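(* Let $n\in\mathbb{N}$, $r\in(0,+\infty]$. For each $q\in\mathbb{C}^\times$ there are topological algebra isomorphisms $\mathcal{O}_{\mathrm{def}}(\mathbb{D}_r^n)_q\cong\mathcal{O}_q(\mathbb{D}_r^n)$, $\mathcal{O}^T_{\mathrm{def}}(\mathbb{D}_r^n)_q\cong\mathcal{O}_q(\mathbb{D}_r^n)$ and $\mathcal{O}_{\mathrm{def}}(\mathbb{B}_r^n)_q\cong\mathcal{O}_q(\mathbb{B}_r^n)$, each sending the class of $\zeta_i$ to $x_i$ ($i=1,\dots,n$).
   Context: $\mathbb{C}^\times=\mathbb{C}\setminus\{0\}$; $\mathcal{O}(\mathbb{C}^\times)$ is the Fréchet algebra of holomorphic functions on $\mathbb{C}^\times$, $z$ its coordinate. For a Fréchet algebra $F$, $\mathcal{O}(\mathbb{C}^\times,F)\cong\mathcal{O}(\mathbb{C}^\times)\widehat\otimes F$ (completed projective tensor product). $\mathcal{F}^T(\mathbb{D}_r^n)$, $\mathcal{F}(\mathbb{D}_r^n)$, $\mathcal{F}(\mathbb{B}_r^n)$ are the Fréchet algebras of series $\sum_{\alpha\in W_n}c_\alpha\zeta_\alpha$ over finite words $\alpha$ in $\{1,\dots,n\}$ with multiplication by concatenation and, respectively, norms $\sum|c_\alpha|\rho^{|\alpha|}$ ($\rho<r$); $\sum|c_\alpha|\rho^{|\alpha|}\tau^{s(\alpha)+1}$ ($\rho<r$, $\tau\ge1$), where $s(\alpha)$ is the number of indices $i$ with $\alpha_i\ne\alpha_{i+1}$ (and $s(\alpha)=|\alpha|-1$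 if $|\alpha|\le1$); $\sum_d(\sum_{|\alpha|=d}|c_\alpha|^2)^{1/2}\rho^d$ ($\rho<r$). For $F$ one of these, let $I$ be the closed two-sided ideal of $\mathcal{O}(\mathbb{C}^\times,F)$ generated by $\zeta_i\zeta_j-z\zeta_j\zeta_i$ ($i<j$); $\mathcal{O}_{\mathrm{def}}(\mathbb{D}_r^n)$, $\mathcal{O}^T_{\mathrm{def}}(\mathbb{D}_r^n)$, $\mathcal{O}_{\mathrm{def}}(\mathbb{B}_r^n)$ denote $\mathcal{O}(\mathbb{C}^\times,F)/I$ for $F=\mathcal{F}(\mathbb{D}_r^n)$, $\mathcal{F}^T(\mathbb{D}_r^n)$, $\mathcal{F}(\mathbb{B}_r^n)$ respectively. For a Fréchet $\mathcal{O}(\mathbb{C}^\times)$-algebra $A$ and $q\in\mathbb{C}^\times$, the fiber is $A_q=A/\overline{\mathfrak{m}_qA}$ with $\mathfrak{m}_q=\{f\in\mathcal{O}(\mathbb{C}^\times):f(q)=0\}$. $\mathcal{O}_q(\mathbb{D}_r^n)$ and $\mathcal{O}_q(\mathbb{B}_r^n)$ are the completions of the algebra $\mathcal{O}_q^{\mathrm{reg}}(\mathbb{C}^n)$ (generated by $x_1,\dots,x_n$, $x_ix_j=qx_jx_i$ for $i<j$, basis $x^k$) with respect to the norms $\sum|c_k|w_q(k)\rho^{|k|}$, resp. $\sum|c_k|([k]_{|q|^2}!/[|k|]_{|q|^2}!)^{1/2}|q|^{\sum_{i<j}k_ik_j}\rho^{|k|}$, $\rho\in(0,r)$, where $w_q(k)=1$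 if $|q|\ge1$, $w_q(k)=|q|^{\sum_{i<j}k_ik_j}$ if $|q|<1$, and $[m]_t!=\prod_{j=1}^m(1+t+\dots+t^{j-1})$, $[k]_t!=\prod_i[k_i]_t!$. *)

theory Defs
  imports "HOL-Analysis.Analysis"
begin

record 'a talg =
  ta_carrier :: "'a set"
  ta_add :: "'a \<Rightarrow> 'a \<Rightarrow> 'a"
  ta_mul :: "'a \<Rightarrow> 'a \<Rightarrow> 'a"
  ta_smul :: "complex \<Rightarrow> 'a \<Rightarrow> 'a"
  ta_zero :: 'a
  ta_one :: 'a
  ta_act :: "(complex \<Rightarrow> complex) \<Rightarrow> 'a \<Rightarrow> 'a"
  ta_top :: "'a topology"

text \<open>Topology on a set X given by a family of (pseudo-)distances d(y,x) = p(y - x).\<close>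
definition semi_top :: "'a set \<Rightarrow> ('a \<Rightarrow> 'a \<Rightarrow> ennreal) set \<Rightarrow> 'a topology" where
  "semi_top X D = topology (\<lambda>U. U \<subseteq> X \<and> (\<forall>x\<in>U. \<exists>D0 (\<epsilon>::real). finite D0 \<and> D0 \<subseteq> D \<and> \<epsilon> > 0
       \<and> {y\<in>X. \<forall>d\<in>D0. d y x < ennreal \<epsilon>} \<subseteq> U))"

definition coset :: "('a, 'b) talg_scheme \<Rightarrow> 'a set \<Rightarrow> 'a \<Rightarrow> 'a set" where
  "coset A J x = {ta_add A x j | j. j \<in> J}"

definition quot :: "('a, 'b) talg_scheme \<Rightarrow> 'a set \<Rightarrow> 'a set talg" where
  "quot A J = \<lparr> ta_carrier = coset A J ` ta_carrier A,
     ta_add = (\<lambda>X Y. {ta_add A x y | x y. x \<in> X \<and> y \<in> Y}),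
     ta_mul = (\<lambda>X Y. {ta_add A (ta_mul A x y) j | x y j. x \<in> X \<and> y \<in> Y \<and> j \<in> J}),
     ta_smul = (\<lambda>c X. {ta_add A (ta_smul A c x) j | x j. x \<in> X \<and> j \<in> J}),
     ta_zero = coset A J (ta_zero A),
     ta_one = coset A J (ta_one A),
     ta_act = (\<lambda>h X. {ta_add A (ta_act A h x) j | x j. x \<in> X \<and> j \<in> J}),
     ta_top = topology (\<lambda>V. V \<subseteq> coset A J ` ta_carrier A \<and> openin (ta_top A) (\<Union>V)) \<rparr>"

definition is_ideal :: "('a, 'b) talg_scheme \<Rightarrow> 'a set \<Rightarrow> bool" where
  "is_ideal A J \<longleftrightarrow> J \<subseteq> ta_carrier A \<and> ta_zero A \<in> J
     \<and> (\<forall>x\<in>J. \<forall>y\<in>J. ta_add A x y \<in> J) \<and> (\<forall>c. \<forall>x\<in>J. ta_smul A c x \<in> J)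
     \<and> (\<forall>a\<in>ta_carrier A. \<forall>x\<in>J. ta_mul A a x \<in> J \<and> ta_mul A x a \<in> J)"

definition closed_ideal_gen :: "('a, 'b) talg_scheme \<Rightarrow> 'a set \<Rightarrow> 'a set" where
  "closed_ideal_gen A G = \<Inter>{J. is_ideal A J \<and> closedin (ta_top A) J \<and> G \<subseteq> J}"

definition fiber_ideal :: "('a, 'b) talg_scheme \<Rightarrow> complex \<Rightarrow> 'a set" where
  "fiber_ideal A q = (ta_top A) closure_of
     (\<Inter>{S. S \<subseteq> ta_carrier A \<and> ta_zero A \<in> S \<and> (\<forall>x\<in>S. \<forall>y\<in>S. ta_add A x y \<in> S)
        \<and> (\<forall>h a. h holomorphic_on (- {0}) \<and> h q = 0 \<and> a \<in> ta_carrier A \<longrightarrow> ta_act A h a \<in> S)})"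

definition fiber :: "('a, 'b) talg_scheme \<Rightarrow> complex \<Rightarrow> 'a set talg" where
  "fiber A q = quot A (fiber_ideal A q)"

definition talg_iso :: "('a, 'b) talg_scheme \<Rightarrow> ('c, 'd) talg_scheme \<Rightarrow> ('a \<Rightarrow> 'c) \<Rightarrow> bool" where
  "talg_iso A B \<Phi> \<longleftrightarrow> bij_betw \<Phi> (ta_carrier A) (ta_carrier B)
     \<and> (\<forall>x\<in>ta_carrier A. \<forall>y\<in>ta_carrier A. \<Phi> (ta_add A x y) = ta_add B (\<Phi> x) (\<Phi> y)
                                      \<and> \<Phi> (ta_mul A x y) = ta_mul B (\<Phi> x) (\<Phi> y))
     \<and> (\<forall>c. \<forall>x\<in>ta_carrier A. \<Phi> (ta_smul A c x) = ta_smul B c (\<Phi> x))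
     \<and> \<Phi> (ta_one A) = ta_one B
     \<and> homeomorphic_map (ta_top A) (ta_top B) \<Phi>"

definition words :: "nat \<Rightarrow> nat list set" where
  "words n = {\<alpha>. set \<alpha> \<subseteq> {..<n}}"

text \<open>s(alpha)+1 (with s(alpha) = |alpha|-1 for |alpha| <= 1)\<close>
definition sp1 :: "nat list \<Rightarrow> nat" where
  "sp1 \<alpha> = (if \<alpha> = [] then 0 else 1 + card {i. Suc i < length \<alpha> \<and> \<alpha> ! i \<noteq> \<alpha> ! Suc i})"

definition FT_norms :: "nat \<Rightarrow> ereal \<Rightarrow> ((nat list \<Rightarrow> complex) \<Rightarrow> ennreal) set" where
  "FT_norms n r = {(\<lambda>c. \<Sum>\<^sub>\<infinity>\<alpha>\<in>words n. ennreal (norm (c \<alpha>) * \<rho> ^ length \<alpha>)) | \<rho>.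
      0 < \<rho> \<and> ereal \<rho> < r}"

definition FD_norms :: "nat \<Rightarrow> ereal \<Rightarrow> ((nat list \<Rightarrow> complex) \<Rightarrow> ennreal) set" where
  "FD_norms n r = {(\<lambda>c. \<Sum>\<^sub>\<infinity>\<alpha>\<in>words n. ennreal (norm (c \<alpha>) * \<rho> ^ length \<alpha> * \<tau> ^ sp1 \<alpha>)) | \<rho> \<tau>.
      0 < \<rho> \<and> ereal \<rho> < r \<and> 1 \<le> \<tau>}"

definition FB_norms :: "nat \<Rightarrow> ereal \<Rightarrow> ((nat list \<Rightarrow> complex) \<Rightarrow> ennreal) set" where
  "FB_norms n r = {(\<lambda>c. \<Sum>\<^sub>\<infinity>d\<in>(UNIV::nat set).
        ennreal (sqrt (\<Sum>\<alpha>\<in>{\<alpha>\<in>words n. length \<alpha> = d}. (norm (c \<alpha>))\<^sup>2) * \<rho> ^ d)) | \<rho>.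
      0 < \<rho> \<and> ereal \<rho> < r}"

definition Fcar :: "nat \<Rightarrow> ((nat list \<Rightarrow> complex) \<Rightarrow> ennreal) set \<Rightarrow> (nat list \<Rightarrow> complex) set" where
  "Fcar n P = {c. (\<forall>\<alpha>. \<alpha> \<notin> words n \<longrightarrow> c \<alpha> = 0) \<and> (\<forall>p\<in>P. p c < top)}"

definition Fhol :: "nat \<Rightarrow> ((nat list \<Rightarrow> complex) \<Rightarrow> ennreal) set \<Rightarrow> (complex \<Rightarrow> nat list \<Rightarrow> complex) \<Rightarrow> bool" where
  "Fhol n P f \<longleftrightarrow> (\<forall>z. z \<noteq> 0 \<longrightarrow> f z \<in> Fcar n P)
     \<and> (\<forall>z0. z0 \<noteq> 0 \<longrightarrow> (\<exists>g\<in>Fcar n P. \<forall>p\<in>P.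
          ((\<lambda>z. p (\<lambda>\<alpha>. (f z \<alpha> - f z0 \<alpha>) / (z - z0) - g \<alpha>)) \<longlongrightarrow> 0) (at z0)))"

text \<open>Functions are normalised to be 0 at the point 0 (outside C^x).\<close>
definition Ocar :: "nat \<Rightarrow> ((nat list \<Rightarrow> complex) \<Rightarrow> ennreal) set \<Rightarrow> (complex \<Rightarrow> nat list \<Rightarrow> complex) set" where
  "Ocar n P = {f. f 0 = (\<lambda>\<alpha>. 0) \<and> Fhol n P f}"

definition Odist :: "((nat list \<Rightarrow> complex) \<Rightarrow> ennreal) set
     \<Rightarrow> ((complex \<Rightarrow> nat list \<Rightarrow> complex) \<Rightarrow> (complex \<Rightarrow> nat list \<Rightarrow> complex) \<Rightarrow> ennreal) set" where
  "Odist P = {(\<lambda>f g. SUP z\<in>K. p (\<lambda>\<alpha>. f z \<alpha> - g z \<alpha>)) | K p. compact K \<and> K \<subseteq> - {0} \<and> p \<in> P}"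

definition Oalg :: "nat \<Rightarrow> ((nat list \<Rightarrow> complex) \<Rightarrow> ennreal) set \<Rightarrow> (complex \<Rightarrow> nat list \<Rightarrow> complex) talg" where
  "Oalg n P = \<lparr> ta_carrier = Ocar n P,
     ta_add = (\<lambda>f g z \<alpha>. f z \<alpha> + g z \<alpha>),
     ta_mul = (\<lambda>f g z \<gamma>. \<Sum>i\<le>length \<gamma>. f z (take i \<gamma>) * g z (drop i \<gamma>)),
     ta_smul = (\<lambda>c f z \<alpha>. c * f z \<alpha>),
     ta_zero = (\<lambda>z \<alpha>. 0),
     ta_one = (\<lambda>z \<alpha>. if z \<noteq> 0 \<and> \<alpha> = [] then 1 else 0),
     ta_act = (\<lambda>h f z \<alpha>. h z * f z \<alpha>),
     ta_top = semi_top (Ocar n P) (Odist P) \<rparr>"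

definition zeta :: "nat \<Rightarrow> complex \<Rightarrow> nat list \<Rightarrow> complex" where
  "zeta i = (\<lambda>z \<alpha>. if z \<noteq> 0 \<and> \<alpha> = [i] then 1 else 0)"

text \<open>generators zeta_i zeta_j - z zeta_j zeta_i, i < j\<close>
definition qgens :: "nat \<Rightarrow> (complex \<Rightarrow> nat list \<Rightarrow> complex) set" where
  "qgens n = {(\<lambda>z \<alpha>. if z = 0 then 0
                     else (if \<alpha> = [i, j] then 1 else 0) - (if \<alpha> = [j, i] then z else 0)) | i j.
              i < j \<and> j < n}"

definition def_ideal :: "nat \<Rightarrow> ((nat list \<Rightarrow> complex) \<Rightarrow> ennreal) set \<Rightarrow> (complex \<Rightarrow> nat list \<Rightarrow> complex) set" where
  "def_ideal n P = closed_ideal_gen (Oalg n P) (qgens n)"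

definition Odef :: "nat \<Rightarrow> ((nat list \<Rightarrow> complex) \<Rightarrow> ennreal) set \<Rightarrow> (complex \<Rightarrow> nat list \<Rightarrow> complex) set talg" where
  "Odef n P = quot (Oalg n P) (def_ideal n P)"

definition zeta_cls :: "nat \<Rightarrow> ((nat list \<Rightarrow> complex) \<Rightarrow> ennreal) set \<Rightarrow> complex \<Rightarrow> nat
     \<Rightarrow> (complex \<Rightarrow> nat list \<Rightarrow> complex) set set" where
  "zeta_cls n P q i = coset (Odef n P) (fiber_ideal (Odef n P) q) (coset (Oalg n P) (def_ideal n P) (zeta i))"

definition midx :: "nat \<Rightarrow> (nat \<Rightarrow> nat) set" where
  "midx n = {k. \<forall>i\<ge>n. k i = 0}"

definition mdeg :: "nat \<Rightarrow> (nat \<Rightarrow> nat) \<Rightarrow> nat" where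
  "mdeg n k = (\<Sum>i<n. k i)"

definition cross :: "nat \<Rightarrow> (nat \<Rightarrow> nat) \<Rightarrow> nat" where
  "cross n k = (\<Sum>i<n. \<Sum>j<n. if i < j then k i * k j else 0)"

definition wq :: "complex \<Rightarrow> nat \<Rightarrow> (nat \<Rightarrow> nat) \<Rightarrow> real" where
  "wq q n k = (if norm q \<ge> 1 then 1 else norm q ^ cross n k)"

definition qfact :: "real \<Rightarrow> nat \<Rightarrow> real" where
  "qfact t m = (\<Prod>j\<in>{1..m}. \<Sum>i<j. t ^ i)"

definition qmfact :: "real \<Rightarrow> nat \<Rightarrow> (nat \<Rightarrow> nat) \<Rightarrow> real" where
  "qmfact t n k = (\<Prod>i<n. qfact t (k i))"

definition ball_w :: "complex \<Rightarrow> nat \<Rightarrow> (nat \<Rightarrow> nat) \<Rightarrow> real" where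
  "ball_w q n k = sqrt (qmfact ((norm q)\<^sup>2) n k / qfact ((norm q)\<^sup>2) (mdeg n k)) * norm q ^ cross n k"

definition Oq_norms :: "nat \<Rightarrow> ((nat \<Rightarrow> nat) \<Rightarrow> real) \<Rightarrow> ereal \<Rightarrow> (((nat \<Rightarrow> nat) \<Rightarrow> complex) \<Rightarrow> ennreal) set" where
  "Oq_norms n w r = {(\<lambda>c. \<Sum>\<^sub>\<infinity>k\<in>midx n. ennreal (norm (c k) * w k * \<rho> ^ mdeg n k)) | \<rho>.
      0 < \<rho> \<and> ereal \<rho> < r}"

text \<open>Completion of O_q^reg(C^n) w.r.t. the weighted l1 norms, realised as coefficient families.\<close>
definition Oq_car :: "nat \<Rightarrow> ((nat \<Rightarrow> nat) \<Rightarrow> real) \<Rightarrow> ereal \<Rightarrow> ((nat \<Rightarrow> nat) \<Rightarrow> complex) set" where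
  "Oq_car n w r = {c. (\<forall>k. k \<notin> midx n \<longrightarrow> c k = 0) \<and> (\<forall>p\<in>Oq_norms n w r. p c < top)}"

text \<open>x^k x^l = q^(- sum_{i>j} k_i l_j) x^(k+l), from x_i x_j = q x_j x_i (i<j).\<close>
definition Oq_alg :: "nat \<Rightarrow> ((nat \<Rightarrow> nat) \<Rightarrow> real) \<Rightarrow> ereal \<Rightarrow> complex \<Rightarrow> ((nat \<Rightarrow> nat) \<Rightarrow> complex) talg" where
  "Oq_alg n w r q = \<lparr> ta_carrier = Oq_car n w r,
     ta_add = (\<lambda>c d k. c k + d k),
     ta_mul = (\<lambda>c d m. \<Sum>k\<in>{k. \<forall>i. k i \<le> m i}.
        c k * d (\<lambda>i. m i - k i) / q ^ (\<Sum>i<n. \<Sum>j<n. if j < i then k i * (m j - k j) else 0)),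
     ta_smul = (\<lambda>a c k. a * c k),
     ta_zero = (\<lambda>k. 0),
     ta_one = (\<lambda>k. if k = (\<lambda>_. 0) then 1 else 0),
     ta_act = (\<lambda>h c. c),
     ta_top = semi_top (Oq_car n w r) {(\<lambda>c d. p (\<lambda>k. c k - d k)) | p. p \<in> Oq_norms n w r} \<rparr>"

definition Oq_D :: "nat \<Rightarrow> ereal \<Rightarrow> complex \<Rightarrow> ((nat \<Rightarrow> nat) \<Rightarrow> complex) talg" where
  "Oq_D n r q = Oq_alg n (wq q n) r q"

definition Oq_B :: "nat \<Rightarrow> ereal \<Rightarrow> complex \<Rightarrow> ((nat \<Rightarrow> nat) \<Rightarrow> complex) talg" where
  "Oq_B n r q = Oq_alg n (ball_w q n) r q"

definition xq :: "nat \<Rightarrow> (nat \<Rightarrow> nat) \<Rightarrow> complex" where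
  "xq i = (\<lambda>k. if k = (\<lambda>j. if j = i then 1 else 0) then 1 else 0)"

end

theory Submission
  imports Defs
begin

text \<open>
  Evaluation at \<open>q\<close> followed by \<open>\<phi>(c)\<^sub>k = (\<Sum>\<alpha>. c\<^sub>\<alpha> q\<^bsup>-inv \<alpha>\<^esup>)\<close>, the sum being over the words \<open>\<alpha>\<close> of
  content \<open>k\<close> and \<open>inv \<alpha>\<close> counting inversions, is a continuous homomorphism
  \<open>\<pi>\<close> from \<open>O(C\<^sup>\<times>, F)\<close> to \<open>O\<^sub>q\<close>. A bounded section of \<open>\<phi>\<close>, used through constant functions,
  makes \<open>\<pi>\<close> surjective and open. It remains to identify the preimage of the fiber
  ideal with the kernel of \<open>\<pi>\<close>. A function \<open>f\<close> in the kernel is a limit, uniformly on compact sets, of its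
  truncations to words of bounded length. Modulo the defining ideal every word \<open>\<alpha>\<close> equals
  \<open>z\<^bsup>-inv \<alpha>\<^esup>\<close> times its sorted rearrangement, so each truncation becomes a finite combination of
  sorted words whose coefficients are the scalar functions \<open>(\<Sum>\<alpha>. f\<^sub>\<alpha>(z) z\<^bsup>-inv \<alpha>\<^esup>)\<close>, and these vanish
  at \<open>q\<close>.

  For the polydisc the section takes the word of content \<open>k\<close> with the fewest or with the most
  inversions. For the ball it is the orthogonal one, and the weight is
  \<open>(\<Sum>\<alpha>. |q|\<^bsup>-2 inv \<alpha>\<^esup>)\<^bsup>-1/2\<^esup>\<close>, which the \<open>q\<close>-multinomial theorem evaluates.
\<close>

section \<open>Open homomorphisms and quotients\<close>

text \<open>The fiber ideal is a closure and \<open>J\<close> an intersection, so neither comes with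
  a description of its elements. That they lie in a kernel is formal; the converse for the fiber
  ideal needs only finite sums, because the closure absorbs the tails. Inversions enter because
  zeta_b zeta_a equals (1/z) zeta_a zeta_b modulo \<open>J\<close> for a < b, so each swap towards
  the sorted word costs one factor 1/z. The weights of the target are quotient norms. Among
  coefficients on the words of one content with prescribed image, the least l1 norm is governed by
  the minimum of |q|^inv, and the least l2 norm by the dual norm of the functional. The sections
  attain these minima. The parameter \<tau> does not change the fiber since the words used by the
  section have at most n blocks of equal letters, which costs a bounded factor \<tau>^n. For the
  ball, the source is l2 and the target l1 in each degree; there are only polynomially many contents
  of degree d, so a slightly larger radius pays for the difference.\<close>

lemma openin_semi_top:
  "openin (semi_top X D) U \<longleftrightarrow> U \<subseteq> X \<and> (\<forall>x\<in>U. \<exists>D0 (\<epsilon>::real). finite D0 \<and> D0 \<subseteq> D \<and> \<epsilon> > 0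
       \<and> {y\<in>X. \<forall>d\<in>D0. d y x < ennreal \<epsilon>} \<subseteq> U)"
proof -
  let ?P = "\<lambda>U x D0 \<epsilon>. finite D0 \<and> D0 \<subseteq> D \<and> \<epsilon> > 0 \<and> {y\<in>X. \<forall>d\<in>D0. d y x < ennreal \<epsilon>} \<subseteq> U"
  let ?L = "\<lambda>U. U \<subseteq> X \<and> (\<forall>x\<in>U. \<exists>D0 (\<epsilon>::real). ?P U x D0 \<epsilon>)"
  have "istopology ?L"
    unfolding istopology_def
  proof (intro conjI allI impI)
    fix S T assume S: "?L S" and T: "?L T"
    show "S \<inter> T \<subseteq> X" using S by blast
    show "\<forall>x\<in>S \<inter> T. \<exists>D0 (\<epsilon>::real). ?P (S \<inter> T) x D0 \<epsilon>"
    proof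
      fix x assume x: "x \<in> S \<inter> T"
      obtain D1 and e1 :: real where 1: "?P S x D1 e1"
        using bspec[OF conjunct2[OF S] IntD1[OF x]] by (elim exE) (rule that)
      obtain D2 and e2 :: real where 2: "?P T x D2 e2"
        using bspec[OF conjunct2[OF T] IntD2[OF x]] by (elim exE) (rule that)
      have "{y\<in>X. \<forall>d\<in>D1\<union>D2. d y x < ennreal (min e1 e2)} \<subseteq> S \<inter> T"
      proof
        fix y assume y: "y \<in> {y\<in>X. \<forall>d\<in>D1\<union>D2. d y x < ennreal (min e1 e2)}"
        have "ennreal (min e1 e2) \<le> ennreal e1" "ennreal (min e1 e2) \<le> ennreal e2"
          by (auto intro: ennreal_leI)
        then have "\<forall>d\<in>D1. d y x < ennreal e1" "\<forall>d\<in>D2. d y x < ennreal e2"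
          using y order_less_le_trans by blast+
        then show "y \<in> S \<inter> T" using y 1 2 by blast
      qed
      then have "?P (S \<inter> T) x (D1 \<union> D2) (min e1 e2)" using 1 2 by simp
      then show "\<exists>D0 (\<epsilon>::real). ?P (S \<inter> T) x D0 \<epsilon>" by blast
    qed
  next
    fix K assume K: "\<forall>U\<in>K. ?L U"
    show "\<Union>K \<subseteq> X" using K by blast
    show "\<forall>x\<in>\<Union>K. \<exists>D0 (\<epsilon>::real). ?P (\<Union>K) x D0 \<epsilon>"
    proof
      fix x assume "x \<in> \<Union>K"
      then obtain U where U: "U \<in> K" "x \<in> U" by blast
      obtain D0 and \<epsilon> :: real where "?P U x D0 \<epsilon>"
        using bspec[OF conjunct2[OF K[rule_format, OF U(1)]] U(2)] by (elim exE) (rule that)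
      then have "?P (\<Union>K) x D0 \<epsilon>" using U by blast
      then show "\<exists>D0 (\<epsilon>::real). ?P (\<Union>K) x D0 \<epsilon>" by blast
    qed
  qed
  then show ?thesis unfolding semi_top_def by (simp add: topology_inverse')
qed

lemma topspace_semi_top [simp]: "topspace (semi_top X D) = X"
proof -
  have "{y \<in> X. \<forall>d\<in>{}. d y x < ennreal 1} \<subseteq> X" for x by blast
  then have "openin (semi_top X D) X"
    unfolding openin_semi_top
    by (intro conjI ballI exI[of _ "{}"] exI[of _ "1::real"]) auto
  then show ?thesis
    by (metis openin_semi_top openin_subset openin_topspace subset_antisym)
qed

text \<open>A Lipschitz criterion: since each target distance is dominated by a single source
  distance, the finitely many that define a neighbourhood of \<open>\<pi> x\<close> pull back to
  finitely many conditions near \<open>x\<close>.\<close>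

lemma continuous_map_semi_top:
  assumes im: "\<And>x. x \<in> X \<Longrightarrow> \<pi> x \<in> Y"
    and lip: "\<And>e. e \<in> E \<Longrightarrow> \<exists>d\<in>D. \<exists>C::real. C > 0 \<and> (\<forall>x\<in>X. \<forall>y\<in>X. e (\<pi> y) (\<pi> x) \<le> ennreal C * d y x)"
  shows "continuous_map (semi_top X D) (semi_top Y E) \<pi>"
  unfolding continuous_map_def topspace_semi_top
proof (intro conjI allI impI)
  show "\<pi> \<in> X \<rightarrow> Y" using im by blast
  fix V assume V: "openin (semi_top Y E) V"
  show "openin (semi_top X D) {x \<in> X. \<pi> x \<in> V}"
    unfolding openin_semi_top
  proof (intro conjI ballI)
    fix x assume x: "x \<in> {x \<in> X. \<pi> x \<in> V}"
    then have "\<pi> x \<in> V" by blast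
    from bspec[OF conjunct2[OF V[unfolded openin_semi_top]] this]
    obtain E0 and \<epsilon> :: real where E0: "finite E0" "E0 \<subseteq> E" "\<epsilon> > 0"
      "{y\<in>Y. \<forall>d\<in>E0. d y (\<pi> x) < ennreal \<epsilon>} \<subseteq> V"
      by (elim exE conjE) (rule that)
    obtain h C where hC: "\<And>e. e \<in> E \<Longrightarrow> h e \<in> D \<and> C e > (0::real) \<and>
        (\<forall>x\<in>X. \<forall>y\<in>X. e (\<pi> y) (\<pi> x) \<le> ennreal (C e) * h e y x)"
      using lip by metis
    \<comment> \<open>The sum dominates every \<open>C e\<close>, so one radius serves all of
      \<open>E0\<close>; the summand 1 keeps the quotient defined for empty \<open>E0\<close> and
      makes the final inequality strict.\<close>
    define \<delta> where "\<delta> = \<epsilon> / (1 + (\<Sum>e\<in>E0. C e))"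
    have Cpos: "(\<Sum>e\<in>E0. C e) \<ge> 0" using hC E0 by (meson less_imp_le subsetD sum_nonneg)
    have dpos: "\<delta> > 0" unfolding \<delta>_def using Cpos E0 by simp
    have "{y \<in> X. \<forall>d\<in>h ` E0. d y x < ennreal \<delta>} \<subseteq> {x \<in> X. \<pi> x \<in> V}"
    proof
      fix y assume y: "y \<in> {y \<in> X. \<forall>d\<in>h ` E0. d y x < ennreal \<delta>}"
      have "e (\<pi> y) (\<pi> x) < ennreal \<epsilon>" if e: "e \<in> E0" for e
      proof -
        have eE: "e \<in> E" using e E0 by blast
        have "C e \<le> (\<Sum>e\<in>E0. C e)" using e E0 hC by (meson less_imp_le member_le_sum subsetD Diff_subset)
        then have "C e * \<delta> \<le> (\<Sum>e\<in>E0. C e) * \<delta>" using dpos by (simp add: mult_right_mono)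
        also have "\<dots> < (1 + (\<Sum>e\<in>E0. C e)) * \<delta>" using dpos by (simp add: algebra_simps)
        also have "\<dots> = \<epsilon>" unfolding \<delta>_def using Cpos by simp
        finally have lt: "C e * \<delta> < \<epsilon>" .
        have "e (\<pi> y) (\<pi> x) \<le> ennreal (C e) * h e y x" using hC eE x y by blast
        also have "\<dots> \<le> ennreal (C e) * ennreal \<delta>"
          using y e by (intro mult_left_mono) (auto simp: less_imp_le)
        also have "\<dots> = ennreal (C e * \<delta>)" using hC[OF eE] dpos by (simp add: ennreal_mult)
        also have "\<dots> < ennreal \<epsilon>" using lt E0 by (simp add: ennreal_lessI)
        finally show ?thesis .
      qed
      then show "y \<in> {x \<in> X. \<pi> x \<in> V}" using y im E0(4) by blast
    qed
    then show "\<exists>D0 (\<epsilon>::real). finite D0 \<and> D0 \<subseteq> D \<and> \<epsilon> > 0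
       \<and> {y\<in>X. \<forall>d\<in>D0. d y x < ennreal \<epsilon>} \<subseteq> {x \<in> X. \<pi> x \<in> V}"
      using E0 hC dpos by (intro exI[of _ "h ` E0"] exI[of _ \<delta>] conjI) auto
  qed blast
qed

text \<open>\<open>\<sigma> x y\<close> is a preimage of \<open>y\<close> chosen relative to a base
  point \<open>x\<close>: it is close to \<open>x\<close> as soon as \<open>y\<close> is close to
  \<open>\<pi> x\<close>. Small balls about \<open>\<pi> x\<close> are thus covered by images of
  small balls about \<open>x\<close>.\<close>

lemma open_map_semi_top:
  assumes im: "\<And>x. x \<in> X \<Longrightarrow> \<pi> x \<in> Y"
    and lift: "\<And>x y. x \<in> X \<Longrightarrow> y \<in> Y \<Longrightarrow> \<sigma> x y \<in> X \<and> \<pi> (\<sigma> x y) = y"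
    and lip: "\<And>d. d \<in> D \<Longrightarrow> \<exists>e\<in>E. \<exists>C::real. C > 0 \<and> (\<forall>x\<in>X. \<forall>y\<in>Y. d (\<sigma> x y) x \<le> ennreal C * e y (\<pi> x))"
  shows "open_map (semi_top X D) (semi_top Y E) \<pi>"
  unfolding open_map_def
proof (intro allI impI)
  fix U assume U: "openin (semi_top X D) U"
  show "openin (semi_top Y E) (\<pi> ` U)"
    unfolding openin_semi_top
  proof (intro conjI ballI)
    show "\<pi> ` U \<subseteq> Y" using U im unfolding openin_semi_top by blast
    fix b assume "b \<in> \<pi> ` U"
    then obtain x where x: "x \<in> U" "b = \<pi> x" by blast
    have xX: "x \<in> X" using x U unfolding openin_semi_top by blast
    from bspec[OF conjunct2[OF U[unfolded openin_semi_top]] x(1)]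
    obtain D0 and \<epsilon> :: real where D0: "finite D0" "D0 \<subseteq> D" "\<epsilon> > 0"
      "{y\<in>X. \<forall>d\<in>D0. d y x < ennreal \<epsilon>} \<subseteq> U"
      by (elim exE conjE) (rule that)
    obtain h C where hC: "\<And>d. d \<in> D \<Longrightarrow> h d \<in> E \<and> C d > (0::real) \<and>
        (\<forall>x\<in>X. \<forall>y\<in>Y. d (\<sigma> x y) x \<le> ennreal (C d) * h d y (\<pi> x))"
      using lip by metis
    define \<delta> where "\<delta> = \<epsilon> / (1 + (\<Sum>e\<in>D0. C e))"
    have Cpos: "(\<Sum>e\<in>D0. C e) \<ge> 0" using hC D0 by (meson less_imp_le subsetD sum_nonneg)
    have dpos: "\<delta> > 0" unfolding \<delta>_def using Cpos D0 by simp
    have "{y \<in> Y. \<forall>d\<in>h ` D0. d y b < ennreal \<delta>} \<subseteq> \<pi> ` U"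
    proof
      fix y assume y: "y \<in> {y \<in> Y. \<forall>d\<in>h ` D0. d y b < ennreal \<delta>}"
      have "d (\<sigma> x y) x < ennreal \<epsilon>" if e: "d \<in> D0" for d
      proof -
        have eE: "d \<in> D" using e D0 by blast
        have "C d \<le> (\<Sum>e\<in>D0. C e)" using e D0 hC by (meson less_imp_le member_le_sum subsetD Diff_subset)
        then have "C d * \<delta> \<le> (\<Sum>e\<in>D0. C e) * \<delta>" using dpos by (simp add: mult_right_mono)
        also have "\<dots> < (1 + (\<Sum>e\<in>D0. C e)) * \<delta>" using dpos by (simp add: algebra_simps)
        also have "\<dots> = \<epsilon>" unfolding \<delta>_def using Cpos by simp
        finally have lt: "C d * \<delta> < \<epsilon>" .
        have "d (\<sigma> x y) x \<le> ennreal (C d) * h d y (\<pi> x)" using hC eE xX y by blast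
        also have "\<dots> \<le> ennreal (C d) * ennreal \<delta>"
          using y e x by (intro mult_left_mono) (auto simp: less_imp_le)
        also have "\<dots> = ennreal (C d * \<delta>)" using hC[OF eE] dpos by (simp add: ennreal_mult)
        also have "\<dots> < ennreal \<epsilon>" using lt D0 by (simp add: ennreal_lessI)
        finally show ?thesis .
      qed
      moreover have \<sigma>: "\<sigma> x y \<in> X" "\<pi> (\<sigma> x y) = y" using lift xX y by auto
      ultimately have "\<sigma> x y \<in> U" using D0(4) by blast
      then show "y \<in> \<pi> ` U" by (rule image_eqI[rotated]) (rule \<sigma>(2)[symmetric])
    qed
    then show "\<exists>D0 (\<epsilon>::real). finite D0 \<and> D0 \<subseteq> E \<and> \<epsilon> > 0
       \<and> {y\<in>Y. \<forall>d\<in>D0. d y b < ennreal \<epsilon>} \<subseteq> \<pi> ` U"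
      using D0 hC dpos by (intro exI[of _ "h ` D0"] exI[of _ \<delta>] conjI) auto
  qed
qed

section \<open>Algebras with a topology, their ideals and quotients\<close>

locale talg =
  fixes A :: "('a, 'b) talg_scheme"
  assumes add_closed: "x \<in> ta_carrier A \<Longrightarrow> y \<in> ta_carrier A \<Longrightarrow> ta_add A x y \<in> ta_carrier A"
    and add_comm: "x \<in> ta_carrier A \<Longrightarrow> y \<in> ta_carrier A \<Longrightarrow> ta_add A x y = ta_add A y x"
    and add_assoc: "x \<in> ta_carrier A \<Longrightarrow> y \<in> ta_carrier A \<Longrightarrow> z \<in> ta_carrier A \<Longrightarrow>
          ta_add A (ta_add A x y) z = ta_add A x (ta_add A y z)"
    and zero_closed: "ta_zero A \<in> ta_carrier A"
    and add_zero: "x \<in> ta_carrier A \<Longrightarrow> ta_add A x (ta_zero A) = x"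
    and add_minus: "x \<in> ta_carrier A \<Longrightarrow> ta_add A x (ta_smul A (-1) x) = ta_zero A"
    and mul_closed: "x \<in> ta_carrier A \<Longrightarrow> y \<in> ta_carrier A \<Longrightarrow> ta_mul A x y \<in> ta_carrier A"
    and mul_add: "x \<in> ta_carrier A \<Longrightarrow> y \<in> ta_carrier A \<Longrightarrow> z \<in> ta_carrier A \<Longrightarrow>
          ta_mul A x (ta_add A y z) = ta_add A (ta_mul A x y) (ta_mul A x z)"
    and add_mul: "x \<in> ta_carrier A \<Longrightarrow> y \<in> ta_carrier A \<Longrightarrow> z \<in> ta_carrier A \<Longrightarrow>
          ta_mul A (ta_add A x y) z = ta_add A (ta_mul A x z) (ta_mul A y z)"
    and smul_closed: "x \<in> ta_carrier A \<Longrightarrow> ta_smul A c x \<in> ta_carrier A"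
    and smul_add: "x \<in> ta_carrier A \<Longrightarrow> y \<in> ta_carrier A \<Longrightarrow>
          ta_smul A c (ta_add A x y) = ta_add A (ta_smul A c x) (ta_smul A c y)"
    and one_closed: "ta_one A \<in> ta_carrier A"
    and topspace_eq: "topspace (ta_top A) = ta_carrier A"

locale talg_ideal = talg +
  fixes J
  assumes ideal: "is_ideal A J"
begin

lemma J_carrier: "j \<in> J \<Longrightarrow> j \<in> ta_carrier A" using ideal unfolding is_ideal_def by blast
lemma J_zero: "ta_zero A \<in> J" using ideal unfolding is_ideal_def by blast
lemma J_add: "x \<in> J \<Longrightarrow> y \<in> J \<Longrightarrow> ta_add A x y \<in> J" using ideal unfolding is_ideal_def by blast
lemma J_smul: "x \<in> J \<Longrightarrow> ta_smul A c x \<in> J" using ideal unfolding is_ideal_def by blast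
lemma J_mul_left: "a \<in> ta_carrier A \<Longrightarrow> x \<in> J \<Longrightarrow> ta_mul A a x \<in> J"
  using ideal unfolding is_ideal_def by blast
lemma J_mul_right: "a \<in> ta_carrier A \<Longrightarrow> x \<in> J \<Longrightarrow> ta_mul A x a \<in> J"
  using ideal unfolding is_ideal_def by blast

lemma coset_sub: "x \<in> ta_carrier A \<Longrightarrow> coset A J x \<subseteq> ta_carrier A"
  unfolding coset_def using add_closed J_carrier by blast

lemma coset_self: "x \<in> ta_carrier A \<Longrightarrow> x \<in> coset A J x"
  unfolding coset_def using J_zero add_zero by force

lemma coset_absorb:
  assumes x: "x \<in> ta_carrier A" and y: "y \<in> coset A J x"
  shows "coset A J y = coset A J x"
proof -
  obtain j where j: "j \<in> J" "y = ta_add A x j" using y unfolding coset_def by blast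
  have "ta_add A y i \<in> coset A J x" if "i \<in> J" for i
    using that j x add_assoc J_carrier J_add unfolding coset_def by blast
  moreover have "ta_add A x i \<in> coset A J y" if i: "i \<in> J" for i
  proof -
    let ?m = "ta_smul A (-1) j"
    have m: "?m \<in> J" using j J_smul by blast
    have c: "x \<in> ta_carrier A" "j \<in> ta_carrier A" "?m \<in> ta_carrier A" "i \<in> ta_carrier A"
      using x j m i J_carrier by auto
    have "ta_add A y (ta_add A ?m i) = ta_add A x (ta_add A (ta_add A j ?m) i)"
      using c j by (simp add: add_assoc add_closed)
    also have "\<dots> = ta_add A x i" using c by (simp add: add_minus add_comm add_zero zero_closed)
    finally show ?thesis unfolding coset_def using m i J_add by (metis (mono_tags, lifting) mem_Collect_eq)
  qed
  ultimately show ?thesis unfolding coset_def by blast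
qed

lemma coset_add_closed:
  assumes x: "x \<in> ta_carrier A" and y: "y \<in> coset A J x" and j: "j \<in> J"
  shows "ta_add A y j \<in> coset A J x"
proof -
  have "ta_add A y j \<in> coset A J y" unfolding coset_def using j by blast
  then show ?thesis using coset_absorb[OF x y] by simp
qed

lemma coset_add_J: "x \<in> ta_carrier A \<Longrightarrow> j \<in> J \<Longrightarrow> coset A J (ta_add A x j) = coset A J x"
  by (rule coset_absorb) (auto simp: coset_def)

lemma coset_J: "j \<in> J \<Longrightarrow> coset A J j = coset A J (ta_zero A)"
  using coset_add_J[OF zero_closed, of j] add_comm[OF zero_closed J_carrier] add_zero[OF J_carrier] by metis

lemma quot_carrier: "ta_carrier (quot A J) = coset A J ` ta_carrier A"
  by (simp add: quot_def)

lemma quot_zero: "ta_zero (quot A J) = coset A J (ta_zero A)"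
  by (simp add: quot_def)

lemma quot_one: "ta_one (quot A J) = coset A J (ta_one A)"
  by (simp add: quot_def)

lemma quot_add:
  assumes x: "x \<in> ta_carrier A" and y: "y \<in> ta_carrier A"
  shows "ta_add (quot A J) (coset A J x) (coset A J y) = coset A J (ta_add A x y)"
proof -
  have "ta_add A (ta_add A x j) (ta_add A y i) = ta_add A (ta_add A x y) (ta_add A j i)"
    if "j \<in> J" "i \<in> J" for i j
  proof -
    have c: "j \<in> ta_carrier A" "i \<in> ta_carrier A" using that J_carrier by auto
    have "ta_add A (ta_add A x j) (ta_add A y i) = ta_add A x (ta_add A (ta_add A j y) i)"
      using x y c by (simp add: add_assoc add_closed)
    also have "ta_add A j y = ta_add A y j" using y c add_comm by blast
    finally show ?thesis using x y c by (simp add: add_assoc add_closed)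
  qed
  note * = this
  have "ta_add A (ta_add A x y) j \<in> {ta_add A a b |a b. a \<in> coset A J x \<and> b \<in> coset A J y}"
    if "j \<in> J" for j
    using that x y coset_self[OF x] add_assoc J_carrier unfolding coset_def by blast
  then show ?thesis
    unfolding quot_def coset_def using * J_add by (auto 4 3)
qed

text \<open>The products of elements of two cosets need not fill a coset, which is why
  \<open>quot\<close> adds all of \<open>J\<close> to them. Expanding (x + j)(y + i) leaves the
  error jy + xi + ji, which a two-sided ideal absorbs.\<close>

lemma quot_mul:
  assumes x: "x \<in> ta_carrier A" and y: "y \<in> ta_carrier A"
  shows "ta_mul (quot A J) (coset A J x) (coset A J y) = coset A J (ta_mul A x y)"
proof -
  have "ta_mul A x' y' \<in> coset A J (ta_mul A x y)" if x': "x' \<in> coset A J x" and y': "y' \<in> coset A J y" for x' y'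
  proof -
    obtain j i where ji: "j \<in> J" "i \<in> J" "x' = ta_add A x j" "y' = ta_add A y i"
      using x' y' unfolding coset_def by blast
    have c: "j \<in> ta_carrier A" "i \<in> ta_carrier A" using ji J_carrier by auto
    have "ta_mul A x' y' = ta_add A (ta_mul A x y) (ta_add A (ta_mul A j y) (ta_add A (ta_mul A x i) (ta_mul A j i)))"
      using x y c ji by (simp add: add_assoc add_closed mul_closed mul_add add_mul)
    moreover have "ta_add A (ta_mul A j y) (ta_add A (ta_mul A x i) (ta_mul A j i)) \<in> J"
      using ji x y c by (simp add: J_add J_mul_left J_mul_right)
    ultimately show ?thesis unfolding coset_def by blast
  qed
  then have "ta_add A (ta_mul A x' y') k \<in> coset A J (ta_mul A x y)"
    if "x' \<in> coset A J x" "y' \<in> coset A J y" "k \<in> J" for x' y' k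
    using that coset_add_closed[OF mul_closed[OF x y]] by blast
  then show ?thesis
    using coset_self[OF x] coset_self[OF y] unfolding quot_def coset_def[of A J "ta_mul A x y"] by auto
qed

text \<open>Stated for an additive \<open>F\<close> preserving \<open>J\<close> so that scalar
  multiplication and the action of a holomorphic function are both instances.\<close>

lemma coset_image:
  assumes x: "x \<in> ta_carrier A" and F: "\<And>u v. u \<in> ta_carrier A \<Longrightarrow> v \<in> ta_carrier A \<Longrightarrow> F (ta_add A u v) = ta_add A (F u) (F v)"
    and cl: "F x \<in> ta_carrier A" and FJ: "\<And>j. j \<in> J \<Longrightarrow> F j \<in> J"
  shows "{ta_add A (F y) j | y j. y \<in> coset A J x \<and> j \<in> J} = coset A J (F x)"
proof -
  have "F y \<in> coset A J (F x)" if "y \<in> coset A J x" for y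
    using that F x J_carrier FJ unfolding coset_def by blast
  then have "ta_add A (F y) j \<in> coset A J (F x)" if "y \<in> coset A J x" "j \<in> J" for y j
    using that coset_add_closed[OF cl] by blast
  then have "{ta_add A (F y) j | y j. y \<in> coset A J x \<and> j \<in> J} \<subseteq> coset A J (F x)" by blast
  moreover have "coset A J (F x) \<subseteq> {ta_add A (F y) j | y j. y \<in> coset A J x \<and> j \<in> J}"
    using coset_self[OF x] unfolding coset_def[of A J "F x"] by blast
  ultimately show ?thesis by (rule subset_antisym)
qed

lemma quot_smul:
  assumes x: "x \<in> ta_carrier A"
  shows "ta_smul (quot A J) c (coset A J x) = coset A J (ta_smul A c x)"
  using coset_image[where F = "ta_smul A c", OF x smul_add smul_closed[OF x] J_smul] unfolding quot_def by simp

lemma quot_act: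
  assumes x: "x \<in> ta_carrier A"
    and h: "\<And>u v. u \<in> ta_carrier A \<Longrightarrow> v \<in> ta_carrier A \<Longrightarrow> ta_act A h (ta_add A u v) = ta_add A (ta_act A h u) (ta_act A h v)"
      "ta_act A h x \<in> ta_carrier A" "\<And>j. j \<in> J \<Longrightarrow> ta_act A h j \<in> J"
  shows "ta_act (quot A J) h (coset A J x) = coset A J (ta_act A h x)"
  using coset_image[OF x h] unfolding quot_def by simp

lemma coset_disjoint:
  assumes "X \<in> coset A J ` ta_carrier A" "Y \<in> coset A J ` ta_carrier A" "z \<in> X" "z \<in> Y"
  shows "X = Y"
  using assms coset_absorb by (metis imageE)

lemma openin_quot:
  "openin (ta_top (quot A J)) V \<longleftrightarrow> V \<subseteq> coset A J ` ta_carrier A \<and> openin (ta_top A) (\<Union>V)"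
proof -
  have "istopology (\<lambda>V. V \<subseteq> coset A J ` ta_carrier A \<and> openin (ta_top A) (\<Union>V))"
    unfolding istopology_def
  proof (intro conjI allI impI)
    fix S T assume S: "S \<subseteq> coset A J ` ta_carrier A \<and> openin (ta_top A) (\<Union>S)"
      and T: "T \<subseteq> coset A J ` ta_carrier A \<and> openin (ta_top A) (\<Union>T)"
    show "S \<inter> T \<subseteq> coset A J ` ta_carrier A" using S by blast
    \<comment> \<open>Passing to unions respects intersections because distinct cosets are disjoint;
      for arbitrary families of sets this inclusion would fail.\<close>
    have "\<Union>S \<inter> \<Union>T \<subseteq> \<Union>(S \<inter> T)"
    proof
      fix x assume "x \<in> \<Union>S \<inter> \<Union>T"
      then obtain X Y where XY: "X \<in> S" "Y \<in> T" "x \<in> X" "x \<in> Y" by blast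
      then have "X = Y" using S T by (intro coset_disjoint[of X Y x]) auto
      then show "x \<in> \<Union>(S \<inter> T)" using XY by blast
    qed
    then have "\<Union>(S \<inter> T) = \<Union>S \<inter> \<Union>T" by blast
    then show "openin (ta_top A) (\<Union>(S \<inter> T))" using S T by auto
  next
    fix K assume K: "\<forall>S\<in>K. S \<subseteq> coset A J ` ta_carrier A \<and> openin (ta_top A) (\<Union>S)"
    show "\<Union>K \<subseteq> coset A J ` ta_carrier A" using K by blast
    have "\<Union>(\<Union>K) = (\<Union>S\<in>K. \<Union>S)" by blast
    then show "openin (ta_top A) (\<Union>(\<Union>K))" using K by (metis (mono_tags, lifting) openin_Union imageE)
  qed
  then show ?thesis by (simp add: quot_def topology_inverse')
qed

lemma Union_cosets: "\<Union>(coset A J ` ta_carrier A) = ta_carrier A"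
  using coset_self coset_sub by blast

lemma topspace_quot: "topspace (ta_top (quot A J)) = ta_carrier (quot A J)"
proof (rule subset_antisym)
  show "topspace (ta_top (quot A J)) \<subseteq> ta_carrier (quot A J)"
    using openin_topspace openin_quot quot_carrier by metis
  have "openin (ta_top (quot A J)) (ta_carrier (quot A J))"
    unfolding openin_quot quot_carrier using Union_cosets topspace_eq openin_topspace by (metis order_refl)
  then show "ta_carrier (quot A J) \<subseteq> topspace (ta_top (quot A J))" by (rule openin_subset)
qed

text \<open>The fiber is a quotient of a quotient: the theory is applied to \<open>Oalg\<close> and
  once more to \<open>Odef\<close>.\<close>

lemma talg_quot: "talg (quot A J)"
proof
  show "ta_zero (quot A J) \<in> ta_carrier (quot A J)" using zero_closed quot_zero quot_carrier by auto
  show "ta_one (quot A J) \<in> ta_carrier (quot A J)" using one_closed quot_one quot_carrier by auto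
  show "ta_add (quot A J) X Y = ta_add (quot A J) Y X"
    if "X \<in> ta_carrier (quot A J)" "Y \<in> ta_carrier (quot A J)" for X Y
    using that by (clarsimp simp: quot_carrier quot_add) (metis add_comm)
qed (auto simp: quot_carrier quot_add quot_mul quot_smul quot_zero add_closed mul_closed smul_closed zero_closed
      add_assoc add_zero add_minus mul_add add_mul smul_add topspace_quot)

end

section \<open>Open homomorphisms and the homomorphism theorem\<close>

definition open_hom :: "('a, 'b) talg_scheme \<Rightarrow> ('c, 'd) talg_scheme \<Rightarrow> ('a \<Rightarrow> 'c) \<Rightarrow> bool" where
  "open_hom A B \<pi> \<longleftrightarrow> \<pi> ` ta_carrier A = ta_carrier B
     \<and> (\<forall>x\<in>ta_carrier A. \<forall>y\<in>ta_carrier A. \<pi> (ta_add A x y) = ta_add B (\<pi> x) (\<pi> y)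
                                      \<and> \<pi> (ta_mul A x y) = ta_mul B (\<pi> x) (\<pi> y))
     \<and> (\<forall>c. \<forall>x\<in>ta_carrier A. \<pi> (ta_smul A c x) = ta_smul B c (\<pi> x))
     \<and> \<pi> (ta_one A) = ta_one B
     \<and> continuous_map (ta_top A) (ta_top B) \<pi> \<and> open_map (ta_top A) (ta_top B) \<pi>"

text \<open>A continuous open bijection is a homeomorphism. Openness is built into
  \<open>open_hom\<close> for this reason: continuity of an inverse never has to be
  examined.\<close>

lemma open_hom_imp_iso:
  assumes "open_hom A B \<pi>" "inj_on \<pi> (ta_carrier A)"
    "topspace (ta_top A) = ta_carrier A" "topspace (ta_top B) = ta_carrier B"
  shows "talg_iso A B \<pi>"
proof -
  have "homeomorphic_map (ta_top A) (ta_top B) \<pi>"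
    using assms unfolding open_hom_def by (intro bijective_open_imp_homeomorphic_map) auto
  then show ?thesis using assms unfolding open_hom_def talg_iso_def bij_betw_def by simp
qed

text \<open>The choice of a representative is harmless only where \<open>\<pi>\<close> is constant
  on the coset; \<open>induced_coset\<close> is the rule by which the definition is used.\<close>

definition induced :: "('a \<Rightarrow> 'c) \<Rightarrow> 'a set \<Rightarrow> 'c" where
  "induced \<pi> X = \<pi> (SOME x. x \<in> X)"

context talg_ideal
begin

lemma induced_coset:
  assumes "\<And>x j. x \<in> ta_carrier A \<Longrightarrow> j \<in> J \<Longrightarrow> \<pi> (ta_add A x j) = \<pi> x" "x \<in> ta_carrier A"
  shows "induced \<pi> (coset A J x) = \<pi> x"
proof -
  have "(SOME y. y \<in> coset A J x) \<in> coset A J x"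
    using coset_self[OF assms(2)] by (rule someI)
  then show ?thesis unfolding induced_def coset_def using assms by force
qed

text \<open>Open sets of the quotient are families of cosets with open union. Both topological
  claims therefore follow from two set identities, \<open>Un\<close> for preimages and
  \<open>im\<close> for images, which translate them into claims about \<open>\<pi>\<close> on
  \<open>A\<close>.\<close>

lemma open_hom_induced:
  assumes hom: "open_hom A B \<pi>"
    and J: "\<And>x j. x \<in> ta_carrier A \<Longrightarrow> j \<in> J \<Longrightarrow> \<pi> (ta_add A x j) = \<pi> x"
  shows "open_hom (quot A J) B (induced \<pi>)"
proof -
  have ind: "induced \<pi> (coset A J x) = \<pi> x" if "x \<in> ta_carrier A" for x
    using J that by (rule induced_coset)
  have Un: "\<Union>{X \<in> ta_carrier (quot A J). induced \<pi> X \<in> V} = {x \<in> ta_carrier A. \<pi> x \<in> V}" for V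
  proof safe
    fix X x assume "x \<in> X" "X \<in> ta_carrier (quot A J)" "induced \<pi> X \<in> V"
    then obtain y where y: "y \<in> ta_carrier A" "X = coset A J y" "x \<in> coset A J y" unfolding quot_carrier by blast
    have x: "x \<in> ta_carrier A" using coset_sub[OF y(1)] y(3) by blast
    then show "x \<in> ta_carrier A" .
    have "induced \<pi> X = \<pi> x" unfolding y(2) coset_absorb[OF y(1,3), symmetric] by (rule ind[OF x])
    then show "\<pi> x \<in> V" using \<open>induced \<pi> X \<in> V\<close> by simp
  next
    fix x assume "x \<in> ta_carrier A" "\<pi> x \<in> V"
    then show "x \<in> \<Union>{X \<in> ta_carrier (quot A J). induced \<pi> X \<in> V}"
      using coset_self[of x] ind[of x] unfolding quot_carrier by force
  qed
  have im: "induced \<pi> ` V = \<pi> ` (\<Union>V)" if "V \<subseteq> coset A J ` ta_carrier A" for V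
  proof -
    have "induced \<pi> X = \<pi> x" if X: "X \<in> V" "x \<in> X" for X x
    proof -
      obtain y where "y \<in> ta_carrier A" "X = coset A J y" using \<open>V \<subseteq> _\<close> X by blast
      then show ?thesis using X coset_sub coset_absorb ind by (metis subsetD)
    qed
    moreover have "\<exists>x. x \<in> X" if "X \<in> V" for X using that \<open>V \<subseteq> _\<close> coset_self by blast
    ultimately show ?thesis by (auto simp: image_iff) metis+
  qed
  have "continuous_map (ta_top (quot A J)) (ta_top B) (induced \<pi>)"
    unfolding continuous_map_def
  proof (intro conjI allI impI)
    show "induced \<pi> \<in> topspace (ta_top (quot A J)) \<rightarrow> topspace (ta_top B)"
      using hom ind unfolding topspace_quot quot_carrier open_hom_def continuous_map_def topspace_eq by auto
    fix V assume "openin (ta_top B) V"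
    then have "openin (ta_top A) {x \<in> ta_carrier A. \<pi> x \<in> V}"
      using hom topspace_eq unfolding open_hom_def continuous_map_def by auto
    then show "openin (ta_top (quot A J)) {x \<in> topspace (ta_top (quot A J)). induced \<pi> x \<in> V}"
      unfolding openin_quot topspace_quot Un using quot_carrier by auto
  qed
  moreover have "open_map (ta_top (quot A J)) (ta_top B) (induced \<pi>)"
    using hom im unfolding open_map_def openin_quot open_hom_def by auto
  ultimately show ?thesis
    using hom im[of "coset A J ` ta_carrier A"] Union_cosets
    unfolding open_hom_def by (auto simp: quot_carrier quot_add quot_mul quot_smul quot_one ind one_closed
      add_closed mul_closed smul_closed)
qed

end

text \<open>The target of a homomorphism need not be known to be an algebra; only its behaviour at
  \<open>0\<close> enters into the homomorphism theorem.\<close>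

definition zero_laws :: "('c, 'd) talg_scheme \<Rightarrow> bool" where
  "zero_laws B \<longleftrightarrow> (\<forall>b. ta_add B b (ta_zero B) = b \<and> ta_mul B b (ta_zero B) = ta_zero B
     \<and> ta_mul B (ta_zero B) b = ta_zero B \<and> ta_add B b (ta_smul B (-1) b) = ta_zero B)
     \<and> (\<forall>c. ta_smul B c (ta_zero B) = ta_zero B)"

definition hom_ker :: "('a, 'b) talg_scheme \<Rightarrow> ('c, 'd) talg_scheme \<Rightarrow> ('a \<Rightarrow> 'c) \<Rightarrow> 'a set" where
  "hom_ker A B \<pi> = {x \<in> ta_carrier A. \<pi> x = ta_zero B}"

context talg
begin

lemma hom_zero:
  assumes "open_hom A B \<pi>" "zero_laws B"
  shows "\<pi> (ta_zero A) = ta_zero B"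
proof -
  have "\<pi> (ta_zero A) = ta_add B (\<pi> (ta_zero A)) (ta_smul B (-1) (\<pi> (ta_zero A)))"
    using assms(1) add_minus[OF zero_closed] zero_closed smul_closed unfolding open_hom_def by metis
  then show ?thesis using assms(2) unfolding zero_laws_def by simp
qed

lemma is_ideal_hom_ker:
  assumes "open_hom A B \<pi>" "zero_laws B"
  shows "is_ideal A (hom_ker A B \<pi>)"
  unfolding is_ideal_def hom_ker_def
  using hom_zero[OF assms] assms add_closed zero_closed smul_closed mul_closed
  unfolding open_hom_def zero_laws_def by auto

lemma hom_add_ker:
  assumes "open_hom A B \<pi>" "zero_laws B" "x \<in> ta_carrier A" "j \<in> hom_ker A B \<pi>"
  shows "\<pi> (ta_add A x j) = \<pi> x"
  using assms unfolding open_hom_def zero_laws_def hom_ker_def by auto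

text \<open>For injectivity, equal images put x - y into the kernel, and adding it to y gives back
  x.\<close>

lemma quot_hom_ker_iso:
  assumes hom: "open_hom A B \<pi>" and zl: "zero_laws B" and top: "topspace (ta_top B) = ta_carrier B"
  shows "talg_iso (quot A (hom_ker A B \<pi>)) B (induced \<pi>)"
proof -
  let ?K = "hom_ker A B \<pi>"
  interpret I: talg_ideal A ?K
    by unfold_locales (rule is_ideal_hom_ker[OF hom zl])
  note add = hom_add_ker[OF hom zl]
  have "inj_on (induced \<pi>) (ta_carrier (quot A ?K))"
  proof (rule inj_onI)
    fix X Y assume X: "X \<in> ta_carrier (quot A ?K)" and Y: "Y \<in> ta_carrier (quot A ?K)"
      and eq: "induced \<pi> X = induced \<pi> Y"
    obtain x y where xy: "x \<in> ta_carrier A" "y \<in> ta_carrier A" "X = coset A ?K x" "Y = coset A ?K y"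
      using X Y unfolding I.quot_carrier by blast
    have pi: "\<pi> x = \<pi> y" using eq I.induced_coset[of \<pi>, OF add] xy by simp
    let ?j = "ta_add A x (ta_smul A (-1) y)"
    have c: "ta_smul A (-1) y \<in> ta_carrier A" using xy smul_closed by blast
    have "\<pi> ?j = ta_add B (\<pi> y) (ta_smul B (-1) (\<pi> y))"
      using hom xy c pi unfolding open_hom_def by metis
    then have j: "?j \<in> ?K" using zl xy c add_closed unfolding zero_laws_def hom_ker_def by simp
    have "ta_add A y ?j = ta_add A (ta_add A y (ta_smul A (-1) y)) x"
      using xy c by (simp add: add_assoc add_closed add_comm[of x])
    also have "\<dots> = x" using xy zero_closed by (simp add: add_minus add_comm[of _ x] add_zero)
    finally show "X = Y" unfolding xy using I.coset_add_J[OF xy(2) j] by simp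
  qed
  then show ?thesis
    using I.open_hom_induced[OF hom add] I.topspace_quot top by (intro open_hom_imp_iso) auto
qed

end

section \<open>Words and inversions\<close>

fun invs :: "nat list \<Rightarrow> nat" where
  "invs [] = 0"
| "invs (x # xs) = length (filter (\<lambda>y. y < x) xs) + invs xs"

text \<open>The number of inversions between a word of content \<open>k\<close> and a following word
  of content \<open>l\<close>; the same number is the exponent in x^k x^l = q^(-cross2)
  x^(k+l).\<close>

definition cross2 :: "nat \<Rightarrow> (nat \<Rightarrow> nat) \<Rightarrow> (nat \<Rightarrow> nat) \<Rightarrow> nat" where
  "cross2 n k l = (\<Sum>i<n. \<Sum>j<n. if j < i then k i * l j else 0)"

lemma cross_eq_cross2: "cross n k = cross2 n k k"
  unfolding cross_def cross2_def
  by (subst sum.swap) (intro sum.cong refl, simp add: mult.commute)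

lemma cross2_add_left: "cross2 n (\<lambda>i. k i + k' i) l = cross2 n k l + cross2 n k' l"
proof -
  have "cross2 n (\<lambda>i. k i + k' i) l = (\<Sum>i<n. \<Sum>j<n. (if j < i then k i * l j else 0) + (if j < i then k' i * l j else 0))"
    unfolding cross2_def by (intro sum.cong refl) (simp add: add_mult_distrib)
  then show ?thesis unfolding cross2_def by (simp add: sum.distrib)
qed

lemma cross2_add_right: "cross2 n k (\<lambda>i. l i + l' i) = cross2 n k l + cross2 n k l'"
proof -
  have "cross2 n k (\<lambda>i. l i + l' i) = (\<Sum>i<n. \<Sum>j<n. (if j < i then k i * l j else 0) + (if j < i then k i * l' j else 0))"
    unfolding cross2_def by (intro sum.cong refl) (simp add: add_mult_distrib2)
  then show ?thesis unfolding cross2_def by (simp add: sum.distrib)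
qed

lemma Nil_in_words [simp]: "[] \<in> words n"
  and Cons_in_words [simp]: "x # \<alpha> \<in> words n \<longleftrightarrow> x < n \<and> \<alpha> \<in> words n"
  and append_in_words [simp]: "\<alpha> @ \<beta> \<in> words n \<longleftrightarrow> \<alpha> \<in> words n \<and> \<beta> \<in> words n"
  and rev_in_words [simp]: "rev \<alpha> \<in> words n \<longleftrightarrow> \<alpha> \<in> words n"
  and sort_in_words [simp]: "sort \<alpha> \<in> words n \<longleftrightarrow> \<alpha> \<in> words n"
  by (auto simp: words_def)

lemma take_drop_in_words: "\<alpha> \<in> words n \<longleftrightarrow> take i \<alpha> \<in> words n \<and> drop i \<alpha> \<in> words n"
  by (metis append_take_drop_id append_in_words)

definition munit :: "nat \<Rightarrow> nat \<Rightarrow> nat" where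
  "munit x = (\<lambda>j. if j = x then 1 else 0)"

lemma count_list_Cons_fun: "count_list (x # \<alpha>) = (\<lambda>i. munit x i + count_list \<alpha> i)"
  by (auto simp: fun_eq_iff munit_def)

lemma count_list_singleton: "count_list [x] = munit x"
  by (auto simp: fun_eq_iff munit_def)

lemma cross2_unit_left:
  assumes "x < n"
  shows "cross2 n (munit x) l = (\<Sum>j<x. l j)"
proof -
  have "cross2 n (munit x) l = (\<Sum>i<n. if i = x then (\<Sum>j<n. if j < x then l j else 0) else 0)"
    unfolding cross2_def by (intro sum.cong refl) (auto simp: munit_def intro!: sum.cong)
  also have "\<dots> = (\<Sum>j<n. if j < x then l j else 0)" using assms by simp
  also have "\<dots> = (\<Sum>j\<in>{..<n} \<inter> {j. j < x}. l j)" by (simp add: sum.inter_restrict)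
  also have "{..<n} \<inter> {j. j < x} = {..<x}" using assms by auto
  finally show ?thesis .
qed

lemma length_filter_less: "length (filter (\<lambda>y. y < (x::nat)) \<beta>) = (\<Sum>j<x. count_list \<beta> j)"
proof (induction \<beta>)
  case (Cons a \<beta>)
  show ?case using Cons unfolding count_list_Cons_fun by (simp add: sum.distrib munit_def)
qed simp

text \<open>An inversion lies within one factor or across the cut, and the number across depends on
  the contents only. This is what makes \<open>phi\<close> multiplicative.\<close>

lemma invs_append:
  "\<alpha> \<in> words n \<Longrightarrow> invs (\<alpha> @ \<beta>) = invs \<alpha> + invs \<beta> + cross2 n (count_list \<alpha>) (count_list \<beta>)"
proof (induction \<alpha>)
  case Nil
  then show ?case by (simp add: cross2_def)
next
  case (Cons x \<alpha>)
  then show ?case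
    using cross2_unit_left[of x n "count_list \<beta>"] length_filter_less[of x \<beta>]
    unfolding count_list_Cons_fun cross2_add_left by simp
qed

text \<open>Two positions carrying distinct letters form an inversion in exactly one of
  \<open>\<alpha>\<close> and its reversal, and \<open>cross\<close> counts such pairs. So
  \<open>cross\<close> bounds \<open>invs\<close>, with equality for decreasing words.\<close>

lemma invs_rev:
  "\<alpha> \<in> words n \<Longrightarrow> invs \<alpha> + invs (rev \<alpha>) = cross n (count_list \<alpha>)"
proof (induction \<alpha>)
  case Nil
  then show ?case by (simp add: cross_def)
next
  case (Cons x \<alpha>)
  then have x: "x < n" and \<alpha>: "\<alpha> \<in> words n" by auto
  have r: "count_list (rev \<alpha>) = count_list \<alpha>" by (simp add: fun_eq_iff)
  have "cross2 n (munit x) (munit x) = 0" using cross2_unit_left[OF x] by (simp add: munit_def)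
  then have c: "cross n (count_list (x # \<alpha>)) = cross2 n (munit x) (count_list \<alpha>)
      + cross2 n (count_list \<alpha>) (munit x) + cross n (count_list \<alpha>)"
    unfolding cross_eq_cross2 count_list_Cons_fun by (simp only: cross2_add_left cross2_add_right)
  have "invs (x # \<alpha>) = invs \<alpha> + cross2 n (munit x) (count_list \<alpha>)"
    using cross2_unit_left[OF x] by (simp add: length_filter_less)
  moreover have "invs (rev (x # \<alpha>)) = invs (rev \<alpha>) + cross2 n (count_list \<alpha>) (munit x)"
    using invs_append[of "rev \<alpha>" n "[x]"] \<alpha> by (simp only: rev_in_words r count_list_singleton rev.simps) simp
  ultimately show ?case
    using Cons.IH[OF \<alpha>] c by linarith
qed

lemma invs_sorted: "sorted \<alpha> \<Longrightarrow> invs \<alpha> = 0"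
  by (induction \<alpha>) (auto simp: filter_empty_conv)

lemma invs_adjacent_swap:
  assumes "a < b"
  shows "invs (\<alpha> @ [b, a] @ \<beta>) = Suc (invs (\<alpha> @ [a, b] @ \<beta>))"
  using assms by (induction \<alpha>) auto

lemma invs_eq_0_imp_sorted: "invs \<alpha> = 0 \<Longrightarrow> sorted \<alpha>"
  by (induction \<alpha>) (auto simp: filter_empty_conv)

lemma not_sorted_adjacent:
  assumes "\<not> sorted (\<alpha> :: nat list)"
  obtains \<beta> \<gamma> a b where "\<alpha> = \<beta> @ [b, a] @ \<gamma>" "a < b"
proof -
  have "\<exists>\<beta> \<gamma> a b. \<alpha> = \<beta> @ [b, a] @ \<gamma> \<and> a < b"
    using assms
  proof (induction \<alpha> rule: induct_list012)
    case (3 x y zs)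
    show ?case
    proof (cases "x \<le> y")
      case True
      then have "\<not> sorted (y # zs)" using 3(3) by (simp only: sorted2 simp_thms)
      then obtain \<beta> \<gamma> a b where "y # zs = \<beta> @ [b, a] @ \<gamma>" "a < b" using 3(2) by blast
      then show ?thesis by (metis append_Cons)
    next
      case False
      then show ?thesis by (metis append_Cons append_Nil not_le)
    qed
  qed auto
  then show thesis using that by blast
qed

section \<open>Words grouped by degree and by content\<close>

definition wdeg :: "nat \<Rightarrow> nat \<Rightarrow> nat list set" where
  "wdeg n d = {\<alpha> \<in> words n. length \<alpha> = d}"

definition wcls :: "nat \<Rightarrow> (nat \<Rightarrow> nat) \<Rightarrow> nat list set" where
  "wcls n k = {\<alpha> \<in> words n. count_list \<alpha> = k}"

definition kdeg :: "nat \<Rightarrow> nat \<Rightarrow> (nat \<Rightarrow> nat) set" where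
  "kdeg n d = {k \<in> midx n. mdeg n k = d}"

lemma finite_wdeg [simp]: "finite (wdeg n d)"
  using finite_lists_length_eq[of "{..<n}" d] by (simp add: wdeg_def words_def)

lemma mdeg_count_list: "\<alpha> \<in> words n \<Longrightarrow> mdeg n (count_list \<alpha>) = length \<alpha>"
  unfolding mdeg_def words_def by (simp add: sum_count_set)

lemma count_list_midx: "\<alpha> \<in> words n \<Longrightarrow> count_list \<alpha> \<in> midx n"
  unfolding midx_def words_def by (auto simp: count_list_0_iff)

lemma wcls_subset: "wcls n k \<subseteq> wdeg n (mdeg n k)"
  unfolding wcls_def wdeg_def by (auto simp: mdeg_count_list)

lemma finite_wcls [simp]: "finite (wcls n k)"
  by (rule finite_subset[OF wcls_subset finite_wdeg])

lemma wcls_empty: "k \<notin> midx n \<Longrightarrow> wcls n k = {}"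
  unfolding wcls_def using count_list_midx by blast

lemma midx_count_list:
  assumes "k \<in> midx n"
  obtains \<alpha> where "\<alpha> \<in> words n" "sorted \<alpha>" "count_list \<alpha> = k"
proof -
  define \<alpha> where "\<alpha> = concat (map (\<lambda>i. replicate (k i) i) [0..<n])"
  have "count_list (concat (map (\<lambda>i. replicate (k i) i) [0..<m])) j = (if j < m then k j else 0)" for m j
    by (induction m) (auto simp: count_list_0_iff count_list_eq_length_filter less_Suc_eq)
  then have "count_list \<alpha> = k" using assms unfolding \<alpha>_def midx_def by (auto simp: fun_eq_iff)
  moreover have "\<alpha> \<in> words n" unfolding \<alpha>_def words_def by auto
  moreover have "count_list (sort \<alpha>) = count_list \<alpha>"
    by (metis count_mset ext mset_sort)
  ultimately show thesis using that[of "sort \<alpha>"] by simp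
qed

text \<open>\<open>PiE\<close> has a known cardinality, but its functions are
  \<open>undefined\<close> outside \<open>{..<n}\<close>; the map applied to it replaces these
  values by the zeros required in \<open>midx\<close>.\<close>

lemma kdeg_subset: "kdeg n d \<subseteq> (\<lambda>f i. if i < n then f i else 0) ` (PiE {..<n} (\<lambda>_. {..d}))"
proof
  fix k assume k: "k \<in> kdeg n d"
  have "k i \<le> d" if "i < n" for i
    using k that member_le_sum[of i "{..<n}" k] unfolding kdeg_def mdeg_def by auto
  then have "restrict k {..<n} \<in> PiE {..<n} (\<lambda>_. {..d})" by auto
  moreover have "k = (\<lambda>i. if i < n then restrict k {..<n} i else 0)"
    using k unfolding kdeg_def midx_def by (auto simp: fun_eq_iff)
  ultimately show "k \<in> (\<lambda>f i. if i < n then f i else 0) ` (PiE {..<n} (\<lambda>_. {..d}))" by blast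
qed

lemma finite_kdeg [simp]: "finite (kdeg n d)"
  by (rule finite_subset[OF kdeg_subset]) (simp add: finite_PiE)

text \<open>What matters is polynomial growth in \<open>d\<close>, which an arbitrarily small
  enlargement of the radius absorbs in the ball case.\<close>

lemma card_kdeg: "card (kdeg n d) \<le> (d + 1) ^ n"
proof -
  have "card (kdeg n d) \<le> card ((\<lambda>f i. if i < n then f i else 0) ` (PiE {..<n} (\<lambda>_. {..d})))"
    by (rule card_mono[OF _ kdeg_subset]) (simp add: finite_PiE)
  also have "\<dots> \<le> card (PiE {..<n} (\<lambda>_. {..d}))" by (rule card_image_le) (simp add: finite_PiE)
  also have "\<dots> = (d + 1) ^ n" by (simp add: card_PiE)
  finally show ?thesis .
qed

lemma sum_wdeg_group:
  "(\<Sum>\<alpha>\<in>wdeg n d. f \<alpha>) = (\<Sum>k\<in>kdeg n d. \<Sum>\<alpha>\<in>wcls n k. f \<alpha>)"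
proof -
  have "(\<Sum>\<alpha>\<in>wdeg n d. f \<alpha>) = (\<Sum>k\<in>kdeg n d. \<Sum>\<alpha>\<in>{\<alpha>\<in>wdeg n d. count_list \<alpha> = k}. f \<alpha>)"
    by (rule sum.group[OF finite_wdeg finite_kdeg, symmetric]) (auto simp: wdeg_def kdeg_def count_list_midx mdeg_count_list)
  also have "\<dots> = (\<Sum>k\<in>kdeg n d. \<Sum>\<alpha>\<in>wcls n k. f \<alpha>)"
    by (intro sum.cong refl) (auto simp: wdeg_def kdeg_def wcls_def mdeg_count_list)
  finally show ?thesis .
qed

section \<open>The q-multinomial theorem\<close>

lemma qint_sum:
  "(\<Sum>x<(n::nat). (t::real) ^ (\<Sum>j<x. k j) * (\<Sum>i<k x. t ^ i)) = (\<Sum>i<(\<Sum>j<n. k j). t ^ i)"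
proof (induction n)
  case (Suc n)
  \<comment> \<open>The addition rule [a + b] = [a] + t^a [b] for q-integers; iterated, it cuts the
    range into consecutive blocks of lengths \<open>k x\<close>.\<close>
  have "(\<Sum>i<a + b. t ^ i) = (\<Sum>i<a. t ^ i) + t ^ a * (\<Sum>i<b. t ^ i)" for a b :: nat
    by (induction b) (simp_all add: power_add algebra_simps)
  then show ?case using Suc by simp
qed simp

lemma qfact_Suc: "qfact t (Suc m) = (\<Sum>i<Suc m. t ^ i) * qfact t m"
  unfolding qfact_def by (simp add: mult.commute)

lemma wcls_Cons:
  assumes "mdeg n k > 0"
  shows "wcls n k = (\<Union>x\<in>{x. x < n \<and> k x > 0}. (#) x ` wcls n (k(x := k x - 1)))"
proof -
  have "\<alpha> \<in> (\<Union>x\<in>{x. x < n \<and> k x > 0}. (#) x ` wcls n (k(x := k x - 1)))" if \<alpha>: "\<alpha> \<in> wcls n k" for \<alpha>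
  proof (cases \<alpha>)
    case Nil
    then show ?thesis using \<alpha> assms mdeg_count_list[of \<alpha> n] by (auto simp: wcls_def)
  next
    case (Cons x \<beta>)
    then have k: "k = count_list (x # \<beta>)" and w: "x < n" "\<beta> \<in> words n"
      using \<alpha> by (simp_all add: wcls_def)
    have "count_list \<beta> = k(x := k x - 1)" "k x > 0"
      unfolding k by auto
    with w have "x < n" "k x > 0" "\<beta> \<in> words n" "count_list \<beta> = k(x := k x - 1)" by auto
    then show ?thesis unfolding Cons wcls_def by blast
  qed
  moreover have "x # \<beta> \<in> wcls n k" if "x < n" "k x > 0" "\<beta> \<in> wcls n (k(x := k x - 1))" for x \<beta>
    using that by (auto simp: wcls_def fun_eq_iff)
  ultimately show ?thesis by blast
qed

text \<open>Splitting off the first letter gives the \<open>q\<close>-Pascal recursion for the inversion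
  generating function of the words of a given content.\<close>

lemma sum_invs_qmultinomial:
  "k \<in> midx n \<Longrightarrow> (\<Sum>\<alpha>\<in>wcls n k. (t::real) ^ invs \<alpha>) * qmfact t n k = qfact t (mdeg n k)"
proof (induction "mdeg n k" arbitrary: k)
  case 0
  then have k: "k = (\<lambda>_. 0)" unfolding midx_def mdeg_def by (auto simp: fun_eq_iff) (metis lessThan_iff not_le)
  have "wcls n k = {[]}"
    unfolding k wcls_def by (auto simp: fun_eq_iff count_list_0_iff)
  then show ?case using 0 by (simp add: k qmfact_def qfact_def mdeg_def)
next
  case (Suc m)
  let ?X = "{x. x < n \<and> k x > 0}"
  let ?k = "\<lambda>x. k(x := k x - 1)"
  have "(\<Sum>\<alpha>\<in>wcls n k. t ^ invs \<alpha>) = (\<Sum>x\<in>?X. \<Sum>\<alpha>\<in>(#) x ` wcls n (?k x). t ^ invs \<alpha>)"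
    using Suc(2) by (subst wcls_Cons) (auto intro!: sum.UNION_disjoint)
  also have "\<dots> = (\<Sum>x\<in>?X. t ^ (\<Sum>j<x. k j) * (\<Sum>\<beta>\<in>wcls n (?k x). t ^ invs \<beta>))"
  proof (intro sum.cong refl)
    fix x assume "x \<in> ?X"
    have "invs (x # \<beta>) = (\<Sum>j<x. k j) + invs \<beta>" if "\<beta> \<in> wcls n (?k x)" for \<beta>
    proof -
      \<comment> \<open>A leading letter \<open>x\<close> is inverted with each smaller letter after
        it, and removing one \<open>x\<close> does not change the multiplicities of the letters
        below \<open>x\<close>.\<close>
      have "(\<Sum>j<x. count_list \<beta> j) = (\<Sum>j<x. k j)"
        using that by (intro sum.cong refl) (auto simp: wcls_def)
      then show ?thesis by (simp add: length_filter_less)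
    qed
    then show "(\<Sum>\<alpha>\<in>(#) x ` wcls n (?k x). t ^ invs \<alpha>) = t ^ (\<Sum>j<x. k j) * (\<Sum>\<beta>\<in>wcls n (?k x). t ^ invs \<beta>)"
      by (subst sum.reindex) (auto simp: sum_distrib_left power_add)
  qed
  finally have "(\<Sum>\<alpha>\<in>wcls n k. t ^ invs \<alpha>) * qmfact t n k
      = (\<Sum>x\<in>?X. t ^ (\<Sum>j<x. k j) * ((\<Sum>\<beta>\<in>wcls n (?k x). t ^ invs \<beta>) * qmfact t n k))"
    by (simp add: sum_distrib_right mult.assoc)
  also have "\<dots> = (\<Sum>x\<in>?X. t ^ (\<Sum>j<x. k j) * (\<Sum>i<k x. t ^ i) * qfact t m)"
  proof (intro sum.cong refl)
    fix x assume x: "x \<in> ?X"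
    have md: "mdeg n k = k x + (\<Sum>i\<in>{..<n}-{x}. k i)"
      unfolding mdeg_def using x by (subst sum.remove[of _ x]) auto
    have "mdeg n (?k x) = (?k x) x + (\<Sum>i\<in>{..<n}-{x}. ?k x i)"
      unfolding mdeg_def using x by (subst sum.remove[of _ x]) auto
    also have "(\<Sum>i\<in>{..<n}-{x}. ?k x i) = (\<Sum>i\<in>{..<n}-{x}. k i)" by (intro sum.cong) auto
    finally have m: "m = mdeg n (?k x)" using md Suc(2) x by (simp del: fun_upd_apply) (simp add: fun_upd_def)
    have "qmfact t n k = qfact t (k x) * (\<Prod>i\<in>{..<n}-{x}. qfact t (k i))"
      unfolding qmfact_def using x by (subst prod.remove[of _ x]) auto
    moreover have "qmfact t n (?k x) = qfact t (k x - 1) * (\<Prod>i\<in>{..<n}-{x}. qfact t (k i))"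
      unfolding qmfact_def using x by (subst prod.remove[of _ x]) (auto intro!: prod.cong)
    moreover have "qfact t (k x) = (\<Sum>i<k x. t ^ i) * qfact t (k x - 1)"
      using qfact_Suc[of t "k x - 1"] x by (simp del: sum.lessThan_Suc)
    ultimately have q: "qmfact t n k = (\<Sum>i<k x. t ^ i) * qmfact t n (?k x)" by simp
    have "?k x \<in> midx n" using Suc(3) x by (auto simp: midx_def)
    then have IH: "(\<Sum>\<beta>\<in>wcls n (?k x). t ^ invs \<beta>) * qmfact t n (?k x) = qfact t m"
      using Suc(1)[OF m] m by simp
    show "t ^ (\<Sum>j<x. k j) * ((\<Sum>\<beta>\<in>wcls n (?k x). t ^ invs \<beta>) * qmfact t n k)
      = t ^ (\<Sum>j<x. k j) * (\<Sum>i<k x. t ^ i) * qfact t m"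
      unfolding q IH[symmetric] by (simp only: mult_ac)
  qed
  \<comment> \<open>Letters with \<open>k x = 0\<close> may be added back, because their geometric
    sum is empty.\<close>
  also have "\<dots> = (\<Sum>x<n. t ^ (\<Sum>j<x. k j) * (\<Sum>i<k x. t ^ i)) * qfact t m"
    unfolding sum_distrib_right by (rule sum.mono_neutral_left) auto
  also have "\<dots> = qfact t (mdeg n k)"
    unfolding qint_sum Suc(2)[symmetric] qfact_Suc using Suc(2) by (simp add: mdeg_def)
  finally show ?case .
qed

text \<open>Both sides count the maximal blocks of equal letters; the right-hand one comes with a
  recursion.\<close>

lemma sp1_eq: "sp1 \<alpha> = length (remdups_adj \<alpha>)"
proof (induction \<alpha> rule: remdups_adj.induct)
  case (3 x y xs)
  let ?S = "\<lambda>\<alpha>. {i. Suc i < length \<alpha> \<and> \<alpha> ! i \<noteq> \<alpha> ! Suc i}"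
  have "?S (x # y # xs) = (if x = y then {} else {0}) \<union> Suc ` ?S (y # xs)"
  proof (rule set_eqI)
    fix i show "i \<in> ?S (x # y # xs) \<longleftrightarrow> i \<in> (if x = y then {} else {0}) \<union> Suc ` ?S (y # xs)"
      by (cases i) (auto simp: image_iff)
  qed
  moreover have "finite (?S (y # xs))" by (rule finite_subset[of _ "{..<length (y # xs)}"]) auto
  ultimately have "card (?S (x # y # xs)) = (if x = y then 0 else 1) + card (?S (y # xs))"
    by (simp add: card_image)
  then have "sp1 (x # y # xs) = (if x = y then 0 else 1) + sp1 (y # xs)" unfolding sp1_def by simp
  then show ?case using 3 by (auto split: if_splits)
qed (auto simp: sp1_def)

text \<open>Concatenation can at most merge the last block of one word with the first block of the
  next. Hence \<open>\<tau> ^ sp1 \<alpha>\<close> is submultiplicative for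
  \<open>\<tau> \<ge> 1\<close>.\<close>

lemma sp1_append: "sp1 (\<alpha> @ \<beta>) \<le> sp1 \<alpha> + sp1 \<beta>"
proof (induction \<alpha> rule: remdups_adj.induct)
  case (2 x)
  then show ?case unfolding sp1_eq by (cases \<beta>) auto
qed (auto simp: sp1_eq)

text \<open>In a sorted word equal letters are adjacent, so each letter that occurs contributes one
  block.\<close>

lemma sp1_sorted: "sorted \<alpha> \<Longrightarrow> sp1 \<alpha> \<le> card (set \<alpha>)"
  unfolding sp1_eq
proof (induction \<alpha> rule: remdups_adj.induct)
  case (3 x y xs)
  show ?case
  proof (cases "x = y")
    case False
    then have "x \<notin> set (y # xs)" using 3(3) by auto
    then show ?thesis using 3 False by auto
  qed (use 3 in auto)
qed auto

lemma sp1_sorted_le: "sorted \<alpha> \<Longrightarrow> \<alpha> \<in> words n \<Longrightarrow> sp1 \<alpha> \<le> n"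
  using sp1_sorted[of \<alpha>] card_mono[of "{..<n}" "set \<alpha>"] unfolding words_def by simp

lemma sp1_rev: "sp1 (rev \<alpha>) = sp1 \<alpha>"
  by (simp add: sp1_eq)

section \<open>The concatenation product and the map to normal forms\<close>

definition cmul :: "(nat list \<Rightarrow> 'a::comm_semiring_1) \<Rightarrow> (nat list \<Rightarrow> 'a) \<Rightarrow> nat list \<Rightarrow> 'a" where
  "cmul c d = (\<lambda>\<gamma>. \<Sum>i\<le>length \<gamma>. c (take i \<gamma>) * d (drop i \<gamma>))"

text \<open>The substitution of x_i for zeta_i: by x_i x_j = q x_j x_i for i < j, rearranging the
  word \<open>\<alpha>\<close> into increasing order costs a factor 1/q for each inversion.\<close>

definition phi :: "nat \<Rightarrow> complex \<Rightarrow> (nat list \<Rightarrow> complex) \<Rightarrow> (nat \<Rightarrow> nat) \<Rightarrow> complex" where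
  "phi n q c k = (\<Sum>\<alpha>\<in>wcls n k. c \<alpha> / q ^ invs \<alpha>)"

lemma phi_add: "phi n q (\<lambda>\<alpha>. c \<alpha> + d \<alpha>) k = phi n q c k + phi n q d k"
  by (simp add: phi_def add_divide_distrib sum.distrib)

lemma phi_diff: "phi n q (\<lambda>\<alpha>. c \<alpha> - d \<alpha>) k = phi n q c k - phi n q d k"
  by (simp add: phi_def diff_divide_distrib sum_subtractf)

lemma phi_scale: "phi n q (\<lambda>\<alpha>. a * c \<alpha>) k = a * phi n q c k"
  by (simp add: phi_def sum_distrib_left)

lemma phi_single:
  assumes "\<beta> \<in> words n"
  shows "phi n q (\<lambda>\<alpha>. if \<alpha> = \<beta> then a else 0) k = (if k = count_list \<beta> then a / q ^ invs \<beta> else 0)"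
proof -
  have "phi n q (\<lambda>\<alpha>. if \<alpha> = \<beta> then a else 0) k = (\<Sum>\<alpha>\<in>wcls n k. if \<alpha> = \<beta> then a / q ^ invs \<beta> else 0)"
    unfolding phi_def by (intro sum.cong) auto
  also have "\<dots> = (if \<beta> \<in> wcls n k then a / q ^ invs \<beta> else 0)"
    by simp
  finally show ?thesis using assms by (auto simp: wcls_def)
qed

lemma finite_le_midx: "m \<in> midx n \<Longrightarrow> finite {k :: nat \<Rightarrow> nat. \<forall>i. k i \<le> m i}"
proof -
  assume m: "m \<in> midx n"
  have "finite {k :: nat \<Rightarrow> nat. \<forall>i. (i \<in> {..<n} \<longrightarrow> k i \<in> {..mdeg n m}) \<and> (i \<notin> {..<n} \<longrightarrow> k i = 0)}"
    by (rule finite_set_of_finite_funs) auto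
  moreover have "m i \<le> mdeg n m" if "i < n" for i
    unfolding mdeg_def using that by (intro member_le_sum) auto
  then have "{k. \<forall>i. k i \<le> m i} \<subseteq> {k. \<forall>i. (i \<in> {..<n} \<longrightarrow> k i \<in> {..mdeg n m}) \<and> (i \<notin> {..<n} \<longrightarrow> k i = 0)}"
    using m unfolding midx_def by (auto intro: order_trans) (metis le_zero_eq linorder_not_less)
  ultimately show ?thesis by (rule finite_subset[rotated])
qed

text \<open>Cutting a word of content \<open>m\<close> gives two words whose contents add up to
  \<open>m\<close>, and every such pair arises from exactly one cut. By \<open>invs_append\<close>
  the weight of the concatenation is the product of the two weights and the structure constant of
  x^k x^(m-k).\<close>

lemma phi_cmul:
  assumes "q \<noteq> 0"
  shows "phi n q (cmul c d) m = (\<Sum>k\<in>{k. \<forall>i. k i \<le> m i}.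
     phi n q c k * phi n q d (\<lambda>i. m i - k i) / q ^ cross2 n k (\<lambda>i. m i - k i))"
proof (cases "m \<in> midx n")
  case False
  \<comment> \<open>Outside \<open>midx\<close> the index set can be infinite; still every term
    vanishes, since one of two contents adding up to \<open>m\<close> already leaves
    \<open>midx\<close>.\<close>
  have "phi n q c k * phi n q d (\<lambda>i. m i - k i) = 0" if k: "\<forall>i. k i \<le> m i" for k
  proof -
    have "k \<notin> midx n \<or> (\<lambda>i. m i - k i) \<notin> midx n"
      using False k unfolding midx_def by auto
    then show ?thesis using wcls_empty unfolding phi_def by force
  qed
  then have "(\<Sum>k\<in>{k. \<forall>i. k i \<le> m i}.
     phi n q c k * phi n q d (\<lambda>i. m i - k i) / q ^ cross2 n k (\<lambda>i. m i - k i)) = 0"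
    by (intro sum.neutral) auto
  then show ?thesis using wcls_empty[OF False] by (simp add: phi_def)
next
  case True
  let ?K = "{k. \<forall>i. k i \<le> m i}"
  let ?D = "\<lambda>k i. m i - k i"
  let ?F = "\<lambda>\<alpha> \<beta>. c \<alpha> * d \<beta> / q ^ invs (\<alpha> @ \<beta>)"
  have "(\<Sum>k\<in>?K. phi n q c k * phi n q d (?D k) / q ^ cross2 n k (?D k))
      = (\<Sum>k\<in>?K. \<Sum>\<alpha>\<in>wcls n k. \<Sum>\<beta>\<in>wcls n (?D k). ?F \<alpha> \<beta>)"
  proof (intro sum.cong refl)
    fix k assume "k \<in> ?K"
    have "invs (\<alpha> @ \<beta>) = invs \<alpha> + invs \<beta> + cross2 n k (?D k)" if "\<alpha> \<in> wcls n k" "\<beta> \<in> wcls n (?D k)" for \<alpha> \<beta>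
      using that invs_append[of \<alpha> n \<beta>] by (simp add: wcls_def)
    then have "(\<Sum>\<alpha>\<in>wcls n k. \<Sum>\<beta>\<in>wcls n (?D k). ?F \<alpha> \<beta>)
      = (\<Sum>\<alpha>\<in>wcls n k. \<Sum>\<beta>\<in>wcls n (?D k). (c \<alpha> / q ^ invs \<alpha>) * (d \<beta> / q ^ invs \<beta>) / q ^ cross2 n k (?D k))"
      by (intro sum.cong refl) (simp add: power_add)
    also have "\<dots> = phi n q c k * phi n q d (?D k) / q ^ cross2 n k (?D k)"
      unfolding phi_def sum_product sum_divide_distrib ..
    finally show "phi n q c k * phi n q d (?D k) / q ^ cross2 n k (?D k)
      = (\<Sum>\<alpha>\<in>wcls n k. \<Sum>\<beta>\<in>wcls n (?D k). ?F \<alpha> \<beta>)" by simp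
  qed
  also have "\<dots> = (\<Sum>(k, \<alpha>, \<beta>)\<in>Sigma ?K (\<lambda>k. wcls n k \<times> wcls n (?D k)). ?F \<alpha> \<beta>)"
    using finite_le_midx[OF True] by (simp add: sum.cartesian_product sum.Sigma split_def)
  also have "\<dots> = (\<Sum>(\<gamma>, i)\<in>Sigma (wcls n m) (\<lambda>\<gamma>. {..length \<gamma>}). ?F (take i \<gamma>) (drop i \<gamma>))"
  proof (rule sum.reindex_bij_witness[where
        i = "\<lambda>(\<gamma>, i). (count_list (take i \<gamma>), take i \<gamma>, drop i \<gamma>)" and
        j = "\<lambda>(k, \<alpha>, \<beta>). (\<alpha> @ \<beta>, length \<alpha>)"], goal_cases)
    case (4 b)
    obtain \<gamma> i where b: "b = (\<gamma>, i)" by force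
    have g: "\<gamma> \<in> words n" "count_list \<gamma> = m" "i \<le> length \<gamma>" using 4 b by (auto simp: wcls_def)
    have "count_list (take i \<gamma>) j + count_list (drop i \<gamma>) j = m j" for j
      using g(2) by (metis append_take_drop_id count_list_append)
    then have "count_list (take i \<gamma>) j \<le> m j" "count_list (drop i \<gamma>) j = m j - count_list (take i \<gamma>) j" for j
      by (metis le_add1, metis add_diff_cancel_left')
    then show ?case using g take_drop_in_words[of \<gamma> n i] b by (auto simp: wcls_def fun_eq_iff)
  qed (auto simp: wcls_def fun_eq_iff)
  also have "\<dots> = (\<Sum>\<gamma>\<in>wcls n m. \<Sum>i\<le>length \<gamma>. ?F (take i \<gamma>) (drop i \<gamma>))"
    by (simp add: sum.Sigma)
  also have "\<dots> = phi n q (cmul c d) m"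
    unfolding phi_def cmul_def by (simp add: sum_divide_distrib)
  finally show ?thesis by simp
qed

section \<open>Holomorphic functions with values in a free algebra\<close>

lemma tendsto_0_le_ennreal:
  fixes f g :: "'a \<Rightarrow> ennreal"
  assumes "(g \<longlongrightarrow> 0) F" "\<forall>\<^sub>F x in F. f x \<le> g x"
  shows "(f \<longlongrightarrow> 0) F"
  by (rule tendsto_sandwich[OF _ assms(2) tendsto_const assms(1)]) simp

text \<open>A partial sum on the left runs over a triangle contained in a square, and the sum over
  the square factors.\<close>

lemma suminf_Cauchy_product_ennreal:
  fixes a b :: "nat \<Rightarrow> ennreal"
  shows "(\<Sum>m. \<Sum>i\<le>m. a i * b (m - i)) \<le> (\<Sum>i. a i) * (\<Sum>j. b j)"
  unfolding suminf_eq_SUP[of "\<lambda>m. \<Sum>i\<le>m. a i * b (m - i)"]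
proof (rule SUP_least)
  fix M :: nat
  have "(\<Sum>m<M. \<Sum>i\<le>m. a i * b (m - i)) = (\<Sum>(i, j)\<in>{(i, j). i + j < M}. a i * b j)"
    by (rule sum.triangle_reindex[symmetric])
  also have "\<dots> \<le> (\<Sum>(i, j)\<in>{..<M} \<times> {..<M}. a i * b j)"
    by (rule sum_mono2) auto
  also have "\<dots> = (\<Sum>i<M. a i) * (\<Sum>j<M. b j)"
    by (simp add: sum_product sum.cartesian_product)
  also have "\<dots> \<le> (\<Sum>i. a i) * (\<Sum>j. b j)"
    by (intro mult_mono sum_le_suminf summableI) auto
  finally show "(\<Sum>m<M. \<Sum>i\<le>m. a i * b (m - i)) \<le> (\<Sum>i. a i) * (\<Sum>j. b j)" .
qed

definition gsum :: "(nat \<Rightarrow> 'a \<Rightarrow> real) \<Rightarrow> 'a \<Rightarrow> ennreal" where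
  "gsum N c = (\<Sum>d. ennreal (N d c))"

definition tail :: "nat \<Rightarrow> (nat list \<Rightarrow> complex) \<Rightarrow> nat list \<Rightarrow> complex" where
  "tail M c = (\<lambda>\<alpha>. if length \<alpha> \<le> M then 0 else c \<alpha>)"

text \<open>The three families of norms on the free algebra are all of the form
  \<open>c \<mapsto> (\<Sum>d. N d c)\<close>, where \<open>N d\<close> only sees the homogeneous component of degree \<open>d\<close>.\<close>

locale graded_norms =
  fixes n :: nat and \<N> :: "(nat \<Rightarrow> (nat list \<Rightarrow> complex) \<Rightarrow> real) set"
  assumes N_mono: "\<And>N d c c'. N \<in> \<N> \<Longrightarrow> (\<And>\<alpha>. \<alpha> \<in> wdeg n d \<Longrightarrow> norm (c \<alpha>) \<le> norm (c' \<alpha>)) \<Longrightarrow> N d c \<le> N d c'"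
    and N_add: "\<And>N d c c'. N \<in> \<N> \<Longrightarrow> N d (\<lambda>\<alpha>. c \<alpha> + c' \<alpha>) \<le> N d c + N d c'"
    and N_scale: "\<And>N d a c. N \<in> \<N> \<Longrightarrow> N d (\<lambda>\<alpha>. a * c \<alpha>) = norm a * N d c"
    and N_cmul: "\<And>N m c c'. N \<in> \<N> \<Longrightarrow> N m (cmul c c') \<le> (\<Sum>i\<le>m. N i c * N (m - i) c')"
    and N_coeff: "\<And>N \<alpha>. N \<in> \<N> \<Longrightarrow> \<alpha> \<in> words n \<Longrightarrow> \<exists>C>0. \<forall>c. norm (c \<alpha>) \<le> C * N (length \<alpha>) c"
    and N_ne: "\<N> \<noteq> {}"
begin

abbreviation "P \<equiv> gsum ` \<N>"

lemma N_zero: "N \<in> \<N> \<Longrightarrow> N d (\<lambda>\<alpha>. 0) = 0"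
  using N_scale[of N d 0 "\<lambda>\<alpha>. 0"] by simp

lemma N_nonneg: "N \<in> \<N> \<Longrightarrow> N d c \<ge> 0"
  using N_mono[of N d "\<lambda>\<alpha>. 0" c] N_zero[of N d] by simp

lemma p_zero: "p \<in> P \<Longrightarrow> p (\<lambda>\<alpha>. 0) = 0"
  by (auto simp: gsum_def N_zero)

lemma p_mono: "p \<in> P \<Longrightarrow> (\<And>\<alpha>. \<alpha> \<in> words n \<Longrightarrow> norm (c \<alpha>) \<le> norm (c' \<alpha>)) \<Longrightarrow> p c \<le> p c'"
proof -
  assume "p \<in> P" and le: "\<And>\<alpha>. \<alpha> \<in> words n \<Longrightarrow> norm (c \<alpha>) \<le> norm (c' \<alpha>)"
  then obtain N where N: "N \<in> \<N>" "p = gsum N" by blast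
  have "N d c \<le> N d c'" for d by (rule N_mono[OF N(1)]) (auto simp: wdeg_def le)
  then show ?thesis unfolding N(2) gsum_def by (intro suminf_le summableI ennreal_leI)
qed

lemma p_add: "p \<in> P \<Longrightarrow> p (\<lambda>\<alpha>. c \<alpha> + c' \<alpha>) \<le> p c + p c'"
proof -
  assume "p \<in> P"
  then obtain N where N: "N \<in> \<N>" "p = gsum N" by blast
  have "p (\<lambda>\<alpha>. c \<alpha> + c' \<alpha>) \<le> (\<Sum>d. ennreal (N d c) + ennreal (N d c'))"
    unfolding N(2) gsum_def using N(1)
    by (intro suminf_le summableI) (simp add: N_add N_nonneg ennreal_leI flip: ennreal_plus)
  also have "\<dots> = p c + p c'" unfolding N(2) gsum_def by (simp add: suminf_add)
  finally show ?thesis .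
qed

lemma p_scale: "p \<in> P \<Longrightarrow> p (\<lambda>\<alpha>. a * c \<alpha>) = ennreal (norm a) * p c"
  by (auto simp: gsum_def N_scale ennreal_mult N_nonneg)

lemma p_cmul: "p \<in> P \<Longrightarrow> p (cmul c c') \<le> p c * p c'"
proof -
  assume "p \<in> P"
  then obtain N where N: "N \<in> \<N>" "p = gsum N" by blast
  have "p (cmul c c') \<le> (\<Sum>m. ennreal (\<Sum>i\<le>m. N i c * N (m - i) c'))"
    unfolding N(2) gsum_def using N(1)
    by (intro suminf_le summableI ennreal_leI N_cmul)
  also have "\<dots> = (\<Sum>m. \<Sum>i\<le>m. ennreal (N i c) * ennreal (N (m - i) c'))"
    using N(1) by (simp add: N_nonneg flip: sum_ennreal ennreal_mult)
  also have "\<dots> \<le> p c * p c'" unfolding N(2) gsum_def by (rule suminf_Cauchy_product_ennreal)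
  finally show ?thesis .
qed

lemma p_coeff:
  assumes "p \<in> P" "\<alpha> \<in> words n"
  obtains C where "C > 0" "\<And>c. ennreal (norm (c \<alpha>)) \<le> ennreal C * p c"
proof -
  obtain N where N: "N \<in> \<N>" "p = gsum N" using assms by blast
  obtain C where C: "C > 0" "\<And>c. norm (c \<alpha>) \<le> C * N (length \<alpha>) c" using N_coeff[OF N(1) assms(2)] by blast
  have "ennreal (norm (c \<alpha>)) \<le> ennreal C * p c" for c
  proof -
    have "ennreal (norm (c \<alpha>)) \<le> ennreal C * ennreal (N (length \<alpha>) c)"
      using C N(1) by (simp add: ennreal_leI N_nonneg flip: ennreal_mult)
    also have "ennreal (N (length \<alpha>) c) \<le> p c"
      unfolding N(2) gsum_def using sum_le_suminf[OF summableI, of "{length \<alpha>}" "\<lambda>d. ennreal (N d c)"] by simp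
    finally show ?thesis by (simp add: mult_left_mono)
  qed
  then show thesis using that C by blast
qed

lemma Fcar_off: "c \<in> Fcar n P \<Longrightarrow> \<alpha> \<notin> words n \<Longrightarrow> c \<alpha> = 0"
  and Fcar_finite: "c \<in> Fcar n P \<Longrightarrow> p \<in> P \<Longrightarrow> p c < top"
  unfolding Fcar_def by auto

lemma FcarI: "(\<And>\<alpha>. \<alpha> \<notin> words n \<Longrightarrow> c \<alpha> = 0) \<Longrightarrow> (\<And>p. p \<in> P \<Longrightarrow> p c < top) \<Longrightarrow> c \<in> Fcar n P"
  unfolding Fcar_def by blast

lemma Fcar_zero: "(\<lambda>\<alpha>. 0) \<in> Fcar n P"
  unfolding Fcar_def using p_zero by force

lemma Fcar_add: "c \<in> Fcar n P \<Longrightarrow> c' \<in> Fcar n P \<Longrightarrow> (\<lambda>\<alpha>. c \<alpha> + c' \<alpha>) \<in> Fcar n P"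
proof (rule FcarI)
  fix p assume c: "c \<in> Fcar n P" "c' \<in> Fcar n P" and p: "p \<in> P"
  have "p c + p c' < top" using Fcar_finite c p by (simp add: ennreal_add_less_top)
  then show "p (\<lambda>\<alpha>. c \<alpha> + c' \<alpha>) < top" using p_add[OF p] by (rule le_less_trans[rotated])
qed (simp add: Fcar_off)

lemma Fcar_cmul:
  assumes "c \<in> Fcar n P" "c' \<in> Fcar n P"
  shows "cmul c c' \<in> Fcar n P"
proof -
  have "cmul c c' \<alpha> = 0" if "\<alpha> \<notin> words n" for \<alpha>
    unfolding cmul_def
    by (rule sum.neutral) (use that take_drop_in_words[of \<alpha> n] Fcar_off[OF assms(1)] Fcar_off[OF assms(2)] in auto)
  moreover have "p (cmul c c') < top" if "p \<in> P" for p
    using p_cmul[OF that, of c c'] Fcar_finite[OF assms(1) that] Fcar_finite[OF assms(2) that]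
    by (auto intro: le_less_trans simp: ennreal_mult_less_top)
  ultimately show ?thesis unfolding Fcar_def by blast
qed

lemma Fcar_bounded_length:
  assumes "\<And>\<alpha>. \<alpha> \<notin> words n \<Longrightarrow> c \<alpha> = 0" "\<And>\<alpha>. length \<alpha> > M \<Longrightarrow> c \<alpha> = 0"
  shows "c \<in> Fcar n P"
proof -
  have "gsum N c < top" if N: "N \<in> \<N>" for N
  proof -
    have "N d c = 0" if "d > M" for d
      using N_mono[OF N, of d c "\<lambda>\<alpha>. 0"] N_zero[OF N] N_nonneg[OF N, of d c] assms(2) that
      by (simp add: wdeg_def)
    then have "gsum N c = (\<Sum>d\<le>M. ennreal (N d c))"
      unfolding gsum_def by (intro suminf_finite) auto
    then show ?thesis by simp
  qed
  then show ?thesis unfolding Fcar_def using assms(1) by blast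
qed

lemma tail_small:
  assumes c: "c \<in> Fcar n P" and p: "p \<in> P" and e: "e > (0::real)"
  obtains M where "p (tail M c) < ennreal e"
proof -
  obtain N where N: "N \<in> \<N>" "p = gsum N" using p by blast
  have "(\<Sum>d. ennreal (N d c)) \<noteq> top" using Fcar_finite[OF c p] unfolding N(2) gsum_def by simp
  then have s: "summable (\<lambda>d. N d c)" by (rule summable_suminf_not_top[rotated]) (rule N_nonneg[OF N(1)])
  obtain M where "\<forall>m\<ge>M. norm (\<Sum>i. N (i + m) c) < e"
    using suminf_exist_split[OF e s] by blast
  \<comment> \<open>\<open>tail M\<close> keeps the degrees above \<open>M\<close>, so the remainder
    of the series has to start at \<open>Suc M\<close>.\<close>
  then have M: "norm (\<Sum>i. N (i + Suc M) c) < e" by (rule allE[of _ "Suc M"]) simp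
  have s': "summable (\<lambda>i. N (i + Suc M) c)" using s by (rule summable_ignore_initial_segment)
  have z: "N d (tail M c) = 0" if "d \<le> M" for d
    using N_mono[OF N(1), of d "tail M c" "\<lambda>\<alpha>. 0"] N_zero[OF N(1)] N_nonneg[OF N(1), of d "tail M c"] that
    by (simp add: wdeg_def tail_def)
  have "p (tail M c) = (\<Sum>i. ennreal (N (i + Suc M) (tail M c)))"
    unfolding N(2) gsum_def using z by (subst suminf_offset[OF summableI, where i = "Suc M"]) simp
  also have "\<dots> \<le> (\<Sum>i. ennreal (N (i + Suc M) c))"
    by (intro suminf_le summableI ennreal_leI N_mono[OF N(1)]) (auto simp: tail_def)
  also have "\<dots> = ennreal (\<Sum>i. N (i + Suc M) c)"
    using s' N_nonneg[OF N(1)] by (intro suminf_ennreal2) auto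
  also have "\<dots> < ennreal e" using M e by (intro ennreal_lessI) auto
  finally show thesis by (rule that)
qed

section \<open>Complex derivatives and the algebra of holomorphic functions\<close>

definition has_der :: "(complex \<Rightarrow> nat list \<Rightarrow> complex) \<Rightarrow> (nat list \<Rightarrow> complex) \<Rightarrow> complex \<Rightarrow> bool" where
  "has_der f g z0 \<longleftrightarrow> (\<forall>p\<in>P. ((\<lambda>z. p (\<lambda>\<alpha>. (f z \<alpha> - f z0 \<alpha>) / (z - z0) - g \<alpha>)) \<longlongrightarrow> 0) (at z0))"

lemma Ocar_iff: "f \<in> Ocar n P \<longleftrightarrow> f 0 = (\<lambda>\<alpha>. 0) \<and> (\<forall>z. z \<noteq> 0 \<longrightarrow> f z \<in> Fcar n P)
     \<and> (\<forall>z0. z0 \<noteq> 0 \<longrightarrow> (\<exists>g\<in>Fcar n P. has_der f g z0))"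
  unfolding Ocar_def Fhol_def has_der_def by simp

lemma Ocar_0: "f \<in> Ocar n P \<Longrightarrow> f 0 = (\<lambda>\<alpha>. 0)"
  and Ocar_Fcar: "f \<in> Ocar n P \<Longrightarrow> z \<noteq> 0 \<Longrightarrow> f z \<in> Fcar n P"
  and Ocar_der: "f \<in> Ocar n P \<Longrightarrow> z \<noteq> 0 \<Longrightarrow> \<exists>g\<in>Fcar n P. has_der f g z"
  by (auto simp: Ocar_iff)

lemma Ocar_Fcar': "f \<in> Ocar n P \<Longrightarrow> f z \<in> Fcar n P"
  using Ocar_0 Ocar_Fcar Fcar_zero by metis

lemma has_der_add:
  assumes "has_der f f' z" "has_der g g' z"
  shows "has_der (\<lambda>z \<alpha>. f z \<alpha> + g z \<alpha>) (\<lambda>\<alpha>. f' \<alpha> + g' \<alpha>) z"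
  unfolding has_der_def
proof
  fix p assume p: "p \<in> P"
  let ?F = "\<lambda>w \<alpha>. (f w \<alpha> - f z \<alpha>) / (w - z) - f' \<alpha>"
  let ?G = "\<lambda>w \<alpha>. (g w \<alpha> - g z \<alpha>) / (w - z) - g' \<alpha>"
  have lim: "((\<lambda>w. p (?F w) + p (?G w)) \<longlongrightarrow> 0) (at z)"
    using assms p tendsto_add[of "\<lambda>w. p (?F w)" 0 "at z" "\<lambda>w. p (?G w)" 0] unfolding has_der_def by auto
  have le: "p (\<lambda>\<alpha>. (f w \<alpha> + g w \<alpha> - (f z \<alpha> + g z \<alpha>)) / (w - z) - (f' \<alpha> + g' \<alpha>)) \<le> p (?F w) + p (?G w)" for w
  proof -
    have "(\<lambda>\<alpha>. (f w \<alpha> + g w \<alpha> - (f z \<alpha> + g z \<alpha>)) / (w - z) - (f' \<alpha> + g' \<alpha>)) = (\<lambda>\<alpha>. ?F w \<alpha> + ?G w \<alpha>)"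
      by (simp add: fun_eq_iff add_divide_distrib diff_divide_distrib)
    then show ?thesis using p_add[OF p] by simp
  qed
  show "((\<lambda>w. p (\<lambda>\<alpha>. (f w \<alpha> + g w \<alpha> - (f z \<alpha> + g z \<alpha>)) / (w - z) - (f' \<alpha> + g' \<alpha>))) \<longlongrightarrow> 0) (at z)"
    using lim by (rule tendsto_0_le_ennreal) (intro always_eventually allI le)
qed

text \<open>Near \<open>z\<close> the difference quotient is within 1 of \<open>g'\<close> in the
  seminorm \<open>p\<close>; multiplying by \<open>w - z\<close> bounds the increment, and
  continuity follows.\<close>

lemma has_der_increment:
  assumes g: "has_der g g' z" and p: "p \<in> P"
  shows "\<forall>\<^sub>F w in at z. p (\<lambda>\<alpha>. g w \<alpha> - g z \<alpha>) \<le> ennreal (norm (w - z)) * (1 + p g')"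
proof -
  let ?G = "\<lambda>w \<alpha>. (g w \<alpha> - g z \<alpha>) / (w - z) - g' \<alpha>"
  have "\<forall>\<^sub>F w in at z. p (?G w) < 1"
    using g p unfolding has_der_def by (intro order_tendstoD(2)[where y = 0]) auto
  moreover have "\<forall>\<^sub>F w in at z. w \<noteq> z" by (simp add: eventually_at_filter)
  ultimately show ?thesis
  proof eventually_elim
    case (elim w)
    have "(\<lambda>\<alpha>. g w \<alpha> - g z \<alpha>) = (\<lambda>\<alpha>. (w - z) * (?G w \<alpha> + g' \<alpha>))"
      using elim(2) by (simp add: fun_eq_iff)
    then have "p (\<lambda>\<alpha>. g w \<alpha> - g z \<alpha>) = ennreal (norm (w - z)) * p (\<lambda>\<alpha>. ?G w \<alpha> + g' \<alpha>)"
      by (simp only: p_scale[OF p])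
    also have "\<dots> \<le> ennreal (norm (w - z)) * (p (?G w) + p g')"
      by (intro mult_left_mono p_add p) auto
    also have "\<dots> \<le> ennreal (norm (w - z)) * (1 + p g')"
      using elim(1) by (intro mult_left_mono add_right_mono) auto
    finally show ?case .
  qed
qed

lemma tendsto_norm_diff_ennreal: "((\<lambda>w. ennreal (norm (w - z)) * C) \<longlongrightarrow> 0) (at (z::complex))" if "C < top"
proof -
  have "((\<lambda>w. norm (w - z)) \<longlongrightarrow> norm (z - z)) (at z)" by (intro tendsto_intros)
  then have "((\<lambda>w. C * ennreal (norm (w - z))) \<longlongrightarrow> C * ennreal (norm (z - z))) (at z)"
    using that by (intro ennreal_tendsto_cmult tendsto_ennrealI)
  then show ?thesis by (simp add: mult.commute)
qed

lemma has_der_continuous: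
  assumes g: "has_der g g' z" and p: "p \<in> P" and fin: "p g' < top"
  shows "((\<lambda>w. p (\<lambda>\<alpha>. g w \<alpha> - g z \<alpha>)) \<longlongrightarrow> 0) (at z)"
proof (rule tendsto_0_le_ennreal[OF tendsto_norm_diff_ennreal has_der_increment[OF g p]])
  show "1 + p g' < top" using fin by (simp add: ennreal_add_less_top)
qed

lemma cmul_add_left: "cmul (\<lambda>\<alpha>. a \<alpha> + b \<alpha>) c = (\<lambda>\<alpha>. cmul a c \<alpha> + cmul b c \<alpha>)"
  and cmul_add_right: "cmul c (\<lambda>\<alpha>. a \<alpha> + b \<alpha>) = (\<lambda>\<alpha>. cmul c a \<alpha> + cmul c b \<alpha>)"
  and cmul_scale_left: "cmul (\<lambda>\<alpha>. x * a \<alpha>) c = (\<lambda>\<alpha>. x * cmul a c \<alpha>)"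
  and cmul_scale_right: "cmul c (\<lambda>\<alpha>. x * a \<alpha>) = (\<lambda>\<alpha>. x * cmul c a \<alpha>)"
  for a b c :: "nat list \<Rightarrow> complex"
  by (auto simp: cmul_def fun_eq_iff sum.distrib sum_distrib_left algebra_simps)

lemma has_der_cmul:
  assumes f: "has_der f f' z" and g: "has_der g g' z"
    and fin: "f z \<in> Fcar n P" "g z \<in> Fcar n P" "f' \<in> Fcar n P" "g' \<in> Fcar n P"
  shows "has_der (\<lambda>z. cmul (f z) (g z)) (\<lambda>\<alpha>. cmul f' (g z) \<alpha> + cmul (f z) g' \<alpha>) z"
  unfolding has_der_def
proof
  fix p assume p: "p \<in> P"
  let ?F = "\<lambda>w \<alpha>. (f w \<alpha> - f z \<alpha>) / (w - z) - f' \<alpha>"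
  let ?G = "\<lambda>w \<alpha>. (g w \<alpha> - g z \<alpha>) / (w - z) - g' \<alpha>"
  let ?D = "\<lambda>w \<alpha>. g w \<alpha> - g z \<alpha>"
  let ?H = "\<lambda>w \<alpha>. (cmul (f w) (g w) \<alpha> - cmul (f z) (g z) \<alpha>) / (w - z) - (cmul f' (g z) \<alpha> + cmul (f z) g' \<alpha>)"
  have fin': "p (f z) < top" "p (g z) < top" "p f' < top" "p g' < top"
    using Fcar_finite p fin by auto
  have F: "((\<lambda>w. p (?F w)) \<longlongrightarrow> 0) (at z)" and G: "((\<lambda>w. p (?G w)) \<longlongrightarrow> 0) (at z)"
    using f g p unfolding has_der_def by auto
  have D: "((\<lambda>w. p (?D w)) \<longlongrightarrow> 0) (at z)" using has_der_continuous[OF g p fin'(4)] .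
  have "\<forall>\<^sub>F w in at z. p (?D w) < 1" using D by (rule order_tendstoD(2)) simp
  moreover have "\<forall>\<^sub>F w in at z. w \<noteq> z" by (simp add: eventually_at_filter)
  \<comment> \<open>The error of the product is F g(w) + f' (g(w) - g(z)) + f(z) G, where F and G
    are the errors of the two factors. As g(w) varies, its seminorm is replaced by the bound 1 + p
    (g z), valid near z.\<close>
  ultimately have le: "\<forall>\<^sub>F w in at z. p (?H w) \<le> (1 + p (g z)) * p (?F w) + p f' * p (?D w) + p (f z) * p (?G w)"
  proof eventually_elim
    case (elim w)
    have fw: "f w = (\<lambda>\<alpha>. f z \<alpha> + (w - z) * (f' \<alpha> + ?F w \<alpha>))"
      and gw: "g w = (\<lambda>\<alpha>. g z \<alpha> + ?D w \<alpha>)" and gw': "g w = (\<lambda>\<alpha>. g z \<alpha> + (w - z) * (g' \<alpha> + ?G w \<alpha>))"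
      using elim(2) by (auto simp: fun_eq_iff)
    have "cmul (f w) (g w) \<alpha> = cmul (f z) (g w) \<alpha> + (w - z) * (cmul f' (g w) \<alpha> + cmul (?F w) (g w) \<alpha>)" for \<alpha>
      by (subst fw) (simp only: cmul_add_left cmul_scale_left)
    moreover have "cmul (f z) (g w) \<alpha> = cmul (f z) (g z) \<alpha> + (w - z) * (cmul (f z) g' \<alpha> + cmul (f z) (?G w) \<alpha>)" for \<alpha>
      by (subst gw') (simp only: cmul_add_right cmul_scale_right)
    moreover have "cmul f' (g w) \<alpha> = cmul f' (g z) \<alpha> + cmul f' (?D w) \<alpha>" for \<alpha>
      by (subst gw) (simp only: cmul_add_right)
    ultimately have "?H w = (\<lambda>\<alpha>. (cmul (?F w) (g w) \<alpha> + cmul f' (?D w) \<alpha>) + cmul (f z) (?G w) \<alpha>)"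
      using elim(2) by (simp add: fun_eq_iff field_simps)
    then have "p (?H w) \<le> p (\<lambda>\<alpha>. cmul (?F w) (g w) \<alpha> + cmul f' (?D w) \<alpha>) + p (cmul (f z) (?G w))"
      using p_add[OF p] by presburger
    also have "\<dots> \<le> (p (cmul (?F w) (g w)) + p (cmul f' (?D w))) + p (cmul (f z) (?G w))"
      by (intro add_right_mono p_add p)
    also have "\<dots> \<le> (p (?F w) * p (g w) + p f' * p (?D w)) + p (f z) * p (?G w)"
      by (intro add_mono p_cmul p)
    also have "p (g w) \<le> 1 + p (g z)"
    proof -
      have "p (g w) \<le> p (g z) + p (?D w)" using p_add[OF p, of "g z" "?D w"] gw by simp
      also have "\<dots> \<le> p (g z) + 1" using elim(1) by (intro add_left_mono) auto
      finally show ?thesis by (simp add: add.commute)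
    qed
    finally show ?case by (simp add: mult_left_mono mult_right_mono mult.commute)
  qed
  have "((\<lambda>w. (1 + p (g z)) * p (?F w) + p f' * p (?D w) + p (f z) * p (?G w))
      \<longlongrightarrow> (1 + p (g z)) * 0 + p f' * 0 + p (f z) * 0) (at z)"
    using fin' F G D by (intro tendsto_add ennreal_tendsto_cmult) (auto simp: ennreal_add_less_top)
  then have "((\<lambda>w. (1 + p (g z)) * p (?F w) + p f' * p (?D w) + p (f z) * p (?G w)) \<longlongrightarrow> 0) (at z)"
    by simp
  then show "((\<lambda>w. p (?H w)) \<longlongrightarrow> 0) (at z)"
    using le by (rule tendsto_0_le_ennreal)
qed

text \<open>Elements of \<open>Ocar\<close> are normalised to be 0 at the point 0, where the natural
  formulas need not vanish; difference quotients at \<open>z0 \<noteq> 0\<close> do not see that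
  point. This lets \<open>const\<close> and \<open>mon\<close> be differentiated through their
  formulas.\<close>

lemma has_der_cong:
  assumes "\<And>z. z \<noteq> 0 \<Longrightarrow> f z = g z" "z0 \<noteq> 0"
  shows "has_der f h z0 \<longleftrightarrow> has_der g h z0"
proof -
  have "\<forall>\<^sub>F z in at z0. z \<noteq> 0"
    using assms(2) by (intro eventually_at_in_open'[of "-{0}", simplified]) auto
  then have "\<forall>\<^sub>F z in at z0. p (\<lambda>\<alpha>. (f z \<alpha> - f z0 \<alpha>) / (z - z0) - h \<alpha>) = p (\<lambda>\<alpha>. (g z \<alpha> - g z0 \<alpha>) / (z - z0) - h \<alpha>)" for p
    by eventually_elim (use assms in simp)
  then show ?thesis unfolding has_der_def using tendsto_cong by fast
qed

definition const :: "(nat list \<Rightarrow> complex) \<Rightarrow> complex \<Rightarrow> nat list \<Rightarrow> complex" where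
  "const c = (\<lambda>z \<alpha>. if z = 0 then 0 else c \<alpha>)"

definition mon :: "(complex \<Rightarrow> complex) \<Rightarrow> nat list \<Rightarrow> complex \<Rightarrow> nat list \<Rightarrow> complex" where
  "mon g \<alpha> = (\<lambda>z \<beta>. if z \<noteq> 0 \<and> \<beta> = \<alpha> then g z else 0)"

lemma Ocar_const: "c \<in> Fcar n P \<Longrightarrow> const c \<in> Ocar n P"
proof -
  assume c: "c \<in> Fcar n P"
  have "has_der (\<lambda>z. c) (\<lambda>\<alpha>. 0) z" for z by (auto simp: has_der_def p_zero N_ne)
  then have "has_der (const c) (\<lambda>\<alpha>. 0) z" if "z \<noteq> 0" for z
    using has_der_cong[of "const c" "\<lambda>z. c" z] that by (simp add: const_def)
  then show ?thesis using c Fcar_zero unfolding Ocar_iff by (auto simp: const_def)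
qed

lemma single_Fcar: "\<alpha> \<in> words n \<Longrightarrow> (\<lambda>\<beta>. if \<beta> = \<alpha> then a else 0) \<in> Fcar n P"
  by (rule Fcar_bounded_length[where M = "length \<alpha>"]) auto

lemma Ocar_mon:
  assumes g: "g holomorphic_on (- {0})" and \<alpha>: "\<alpha> \<in> words n"
  shows "mon g \<alpha> \<in> Ocar n P"
proof -
  let ?s = "\<lambda>a \<beta>. if \<beta> = \<alpha> then a else 0 :: complex"
  have "\<exists>h\<in>Fcar n P. has_der (mon g \<alpha>) h z" if z: "z \<noteq> 0" for z
  proof -
    obtain g' where g': "(g has_field_derivative g') (at z)"
      using g z holomorphic_on_open[of "-{0}" g] by auto
    have "has_der (\<lambda>z. ?s (g z)) (?s g') z"
      unfolding has_der_def
    proof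
      fix p assume p: "p \<in> P"
      have "((\<lambda>w. (g w - g z) / (w - z) - g') \<longlongrightarrow> 0) (at z)"
        using g' unfolding has_field_derivative_iff by (simp add: LIM_zero)
      then have "((\<lambda>w. ennreal (norm ((g w - g z) / (w - z) - g'))) \<longlongrightarrow> ennreal 0) (at z)"
        by (intro tendsto_ennrealI tendsto_norm_zero)
      moreover have "p (?s 1) < top" using Fcar_finite[OF single_Fcar[OF \<alpha>] p] .
      ultimately have "((\<lambda>w. p (?s 1) * ennreal (norm ((g w - g z) / (w - z) - g'))) \<longlongrightarrow> p (?s 1) * ennreal 0) (at z)"
        by (intro ennreal_tendsto_cmult)
      moreover have "p (\<lambda>\<beta>. (?s (g w) \<beta> - ?s (g z) \<beta>) / (w - z) - ?s g' \<beta>)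
          = p (?s 1) * ennreal (norm ((g w - g z) / (w - z) - g'))" for w
      proof -
        have "(\<lambda>\<beta>. (?s (g w) \<beta> - ?s (g z) \<beta>) / (w - z) - ?s g' \<beta>) = (\<lambda>\<beta>. ((g w - g z) / (w - z) - g') * ?s 1 \<beta>)"
          by (auto simp: fun_eq_iff)
        then show ?thesis by (simp only: p_scale[OF p] mult.commute[of "p (?s 1)"])
      qed
      ultimately show "((\<lambda>w. p (\<lambda>\<beta>. (?s (g w) \<beta> - ?s (g z) \<beta>) / (w - z) - ?s g' \<beta>)) \<longlongrightarrow> 0) (at z)" by simp
    qed
    then have "has_der (mon g \<alpha>) (?s g') z"
      using has_der_cong[of "mon g \<alpha>" "\<lambda>z. ?s (g z)" z] z by (simp add: mon_def)
    then show ?thesis using single_Fcar[OF \<alpha>] by blast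
  qed
  moreover have "mon g \<alpha> z \<in> Fcar n P" if "z \<noteq> 0" for z
    using single_Fcar[OF \<alpha>, of "g z"] that by (simp add: mon_def)
  ultimately show ?thesis unfolding Ocar_iff by (simp add: mon_def)
qed

lemma Ocar_add:
  assumes "f \<in> Ocar n P" "g \<in> Ocar n P"
  shows "(\<lambda>z \<alpha>. f z \<alpha> + g z \<alpha>) \<in> Ocar n P"
  unfolding Ocar_iff
proof (intro conjI allI impI)
  fix z :: complex assume z: "z \<noteq> 0"
  show "\<exists>h\<in>Fcar n P. has_der (\<lambda>z \<alpha>. f z \<alpha> + g z \<alpha>) h z"
    using Ocar_der[OF assms(1) z] Ocar_der[OF assms(2) z] has_der_add Fcar_add by blast
  show "(\<lambda>\<alpha>. f z \<alpha> + g z \<alpha>) \<in> Fcar n P"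
    by (rule Fcar_add[OF Ocar_Fcar[OF assms(1) z] Ocar_Fcar[OF assms(2) z]])
qed (use assms in \<open>auto simp: Ocar_0\<close>)

lemma Ocar_cmul:
  assumes "f \<in> Ocar n P" "g \<in> Ocar n P"
  shows "(\<lambda>z. cmul (f z) (g z)) \<in> Ocar n P"
  unfolding Ocar_iff
proof (intro conjI allI impI)
  fix z :: complex assume z: "z \<noteq> 0"
  obtain f' g' where d: "f' \<in> Fcar n P" "g' \<in> Fcar n P" "has_der f f' z" "has_der g g' z"
    using Ocar_der[OF assms(1) z] Ocar_der[OF assms(2) z] by blast
  show "\<exists>h\<in>Fcar n P. has_der (\<lambda>z. cmul (f z) (g z)) h z"
    using has_der_cmul[OF d(3,4) Ocar_Fcar[OF assms(1) z] Ocar_Fcar[OF assms(2) z] d(1,2)]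
      Fcar_add Fcar_cmul d(1,2) Ocar_Fcar[OF assms(1) z] Ocar_Fcar[OF assms(2) z] by blast
  show "cmul (f z) (g z) \<in> Fcar n P"
    using Fcar_cmul Ocar_Fcar[OF assms(1) z] Ocar_Fcar[OF assms(2) z] by blast
qed (use assms in \<open>auto simp: Ocar_0 cmul_def\<close>)

lemma cmul_mon:
  "cmul (\<lambda>\<beta>. if \<beta> = [] then a else 0) c = (\<lambda>\<alpha>. a * c \<alpha>)" for a :: complex
proof
  fix \<alpha>
  have "cmul (\<lambda>\<beta>. if \<beta> = [] then a else 0) c \<alpha> = (\<Sum>i\<le>length \<alpha>. if i = 0 then a * c \<alpha> else 0)"
    unfolding cmul_def by (intro sum.cong) auto
  then show "cmul (\<lambda>\<beta>. if \<beta> = [] then a else 0) c \<alpha> = a * c \<alpha>" by simp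
qed

lemma cmul_single:
  "cmul (\<lambda>\<gamma>. if \<gamma> = \<alpha> then a else 0) (\<lambda>\<gamma>. if \<gamma> = \<beta> then b else 0) = (\<lambda>\<gamma>. if \<gamma> = \<alpha> @ \<beta> then a * b else 0)" for a b :: complex
proof
  fix \<gamma>
  have "(take i \<gamma> = \<alpha> \<and> drop i \<gamma> = \<beta>) \<longleftrightarrow> (i = length \<alpha> \<and> \<gamma> = \<alpha> @ \<beta>)" if "i \<le> length \<gamma>" for i
    using that by auto
  note iff = this
  have "cmul (\<lambda>\<gamma>. if \<gamma> = \<alpha> then a else 0) (\<lambda>\<gamma>. if \<gamma> = \<beta> then b else 0) \<gamma>
     = (\<Sum>i\<le>length \<gamma>. if take i \<gamma> = \<alpha> \<and> drop i \<gamma> = \<beta> then a * b else 0)"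
    unfolding cmul_def by (intro sum.cong) auto
  also have "\<dots> = (\<Sum>i\<le>length \<gamma>. if i = length \<alpha> \<and> \<gamma> = \<alpha> @ \<beta> then a * b else 0)"
    by (intro sum.cong refl) (simp only: iff atMost_iff)
  also have "\<dots> = (\<Sum>i\<le>length \<gamma>. if i = length \<alpha> then (if \<gamma> = \<alpha> @ \<beta> then a * b else 0) else 0)"
    by (intro sum.cong) auto
  finally have "cmul (\<lambda>\<gamma>. if \<gamma> = \<alpha> then a else 0) (\<lambda>\<gamma>. if \<gamma> = \<beta> then b else 0) \<gamma>
     = (\<Sum>i\<le>length \<gamma>. if i = length \<alpha> then (if \<gamma> = \<alpha> @ \<beta> then a * b else 0) else 0)" .
  then show "cmul (\<lambda>\<gamma>. if \<gamma> = \<alpha> then a else 0) (\<lambda>\<gamma>. if \<gamma> = \<beta> then b else 0) \<gamma> = (if \<gamma> = \<alpha> @ \<beta> then a * b else 0)" by simp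
qed

text \<open>The action of \<open>h\<close> is multiplication by the scalar series
  \<open>mon h []\<close>, so the product rule covers it.\<close>

lemma Ocar_act:
  assumes h: "h holomorphic_on (- {0})" and f: "f \<in> Ocar n P"
  shows "(\<lambda>z \<alpha>. h z * f z \<alpha>) \<in> Ocar n P"
proof -
  have "(\<lambda>z. cmul (mon h [] z) (f z)) = (\<lambda>z \<alpha>. h z * f z \<alpha>)"
  proof
    fix z show "cmul (mon h [] z) (f z) = (\<lambda>\<alpha>. h z * f z \<alpha>)"
      using cmul_mon[of "h z" "f z"] Ocar_0[OF f] by (cases "z = 0") (auto simp: mon_def cmul_def)
  qed
  then show ?thesis using Ocar_cmul[OF Ocar_mon[OF h Nil_in_words] f] by simp
qed

text \<open>\<open>p_coeff\<close> bounds a coefficient by a seminorm, so the difference quotients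
  of the coefficient converge along with those of \<open>f\<close>.\<close>

lemma coeff_holomorphic:
  assumes f: "f \<in> Ocar n P"
  shows "(\<lambda>z. f z \<alpha>) holomorphic_on (- {0})"
proof (cases "\<alpha> \<in> words n")
  case False
  then have "f z \<alpha> = 0" for z using Fcar_off[OF Ocar_Fcar'[OF f]] by blast
  then show ?thesis by simp
next
  case True
  have "(\<lambda>z. f z \<alpha>) field_differentiable at z" if z: "z \<in> - {0}" for z
  proof -
    obtain g where g: "g \<in> Fcar n P" "has_der f g z" using Ocar_der[OF f] z by blast
    obtain p where p: "p \<in> P" using N_ne by blast
    obtain C where C: "C > 0" "\<And>c. ennreal (norm (c \<alpha>)) \<le> ennreal C * p c" using p_coeff[OF p True] by blast
    let ?D = "\<lambda>w \<alpha>. (f w \<alpha> - f z \<alpha>) / (w - z) - g \<alpha>"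
    have "((\<lambda>w. ennreal C * p (?D w)) \<longlongrightarrow> ennreal C * 0) (at z)"
      using g p unfolding has_der_def by (intro ennreal_tendsto_cmult) auto
    then have "((\<lambda>w. ennreal C * p (?D w)) \<longlongrightarrow> 0) (at z)" by simp
    then have "((\<lambda>w. ennreal (norm (?D w \<alpha>))) \<longlongrightarrow> 0) (at z)"
      by (rule tendsto_0_le_ennreal) (intro always_eventually allI C(2))
    then have "((\<lambda>w. ennreal (norm (?D w \<alpha>))) \<longlongrightarrow> ennreal 0) (at z)" by simp
    then have "((\<lambda>w. norm (?D w \<alpha>)) \<longlongrightarrow> 0) (at z)"
      by (rule tendsto_ennrealD) auto
    then have "((\<lambda>w. ?D w \<alpha>) \<longlongrightarrow> 0) (at z)" by (rule tendsto_norm_zero_cancel)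
    then have "((\<lambda>w. (f w \<alpha> - f z \<alpha>) / (w - z)) \<longlongrightarrow> g \<alpha>) (at z)" by (rule LIM_zero_cancel)
    then show ?thesis unfolding field_differentiable_def has_field_derivative_iff by blast
  qed
  then show ?thesis by (simp add: holomorphic_on_def field_differentiable_at_within)
qed

text \<open>Tails are small at one point by summability, and stay small nearby because the tail of
  \<open>f w\<close> exceeds that of \<open>f z\<close> by at most the norm of the difference.
  Lengthening the cut only shrinks tails, so finitely many such neighbourhoods share one
  bound.\<close>

lemma tail_uniformly_small:
  assumes f: "f \<in> Ocar n P" and p: "p \<in> P" and K: "compact K" "K \<subseteq> - {0}" and e: "e > (0::real)"
  obtains M where "\<And>M'. M' \<ge> M \<Longrightarrow> (SUP z\<in>K. p (tail M' (f z))) < ennreal e"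
proof -
  have "\<exists>U M. open U \<and> z \<in> U \<and> (\<forall>w\<in>U. \<forall>M'\<ge>M. p (tail M' (f w)) \<le> ennreal (e / 2))" if z: "z \<in> K" for z
  proof -
    have z0: "z \<noteq> 0" using z K by auto
    obtain g where g: "g \<in> Fcar n P" "has_der f g z" using Ocar_der[OF f z0] by blast
    have "((\<lambda>w. p (\<lambda>\<alpha>. f w \<alpha> - f z \<alpha>)) \<longlongrightarrow> 0) (at z)"
      using has_der_continuous[OF g(2) p Fcar_finite[OF g(1) p]] .
    then have "\<forall>\<^sub>F w in at z. p (\<lambda>\<alpha>. f w \<alpha> - f z \<alpha>) < ennreal (e / 4)"
      using e by (intro order_tendstoD(2)) auto
    then obtain U where U: "open U" "z \<in> U" "\<And>w. w \<in> U \<Longrightarrow> w \<noteq> z \<Longrightarrow> p (\<lambda>\<alpha>. f w \<alpha> - f z \<alpha>) < ennreal (e / 4)"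
      unfolding eventually_at_topological by auto
    obtain M where M: "p (tail M (f z)) < ennreal (e / 4)"
      using tail_small[OF Ocar_Fcar'[OF f] p, of "e / 4"] e by auto
    have "p (tail M' (f w)) \<le> ennreal (e / 2)" if w: "w \<in> U" and M': "M' \<ge> M" for w M'
    proof -
      have d: "p (\<lambda>\<alpha>. f w \<alpha> - f z \<alpha>) \<le> ennreal (e / 4)"
        using U(3)[OF w] p_zero[OF p] by (cases "w = z") auto
      have "p (tail M' (f w)) = p (\<lambda>\<alpha>. tail M' (\<lambda>\<alpha>. f w \<alpha> - f z \<alpha>) \<alpha> + tail M' (f z) \<alpha>)"
        by (rule arg_cong[where f = p]) (auto simp: tail_def)
      also have "\<dots> \<le> p (tail M' (\<lambda>\<alpha>. f w \<alpha> - f z \<alpha>)) + p (tail M' (f z))" by (rule p_add[OF p])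
      also have "\<dots> \<le> p (\<lambda>\<alpha>. f w \<alpha> - f z \<alpha>) + p (tail M (f z))"
        using M' by (intro add_mono p_mono[OF p]) (auto simp: tail_def)
      also have "\<dots> \<le> ennreal (e / 4) + ennreal (e / 4)" using d M by (intro add_mono) auto
      also have "\<dots> = ennreal (e / 2)" using e by (simp flip: ennreal_plus)
      finally show ?thesis .
    qed
    then show ?thesis using U by blast
  qed
  then obtain U M where UM: "\<And>z. z \<in> K \<Longrightarrow> open (U z) \<and> z \<in> U z \<and> (\<forall>w\<in>U z. \<forall>M'\<ge>M z. p (tail M' (f w)) \<le> ennreal (e / 2))"
    by metis
  obtain K0 where K0: "K0 \<subseteq> K" "finite K0" "K \<subseteq> (\<Union>z\<in>K0. U z)"
    by (rule compactE_image[OF K(1), of K U]) (use UM in auto)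
  show thesis
  proof (rule that)
    fix M' assume M': "M' \<ge> (\<Sum>z\<in>K0. M z)"
    have "p (tail M' (f w)) \<le> ennreal (e / 2)" if w: "w \<in> K" for w
    proof -
      obtain z where z: "z \<in> K0" "w \<in> U z" using K0 w by blast
      have "M z \<le> (\<Sum>z\<in>K0. M z)" using K0 z by (intro member_le_sum) auto
      then show ?thesis using UM[of z] z K0 M' by auto
    qed
    then have "(SUP z\<in>K. p (tail M' (f z))) \<le> ennreal (e / 2)" by (rule SUP_least)
    also have "\<dots> < ennreal e" using e by (intro ennreal_lessI) auto
    finally show "(SUP z\<in>K. p (tail M' (f z))) < ennreal e" .
  qed
qed

lemma Oalg_simps:
  "ta_carrier (Oalg n P) = Ocar n P"
  "ta_add (Oalg n P) f g = (\<lambda>z \<alpha>. f z \<alpha> + g z \<alpha>)"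
  "ta_mul (Oalg n P) f g = (\<lambda>z. cmul (f z) (g z))"
  "ta_smul (Oalg n P) c f = (\<lambda>z \<alpha>. c * f z \<alpha>)"
  "ta_zero (Oalg n P) = (\<lambda>z \<alpha>. 0)"
  "ta_one (Oalg n P) = mon (\<lambda>z. 1) []"
  "ta_act (Oalg n P) h f = (\<lambda>z \<alpha>. h z * f z \<alpha>)"
  "ta_top (Oalg n P) = semi_top (Ocar n P) (Odist P)"
  by (auto simp: Oalg_def cmul_def mon_def)

lemma Ocar_smul: "f \<in> Ocar n P \<Longrightarrow> (\<lambda>z \<alpha>. c * f z \<alpha>) \<in> Ocar n P"
  using Ocar_act[of "\<lambda>_. c"] by simp

lemma Ocar_zero: "(\<lambda>z \<alpha>. 0) \<in> Ocar n P"
  using Ocar_const[OF Fcar_zero] by (simp add: const_def)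

lemma talg_Oalg: "talg (Oalg n P)"
proof
  show "ta_one (Oalg n P) \<in> ta_carrier (Oalg n P)"
    unfolding Oalg_simps by (rule Ocar_mon) auto
qed (auto simp: Oalg_simps cmul_add_left cmul_add_right algebra_simps
   intro: Ocar_add Ocar_cmul Ocar_smul Ocar_zero)

end

section \<open>The fiber of the deformation\<close>

text \<open>Both sides are suprema of finite sums of nonnegative terms: a finite set lies below some
  level, and the part of \<open>A\<close> below a level is finite.\<close>

lemma infsum_ennreal_graded:
  fixes f :: "'a \<Rightarrow> ennreal" and g :: "'a \<Rightarrow> nat"
  assumes fin: "\<And>d. finite {x \<in> A. g x = d}"
  shows "infsum f A = (\<Sum>d. \<Sum>x\<in>{x \<in> A. g x = d}. f x)"
proof (rule antisym)
  have fin': "finite {x \<in> A. g x < M}" for M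
  proof -
    have "{x \<in> A. g x < M} = (\<Union>d<M. {x \<in> A. g x = d})" by auto
    then show ?thesis using fin by simp
  qed
  have part: "(\<Sum>d<M. \<Sum>x\<in>{x \<in> A. g x = d}. f x) = (\<Sum>x\<in>{x \<in> A. g x < M}. f x)" for M
  proof -
    have "(\<Sum>x\<in>{x \<in> A. g x < M}. f x) = (\<Sum>d<M. \<Sum>x\<in>{x \<in> {x \<in> A. g x < M}. g x = d}. f x)"
      by (rule sum.group[symmetric]) (auto simp: fin')
    also have "\<dots> = (\<Sum>d<M. \<Sum>x\<in>{x \<in> A. g x = d}. f x)" by (intro sum.cong) auto
    finally show ?thesis by simp
  qed
  have sup: "infsum f A = (SUP F\<in>{F. finite F \<and> F \<subseteq> A}. sum f F)"
    by (rule nonneg_infsum_complete) simp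
  show "infsum f A \<le> (\<Sum>d. \<Sum>x\<in>{x \<in> A. g x = d}. f x)"
    unfolding sup
  proof (rule SUP_least)
    fix F assume F: "F \<in> {F. finite F \<and> F \<subseteq> A}"
    let ?M = "Suc (\<Sum>x\<in>F. g x)"
    have "g x < ?M" if "x \<in> F" for x
      using F that member_le_sum[of x F g] by (simp add: less_Suc_eq_le)
    then have "sum f F \<le> sum f {x \<in> A. g x < ?M}"
      using F fin' by (intro sum_mono2) auto
    also have "\<dots> \<le> (\<Sum>d. \<Sum>x\<in>{x \<in> A. g x = d}. f x)"
      unfolding part[symmetric] by (rule sum_le_suminf[OF summableI]) auto
    finally show "sum f F \<le> (\<Sum>d. \<Sum>x\<in>{x \<in> A. g x = d}. f x)" .
  qed
  show "(\<Sum>d. \<Sum>x\<in>{x \<in> A. g x = d}. f x) \<le> infsum f A"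
    unfolding suminf_eq_SUP sup part
    by (intro SUP_mono) (use fin' in auto)
qed

definition oqnorm :: "nat \<Rightarrow> ((nat \<Rightarrow> nat) \<Rightarrow> real) \<Rightarrow> real \<Rightarrow> ((nat \<Rightarrow> nat) \<Rightarrow> complex) \<Rightarrow> ennreal" where
  "oqnorm n w \<rho> c = (\<Sum>\<^sub>\<infinity>k\<in>midx n. ennreal (norm (c k) * w k * \<rho> ^ mdeg n k))"

lemma sort_eq_iff_count_list: "sorted \<beta> \<Longrightarrow> sort \<alpha> = \<beta> \<longleftrightarrow> count_list \<alpha> = count_list (\<beta> :: nat list)"
  by (metis count_mset ext multiset_eqI properties_for_sort mset_sort sorted_sort)

text \<open>What polydisc and ball have to supply: \<open>phi_bound\<close> makes \<open>phi\<close>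
  continuous, and the assumptions on \<open>s\<close> give a bounded right inverse. The estimates
  are asked degree by degree, so that summing over \<open>d\<close> turns them into estimates of the
  norms; each of them is free to change the radius.\<close>

locale fiber_setup = graded_norms n \<N>
  for n :: nat and \<N> :: "(nat \<Rightarrow> (nat list \<Rightarrow> complex) \<Rightarrow> real) set" +
  fixes r :: ereal and q :: complex and w :: "(nat \<Rightarrow> nat) \<Rightarrow> real"
    and s :: "((nat \<Rightarrow> nat) \<Rightarrow> complex) \<Rightarrow> nat list \<Rightarrow> complex"
  assumes r_pos: "0 < r" and q_nz: "q \<noteq> 0"
    and w_pos: "\<And>k. w k > 0"
    and phi_bound: "\<And>\<rho>. 0 < \<rho> \<Longrightarrow> ereal \<rho> < r \<Longrightarrow>
        \<exists>N\<in>\<N>. \<exists>C>0. \<forall>c d. (\<Sum>k\<in>kdeg n d. norm (phi n q c k) * w k * \<rho> ^ d) \<le> C * N d c"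
    and s_phi: "\<And>b k. k \<in> midx n \<Longrightarrow> phi n q (s b) k = b k"
    and s_off: "\<And>b \<alpha>. \<alpha> \<notin> words n \<Longrightarrow> s b \<alpha> = 0"
    and s_bound: "\<And>N. N \<in> \<N> \<Longrightarrow> \<exists>\<rho> C. 0 < \<rho> \<and> ereal \<rho> < r \<and> 0 < C \<and>
        (\<forall>b d. N d (s b) \<le> C * (\<Sum>k\<in>kdeg n d. norm (b k) * w k * \<rho> ^ d))"
begin

abbreviation "A \<equiv> Oalg n P"
abbreviation "B \<equiv> Oq_alg n w r q"

sublocale A: talg A by (rule talg_Oalg)

section \<open>The evaluation homomorphism\<close>

definition \<pi> :: "(complex \<Rightarrow> nat list \<Rightarrow> complex) \<Rightarrow> (nat \<Rightarrow> nat) \<Rightarrow> complex" where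
  "\<pi> f = phi n q (f q)"

lemma oqnorm_graded:
  assumes "\<rho> > 0"
  shows "oqnorm n w \<rho> c = (\<Sum>d. ennreal (\<Sum>k\<in>kdeg n d. norm (c k) * w k * \<rho> ^ d))"
proof -
  have "oqnorm n w \<rho> c = (\<Sum>d. \<Sum>k\<in>kdeg n d. ennreal (norm (c k) * w k * \<rho> ^ mdeg n k))"
    unfolding oqnorm_def kdeg_def
    by (rule infsum_ennreal_graded) (use finite_kdeg in \<open>simp add: kdeg_def\<close>)
  also have "\<dots> = (\<Sum>d. \<Sum>k\<in>kdeg n d. ennreal (norm (c k) * w k * \<rho> ^ d))"
    by (intro suminf_cong sum.cong) (auto simp: kdeg_def)
  also have "\<dots> = (\<Sum>d. ennreal (\<Sum>k\<in>kdeg n d. norm (c k) * w k * \<rho> ^ d))"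
    using assms w_pos by (intro suminf_cong sum_ennreal) (simp add: less_imp_le)
  finally show ?thesis .
qed

lemma oqnorm_phi:
  assumes "0 < \<rho>" "ereal \<rho> < r"
  obtains p C where "p \<in> P" "C > 0" "\<And>c. oqnorm n w \<rho> (phi n q c) \<le> ennreal C * p c"
proof -
  obtain N C where N: "N \<in> \<N>" "C > 0"
    "\<And>c d. (\<Sum>k\<in>kdeg n d. norm (phi n q c k) * w k * \<rho> ^ d) \<le> C * N d c"
    using phi_bound[OF assms] by blast
  have "oqnorm n w \<rho> (phi n q c) \<le> ennreal C * gsum N c" for c
  proof -
    have "oqnorm n w \<rho> (phi n q c) \<le> (\<Sum>d. ennreal (C * N d c))"
      unfolding oqnorm_graded[OF assms(1)] by (intro suminf_le summableI ennreal_leI N(3))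
    also have "\<dots> = ennreal C * gsum N c"
      using N(1,2) by (simp add: ennreal_mult N_nonneg gsum_def)
    finally show ?thesis .
  qed
  then show thesis using that N by blast
qed

lemma p_s:
  assumes "p \<in> P"
  obtains \<rho> C where "0 < \<rho>" "ereal \<rho> < r" "C > 0" "\<And>b. p (s b) \<le> ennreal C * oqnorm n w \<rho> b"
proof -
  obtain N where N: "N \<in> \<N>" "p = gsum N" using assms by blast
  obtain \<rho> C where C: "0 < \<rho>" "ereal \<rho> < r" "0 < C"
    "\<And>b d. N d (s b) \<le> C * (\<Sum>k\<in>kdeg n d. norm (b k) * w k * \<rho> ^ d)"
    using s_bound[OF N(1)] by blast
  have "p (s b) \<le> ennreal C * oqnorm n w \<rho> b" for b
  proof -
    have "p (s b) \<le> (\<Sum>d. ennreal (C * (\<Sum>k\<in>kdeg n d. norm (b k) * w k * \<rho> ^ d)))"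
      unfolding N(2) gsum_def by (intro suminf_le summableI ennreal_leI C(4))
    also have "\<dots> = (\<Sum>d. ennreal C * ennreal (\<Sum>k\<in>kdeg n d. norm (b k) * w k * \<rho> ^ d))"
      using C w_pos by (intro suminf_cong ennreal_mult sum_nonneg) (auto simp: less_imp_le)
    also have "\<dots> = ennreal C * oqnorm n w \<rho> b"
      unfolding oqnorm_graded[OF C(1)] by simp
    finally show ?thesis .
  qed
  then show thesis using that C by blast
qed

lemma Oq_norms_eq: "Oq_norms n w r = oqnorm n w ` {\<rho>. 0 < \<rho> \<and> ereal \<rho> < r}"
  unfolding Oq_norms_def oqnorm_def[abs_def] by auto

lemma Oq_car_iff: "c \<in> Oq_car n w r \<longleftrightarrow> (\<forall>k. k \<notin> midx n \<longrightarrow> c k = 0) \<and>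
    (\<forall>\<rho>. 0 < \<rho> \<and> ereal \<rho> < r \<longrightarrow> oqnorm n w \<rho> c < top)"
  unfolding Oq_car_def Oq_norms_eq by auto

lemma B_simps:
  "ta_carrier B = Oq_car n w r"
  "ta_add B c d = (\<lambda>k. c k + d k)"
  "ta_mul B c d = (\<lambda>m. \<Sum>k\<in>{k. \<forall>i. k i \<le> m i}. c k * d (\<lambda>i. m i - k i) / q ^ cross2 n k (\<lambda>i. m i - k i))"
  "ta_smul B a c = (\<lambda>k. a * c k)"
  "ta_zero B = (\<lambda>k. 0)"
  "ta_one B = (\<lambda>k. if k = (\<lambda>_. 0) then 1 else 0)"
  "ta_top B = semi_top (Oq_car n w r) {(\<lambda>c d. p (\<lambda>k. c k - d k)) | p. p \<in> Oq_norms n w r}"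
  by (auto simp: Oq_alg_def cross2_def)

lemma zero_laws_B: "zero_laws B"
  unfolding zero_laws_def B_simps by (auto simp: fun_eq_iff)

lemma oqnorm_diff:
  assumes "\<rho> > 0"
  shows "oqnorm n w \<rho> (\<lambda>k. b k - c k) \<le> oqnorm n w \<rho> b + oqnorm n w \<rho> c"
proof -
  have "norm (b k - c k) * w k * \<rho> ^ mdeg n k \<le> norm (b k) * w k * \<rho> ^ mdeg n k + norm (c k) * w k * \<rho> ^ mdeg n k" for k
    using assms w_pos[of k] norm_triangle_ineq4[of "b k" "c k"]
    by (simp add: less_imp_le mult_right_mono flip: distrib_right)
  then have "oqnorm n w \<rho> (\<lambda>k. b k - c k) \<le> (\<Sum>\<^sub>\<infinity>k\<in>midx n. ennreal (norm (b k) * w k * \<rho> ^ mdeg n k) + ennreal (norm (c k) * w k * \<rho> ^ mdeg n k))"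
    unfolding oqnorm_def using assms w_pos
    by (intro infsum_mono nonneg_summable_on_complete) (auto simp: less_imp_le simp flip: ennreal_plus intro!: ennreal_leI)
  also have "\<dots> = oqnorm n w \<rho> b + oqnorm n w \<rho> c"
    unfolding oqnorm_def by (intro infsum_add nonneg_summable_on_complete) auto
  finally show ?thesis .
qed

lemma Oq_car_diff: "b \<in> Oq_car n w r \<Longrightarrow> c \<in> Oq_car n w r \<Longrightarrow> (\<lambda>k. b k - c k) \<in> Oq_car n w r"
proof -
  assume b: "b \<in> Oq_car n w r" and c: "c \<in> Oq_car n w r"
  have "oqnorm n w \<rho> (\<lambda>k. b k - c k) < top" if "0 < \<rho> \<and> ereal \<rho> < r" for \<rho>
  proof (rule le_less_trans[OF oqnorm_diff])
    show "oqnorm n w \<rho> b + oqnorm n w \<rho> c < top"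
      using b c that unfolding Oq_car_iff by (simp add: ennreal_add_less_top)
  qed (use that in simp)
  then show ?thesis using b c unfolding Oq_car_iff by simp
qed

lemma \<pi>_carrier: "f \<in> Ocar n P \<Longrightarrow> \<pi> f \<in> Oq_car n w r"
proof -
  assume f: "f \<in> Ocar n P"
  have "oqnorm n w \<rho> (\<pi> f) < top" if \<rho>: "0 < \<rho>" "ereal \<rho> < r" for \<rho>
  proof -
    obtain p C where p: "p \<in> P" "C > 0" "\<And>c. oqnorm n w \<rho> (phi n q c) \<le> ennreal C * p c"
      using oqnorm_phi[OF \<rho>] by blast
    have "ennreal C * p (f q) < top"
      using Fcar_finite[OF Ocar_Fcar'[OF f] p(1)] by (simp add: ennreal_mult_less_top)
    then show ?thesis unfolding \<pi>_def by (rule le_less_trans[OF p(3)])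
  qed
  moreover have "\<pi> f k = 0" if "k \<notin> midx n" for k
    using wcls_empty[OF that] by (simp add: \<pi>_def phi_def)
  ultimately show ?thesis unfolding Oq_car_iff by blast
qed

lemma s_Fcar: "b \<in> Oq_car n w r \<Longrightarrow> s b \<in> Fcar n P"
proof (rule FcarI)
  fix p assume b: "b \<in> Oq_car n w r" and p: "p \<in> P"
  obtain \<rho> C where C: "0 < \<rho>" "ereal \<rho> < r" "C > 0" "\<And>b. p (s b) \<le> ennreal C * oqnorm n w \<rho> b"
    using p_s[OF p] by blast
  have "ennreal C * oqnorm n w \<rho> b < top" using b C unfolding Oq_car_iff by (simp add: ennreal_mult_less_top)
  then show "p (s b) < top" by (rule le_less_trans[OF C(4)])
qed (rule s_off)

lemma phi_s: "b \<in> Oq_car n w r \<Longrightarrow> phi n q (s b) = b"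
proof
  fix k assume "b \<in> Oq_car n w r"
  then show "phi n q (s b) k = b k"
    using s_phi wcls_empty[of k n] by (cases "k \<in> midx n") (auto simp: phi_def Oq_car_iff)
qed

lemma continuous_\<pi>: "continuous_map (ta_top A) (ta_top B) \<pi>"
  unfolding Oalg_simps B_simps
proof (rule continuous_map_semi_top[OF \<pi>_carrier])
  fix e assume "e \<in> {(\<lambda>c d. p (\<lambda>k. c k - d k)) | p. p \<in> Oq_norms n w r}"
  then obtain \<rho> where \<rho>: "0 < \<rho>" "ereal \<rho> < r" "e = (\<lambda>c d. oqnorm n w \<rho> (\<lambda>k. c k - d k))"
    unfolding Oq_norms_eq by blast
  obtain p C where p: "p \<in> P" "C > 0" "\<And>c. oqnorm n w \<rho> (phi n q c) \<le> ennreal C * p c"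
    using oqnorm_phi[OF \<rho>(1,2)] by blast
  \<comment> \<open>\<open>\<pi>\<close> sees only the value at \<open>q\<close>, so the compact set
    \<open>{q}\<close> is enough.\<close>
  let ?d = "\<lambda>f g :: complex \<Rightarrow> nat list \<Rightarrow> complex. SUP z\<in>{q}. p (\<lambda>\<alpha>. f z \<alpha> - g z \<alpha>)"
  have "?d \<in> Odist P"
    unfolding Odist_def by (rule CollectI, rule exI[of _ "{q}"], rule exI[of _ p]) (use p(1) q_nz in simp)
  moreover have "e (\<pi> y) (\<pi> x) \<le> ennreal C * ?d y x" for x y
  proof -
    have "(\<lambda>k. \<pi> y k - \<pi> x k) = phi n q (\<lambda>\<alpha>. y q \<alpha> - x q \<alpha>)" by (simp add: \<pi>_def phi_diff fun_eq_iff)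
    then show ?thesis unfolding \<rho>(3) using p(3)[of "\<lambda>\<alpha>. y q \<alpha> - x q \<alpha>"] by simp
  qed
  ultimately show "\<exists>d\<in>Odist P. \<exists>C>0. \<forall>x\<in>Ocar n P. \<forall>y\<in>Ocar n P. e (\<pi> y) (\<pi> x) \<le> ennreal C * d y x"
    using p(2) by (intro bexI[of _ ?d] exI[of _ C] conjI ballI)
qed

text \<open>Lifts along constant functions are uniformly small on every compact set, so openness
  needs no open mapping theorem.\<close>

lemma open_\<pi>: "open_map (ta_top A) (ta_top B) \<pi>"
  unfolding Oalg_simps B_simps
proof (rule open_map_semi_top[where \<sigma> = "\<lambda>f b z \<alpha>. f z \<alpha> + const (s (\<lambda>k. b k - \<pi> f k)) z \<alpha>", OF \<pi>_carrier])
  fix f b assume f: "f \<in> Ocar n P" and b: "b \<in> Oq_car n w r"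
  have d: "(\<lambda>k. b k - \<pi> f k) \<in> Oq_car n w r" using Oq_car_diff[OF b \<pi>_carrier[OF f]] .
  have "\<pi> (\<lambda>z \<alpha>. f z \<alpha> + const (s (\<lambda>k. b k - \<pi> f k)) z \<alpha>) = b"
    using phi_s[OF d] q_nz unfolding \<pi>_def const_def by (simp add: phi_add fun_eq_iff)
  then show "(\<lambda>z \<alpha>. f z \<alpha> + const (s (\<lambda>k. b k - \<pi> f k)) z \<alpha>) \<in> Ocar n P
      \<and> \<pi> (\<lambda>z \<alpha>. f z \<alpha> + const (s (\<lambda>k. b k - \<pi> f k)) z \<alpha>) = b"
    using Ocar_add[OF f Ocar_const[OF s_Fcar[OF d]]] by blast
next
  fix d assume "d \<in> Odist P"
  then obtain K p where K: "p \<in> P" "d = (\<lambda>f g. SUP z\<in>K. p (\<lambda>\<alpha>. f z \<alpha> - g z \<alpha>))" "K \<subseteq> - {0}"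
    unfolding Odist_def by blast
  obtain \<rho> C where C: "0 < \<rho>" "ereal \<rho> < r" "C > 0" "\<And>b. p (s b) \<le> ennreal C * oqnorm n w \<rho> b"
    using p_s[OF K(1)] by blast
  let ?e = "\<lambda>c d. oqnorm n w \<rho> (\<lambda>k. c k - d k)"
  have "?e \<in> {(\<lambda>c d. p (\<lambda>k. c k - d k)) | p. p \<in> Oq_norms n w r}" unfolding Oq_norms_eq using C by blast
  moreover have "d (\<lambda>z \<alpha>. f z \<alpha> + const (s (\<lambda>k. b k - \<pi> f k)) z \<alpha>) f \<le> ennreal C * ?e b (\<pi> f)" for f b
    unfolding K(2)
  proof (rule SUP_least)
    fix z assume "z \<in> K"
    then have "z \<noteq> 0" using K by auto
    then have "(\<lambda>\<alpha>. f z \<alpha> + const (s (\<lambda>k. b k - \<pi> f k)) z \<alpha> - f z \<alpha>) = s (\<lambda>k. b k - \<pi> f k)"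
      by (simp add: const_def)
    then show "p (\<lambda>\<alpha>. f z \<alpha> + const (s (\<lambda>k. b k - \<pi> f k)) z \<alpha> - f z \<alpha>) \<le> ennreal C * ?e b (\<pi> f)"
      using C(4) by simp
  qed
  ultimately show "\<exists>e\<in>{(\<lambda>c d. p (\<lambda>k. c k - d k)) | p. p \<in> Oq_norms n w r}. \<exists>C>0. \<forall>f\<in>Ocar n P. \<forall>b\<in>Oq_car n w r.
      d (\<lambda>z \<alpha>. f z \<alpha> + const (s (\<lambda>k. b k - \<pi> f k)) z \<alpha>) f \<le> ennreal C * e b (\<pi> f)"
    using C(3) by (intro bexI[of _ ?e] exI[of _ C] conjI ballI)
qed

lemma count_list_Nil_fun: "count_list [] = (\<lambda>_. 0)"
  by (simp add: fun_eq_iff)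

lemma open_hom_\<pi>: "open_hom A B \<pi>"
  unfolding open_hom_def
proof (intro conjI ballI allI continuous_\<pi> open_\<pi>)
  show "\<pi> ` ta_carrier A = ta_carrier B"
    unfolding Oalg_simps B_simps
  proof (intro subset_antisym subsetI)
    fix b assume b: "b \<in> Oq_car n w r"
    have "\<pi> (const (s b)) = b" using phi_s[OF b] q_nz by (simp add: \<pi>_def const_def)
    then show "b \<in> \<pi> ` Ocar n P" using Ocar_const[OF s_Fcar[OF b]] by (metis imageI)
  qed (use \<pi>_carrier in auto)
  show "\<pi> (ta_one A) = ta_one B"
    unfolding Oalg_simps B_simps \<pi>_def mon_def
    using q_nz phi_single[of "[]" n q 1] by (simp add: fun_eq_iff[of "phi n q _"] count_list_Nil_fun)
qed (auto simp: Oalg_simps B_simps \<pi>_def phi_add phi_scale phi_cmul[OF q_nz])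

lemma topspace_B: "topspace (ta_top B) = ta_carrier B"
  unfolding B_simps by simp

text \<open>A nonzero coefficient \<open>b k\<close> contributes its weighted modulus to a norm of
  \<open>b\<close>, so the ball of that radius about \<open>b\<close> misses 0. It makes the kernels
  closed, which is how they come to contain \<open>J\<close> and the fiber ideal.\<close>

lemma closedin_zero: "closedin (ta_top B) {\<lambda>k. 0}"
proof -
  let ?E = "{(\<lambda>c d. p (\<lambda>k. c k - d k)) | p. p \<in> Oq_norms n w r}"
  obtain \<rho> :: real where \<rho>: "0 < \<rho>" "ereal \<rho> < r"
    using ereal_dense2[OF r_pos] by (metis ereal_less(2))
  have "openin (ta_top B) (Oq_car n w r - {\<lambda>k. 0})"
    unfolding B_simps openin_semi_top
  proof (intro conjI ballI)
    fix b assume b: "b \<in> Oq_car n w r - {\<lambda>k. 0}"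
    then obtain k where k: "b k \<noteq> 0" by (auto simp: fun_eq_iff)
    then have km: "k \<in> midx n" using b by (auto simp: Oq_car_iff)
    let ?\<epsilon> = "norm (b k) * w k * \<rho> ^ mdeg n k"
    let ?e = "\<lambda>c d. oqnorm n w \<rho> (\<lambda>k. c k - d k)"
    have "ennreal ?\<epsilon> \<le> ?e (\<lambda>k. 0) b"
    proof -
      have "ennreal (norm (0 - b k) * w k * \<rho> ^ mdeg n k) = (\<Sum>\<^sub>\<infinity>k\<in>{k}. ennreal (norm (0 - b k) * w k * \<rho> ^ mdeg n k))"
        by simp
      also have "\<dots> \<le> ?e (\<lambda>k. 0) b"
        unfolding oqnorm_def by (rule infsum_mono_neutral) (use km in \<open>auto intro: nonneg_summable_on_complete\<close>)
      finally show ?thesis by simp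
    qed
    then have "{y \<in> Oq_car n w r. \<forall>d\<in>{?e}. d y b < ennreal ?\<epsilon>} \<subseteq> Oq_car n w r - {\<lambda>k. 0}" by auto
    moreover have "?\<epsilon> > 0" using k w_pos \<rho> by simp
    moreover have "{?e} \<subseteq> ?E" unfolding Oq_norms_eq using \<rho> by blast
    ultimately show "\<exists>D0 (\<epsilon>::real). finite D0 \<and> D0 \<subseteq> ?E \<and> \<epsilon> > 0
       \<and> {y\<in>Oq_car n w r. \<forall>d\<in>D0. d y b < ennreal \<epsilon>} \<subseteq> Oq_car n w r - {\<lambda>k. 0}"
      by (intro exI[of _ "{?e}"] exI[of _ ?\<epsilon>] conjI) auto
  qed blast
  moreover have "(\<lambda>k. 0) \<in> Oq_car n w r" using \<pi>_carrier[OF Ocar_zero] by (simp add: \<pi>_def phi_def[abs_def])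
  ultimately show ?thesis unfolding closedin_def topspace_B by (simp add: B_simps)
qed

text \<open>\<open>is_ideal\<close> does not mention the action. Writing it as a multiplication
  makes ideals stable under every holomorphic \<open>h\<close>, as \<open>act_coset\<close>
  requires.\<close>

lemma act_eq_mul:
  assumes "f \<in> Ocar n P"
  shows "ta_act A h f = ta_mul A (mon h []) f"
proof
  fix z show "ta_act A h f z = ta_mul A (mon h []) f z"
    using cmul_mon[of "h z" "f z"] Ocar_0[OF assms] by (cases "z = 0") (auto simp: mon_def cmul_def Oalg_simps)
qed

section \<open>The defining ideal and the fiber ideal\<close>

abbreviation "J \<equiv> def_ideal n P"
abbreviation "Q \<equiv> Odef n P"

lemma qgens_eq: "qgens n = {(\<lambda>z \<gamma>. mon (\<lambda>_. 1) [i, j] z \<gamma> + mon (\<lambda>z. - z) [j, i] z \<gamma>) | i j. i < j \<and> j < n}"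
  unfolding qgens_def mon_def
  by (intro Collect_cong ex_cong1 conj_cong refl arg_cong2[where f = "(=)"]) (auto simp: fun_eq_iff)

lemma qgens_ker: "qgens n \<subseteq> hom_ker A B \<pi>"
proof
  fix g assume "g \<in> qgens n"
  then obtain i j where ij: "i < j" "j < n" "g = (\<lambda>z \<gamma>. mon (\<lambda>_. 1) [i, j] z \<gamma> + mon (\<lambda>z. - z) [j, i] z \<gamma>)"
    unfolding qgens_eq by blast
  have "g \<in> Ocar n P"
    unfolding ij(3) using ij by (intro Ocar_add Ocar_mon) (auto intro: holomorphic_intros)
  \<comment> \<open>The word \<open>[j, i]\<close> has one inversion, so its coefficient -q
    contributes -1 and cancels the contribution 1 of \<open>[i, j]\<close>.\<close>
  moreover have "count_list [i, j] = count_list [j, i]" by (auto simp: fun_eq_iff)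
  then have "\<pi> g = (\<lambda>k. 0)"
    unfolding ij(3) \<pi>_def mon_def using q_nz ij
    by (simp add: phi_add phi_single fun_eq_iff[of "phi n q _"])
  ultimately show "g \<in> hom_ker A B \<pi>" unfolding hom_ker_def Oalg_simps B_simps by blast
qed

lemma closedin_ker: "closedin (ta_top A) (hom_ker A B \<pi>)"
proof -
  have "hom_ker A B \<pi> = {x \<in> topspace (ta_top A). \<pi> x \<in> {\<lambda>k. 0}}"
    unfolding hom_ker_def A.topspace_eq by (simp add: B_simps)
  then show ?thesis using closedin_continuous_map_preimage[OF continuous_\<pi> closedin_zero] by simp
qed

lemma J_subset_ker: "J \<subseteq> hom_ker A B \<pi>"
  unfolding def_ideal_def closed_ideal_gen_def
  using A.is_ideal_hom_ker[OF open_hom_\<pi> zero_laws_B] closedin_ker qgens_ker by blast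

lemma is_ideal_J: "is_ideal A J"
proof -
  \<comment> \<open>The kernel is a member of the intersected family and confines \<open>J\<close>
    to the carrier; the intersection of an empty family would be everything.\<close>
  have "J \<subseteq> ta_carrier A" using J_subset_ker unfolding hom_ker_def by blast
  then show ?thesis
    unfolding def_ideal_def closed_ideal_gen_def is_ideal_def by auto
qed

sublocale I: talg_ideal A J by unfold_locales (rule is_ideal_J)

lemma qgens_J: "qgens n \<subseteq> J"
  unfolding def_ideal_def closed_ideal_gen_def by blast

lemma Odef_eq: "Q = quot A J"
  by (simp add: Odef_def)

text \<open>Induction on the number of inversions: a descent \<open>b\<close>, \<open>a\<close> in
  \<open>\<alpha>\<close> is replaced by \<open>a\<close>, \<open>b\<close> at the cost of dividing
  the coefficient by \<open>z\<close>. The function \<open>g\<close> varies in the induction for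
  this reason.\<close>

lemma mon_sort_J:
  assumes "g holomorphic_on (- {0})" "\<alpha> \<in> words n"
  shows "(\<lambda>z \<gamma>. mon g \<alpha> z \<gamma> + mon (\<lambda>z. - (g z / z ^ invs \<alpha>)) (sort \<alpha>) z \<gamma>) \<in> J"
  using assms
proof (induction "invs \<alpha>" arbitrary: \<alpha> g)
  case 0
  then have "sort \<alpha> = \<alpha>" using invs_eq_0_imp_sorted[of \<alpha>] by (simp add: sorted_sort_id)
  then have "(\<lambda>z \<gamma>. mon g \<alpha> z \<gamma> + mon (\<lambda>z. - (g z / z ^ invs \<alpha>)) (sort \<alpha>) z \<gamma>) = ta_zero A"
    using 0(1) by (simp add: mon_def fun_eq_iff Oalg_simps)
  then show ?case using I.J_zero by simp
next
  case (Suc m)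
  then have "\<not> sorted \<alpha>" using invs_sorted[of \<alpha>] by auto
  then obtain \<beta> \<gamma> a b where \<alpha>: "\<alpha> = \<beta> @ [b, a] @ \<gamma>" and ab: "a < b" by (rule not_sorted_adjacent)
  let ?\<alpha>' = "\<beta> @ [a, b] @ \<gamma>"
  let ?gen = "\<lambda>z \<gamma>. mon (\<lambda>_. 1) [a, b] z \<gamma> + mon (\<lambda>z. - z) [b, a] z \<gamma>"
  let ?g = "\<lambda>z. g z / z"
  have inv: "invs \<alpha> = Suc (invs ?\<alpha>')" unfolding \<alpha> by (rule invs_adjacent_swap[OF ab])
  have w: "\<beta> \<in> words n" "\<gamma> \<in> words n" "a < n" "b < n" using Suc(4) unfolding \<alpha> by auto
  have hol: "?g holomorphic_on (- {0})" "(\<lambda>z. - ?g z) holomorphic_on (- {0})"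
    using Suc(3) by (auto intro!: holomorphic_intros)
  have "?gen \<in> J" using qgens_J ab w unfolding qgens_eq by blast
  \<comment> \<open>The left factor carries -g/z so that its product with ab - z ba has coefficient
    g on the descent and -g/z on the swapped word.\<close>
  then have gJ: "ta_mul A (ta_mul A (mon (\<lambda>z. - ?g z) \<beta>) ?gen) (mon (\<lambda>_. 1) \<gamma>) \<in> J"
    using hol w by (intro I.J_mul_left I.J_mul_right) (auto simp: Oalg_simps intro!: Ocar_mon)
  have sort: "sort ?\<alpha>' = sort \<alpha>" unfolding \<alpha> by (rule properties_for_sort) (auto simp: ac_simps)
  have IH: "(\<lambda>z \<gamma>. mon ?g ?\<alpha>' z \<gamma> + mon (\<lambda>z. - (?g z / z ^ invs ?\<alpha>')) (sort \<alpha>) z \<gamma>) \<in> J"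
    unfolding sort[symmetric] using Suc(2) inv w hol by (intro Suc(1)) auto
  have "ta_mul A (ta_mul A (mon (\<lambda>z. - ?g z) \<beta>) ?gen) (mon (\<lambda>_. 1) \<gamma>)
      = (\<lambda>z \<delta>. mon (\<lambda>z. - ?g z) ?\<alpha>' z \<delta> + mon g \<alpha> z \<delta>)"
  proof
    fix z :: complex
    show "ta_mul A (ta_mul A (mon (\<lambda>z. - ?g z) \<beta>) ?gen) (mon (\<lambda>_. 1) \<gamma>) z
      = (\<lambda>\<delta>. mon (\<lambda>z. - ?g z) ?\<alpha>' z \<delta> + mon g \<alpha> z \<delta>)"
    proof (cases "z = 0")
      case True
      then show ?thesis by (simp add: Oalg_simps mon_def cmul_def)
    next
      case False
      have e: "- (g z / z) * 1 * 1 = - (g z / z)" "- (g z / z) * - z * 1 = g z" using False by auto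
      have m: "mon h \<delta> z = (\<lambda>\<gamma>. if \<gamma> = \<delta> then h z else 0)" for h \<delta>
        using False by (simp add: mon_def)
      show ?thesis
        unfolding Oalg_simps m \<alpha> cmul_add_left cmul_add_right cmul_single append_assoc e by (rule refl)
    qed
  qed
  then have "(\<lambda>z \<gamma>. mon g \<alpha> z \<gamma> + mon (\<lambda>z. - (g z / z ^ invs \<alpha>)) (sort \<alpha>) z \<gamma>)
     = ta_add A (ta_mul A (ta_mul A (mon (\<lambda>z. - ?g z) \<beta>) ?gen) (mon (\<lambda>_. 1) \<gamma>))
        (\<lambda>z \<gamma>. mon ?g ?\<alpha>' z \<gamma> + mon (\<lambda>z. - (?g z / z ^ invs ?\<alpha>')) (sort \<alpha>) z \<gamma>)"
    unfolding inv by (auto simp: Oalg_simps mon_def fun_eq_iff)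
  then show ?case using I.J_add[OF gJ IH] by simp
qed

abbreviation "\<psi> \<equiv> induced \<pi>"

lemma \<pi>_add_J: "x \<in> ta_carrier A \<Longrightarrow> j \<in> J \<Longrightarrow> \<pi> (ta_add A x j) = \<pi> x"
  using A.hom_add_ker[OF open_hom_\<pi> zero_laws_B] J_subset_ker by blast

lemma \<psi>_coset: "x \<in> Ocar n P \<Longrightarrow> \<psi> (coset A J x) = \<pi> x"
  using I.induced_coset[of \<pi>, OF \<pi>_add_J] by (simp add: Oalg_simps)

lemma open_hom_\<psi>: "open_hom Q B \<psi>"
  unfolding Odef_eq using open_hom_\<pi> \<pi>_add_J by (rule I.open_hom_induced)

sublocale Q: talg Q unfolding Odef_eq by (rule I.talg_quot)

lemma act_coset:
  assumes h: "h holomorphic_on (- {0})" and f: "f \<in> Ocar n P"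
  shows "ta_act Q h (coset A J f) = coset A J (ta_act A h f)"
  unfolding Odef_eq
proof (rule I.quot_act)
  show "ta_act A h j \<in> J" if "j \<in> J" for j
  proof -
    have "mon h [] \<in> ta_carrier A" using Ocar_mon[OF h] by (simp add: Oalg_simps)
    then show ?thesis using act_eq_mul[of j h] I.J_mul_left that I.J_carrier[OF that] by (simp add: Oalg_simps)
  qed
qed (use f Ocar_act[OF h] in \<open>auto simp: Oalg_simps algebra_simps\<close>)

text \<open>A product of \<open>f\<close> with a function \<open>h\<close> vanishing at
  \<open>q\<close> evaluates to 0 there, so the kernel of \<open>\<psi>\<close> is one of the sets
  intersected in \<open>fiber_ideal\<close>; being closed, it also contains the closure.\<close>

lemma fiber_ideal_subset: "fiber_ideal Q q \<subseteq> hom_ker Q B \<psi>"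
  unfolding fiber_ideal_def
proof (rule closure_of_minimal)
  let ?Z = "hom_ker Q B \<psi>"
  have id: "is_ideal Q ?Z" by (rule Q.is_ideal_hom_ker[OF open_hom_\<psi> zero_laws_B])
  have "ta_act Q h X \<in> ?Z" if h: "h holomorphic_on (- {0})" "h q = 0" and X: "X \<in> ta_carrier Q" for h X
  proof -
    obtain f where f: "f \<in> Ocar n P" "X = coset A J f"
      using X unfolding Odef_eq I.quot_carrier Oalg_simps by blast
    have "ta_act A h f \<in> Ocar n P" using Ocar_act[OF h(1) f(1)] by (simp add: Oalg_simps)
    moreover have "\<pi> (ta_act A h f) = (\<lambda>k. 0)" using h(2) by (simp add: \<pi>_def Oalg_simps phi_def fun_eq_iff)
    ultimately show ?thesis
      unfolding f(2) act_coset[OF h(1) f(1)] hom_ker_def B_simps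
      by (auto simp: \<psi>_coset Odef_eq I.quot_carrier Oalg_simps(1))
  qed
  then show "\<Inter>{S. S \<subseteq> ta_carrier Q \<and> ta_zero Q \<in> S \<and> (\<forall>x\<in>S. \<forall>y\<in>S. ta_add Q x y \<in> S)
        \<and> (\<forall>h a. h holomorphic_on (- {0}) \<and> h q = 0 \<and> a \<in> ta_carrier Q \<longrightarrow> ta_act Q h a \<in> S)} \<subseteq> ?Z"
    using id unfolding is_ideal_def by (intro Inter_lower CollectI conjI) auto
  have "?Z = {x \<in> topspace (ta_top Q). \<psi> x \<in> {\<lambda>k. 0}}"
    unfolding hom_ker_def Q.topspace_eq by (simp add: B_simps)
  then show "closedin (ta_top Q) ?Z"
    using closedin_continuous_map_preimage[OF _ closedin_zero] open_hom_\<psi> unfolding open_hom_def by auto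
qed

definition trunc :: "nat \<Rightarrow> (complex \<Rightarrow> nat list \<Rightarrow> complex) \<Rightarrow> complex \<Rightarrow> nat list \<Rightarrow> complex" where
  "trunc M f = (\<lambda>z \<alpha>. if length \<alpha> \<le> M then f z \<alpha> else 0)"

text \<open>Modulo the ideal every word becomes a multiple of its sorted rearrangement; collecting the
  coefficients of a sorted word gives a scalar function that vanishes at \<open>q\<close>.\<close>

lemma trunc_in_fiber_ideal:
  assumes f: "f \<in> Ocar n P" and f0: "\<pi> f = (\<lambda>k. 0)"
    and L0: "(\<lambda>z \<alpha>. 0) \<in> L"
    and Ladd: "\<And>x y. x \<in> L \<Longrightarrow> y \<in> L \<Longrightarrow> (\<lambda>z \<alpha>. x z \<alpha> + y z \<alpha>) \<in> L"
    and LJ: "J \<subseteq> L"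
    and Lact: "\<And>h a. h holomorphic_on (- {0}) \<Longrightarrow> h q = 0 \<Longrightarrow> a \<in> Ocar n P \<Longrightarrow> ta_act A h a \<in> L"
  shows "trunc M f \<in> L"
proof -
  define W where "W = {\<alpha> \<in> words n. length \<alpha> \<le> M}"
  have "W = (\<Union>d\<le>M. wdeg n d)" by (auto simp: W_def wdeg_def)
  then have finW: "finite W" by simp
  have sumL: "(\<lambda>z \<gamma>. \<Sum>\<alpha>\<in>S. X \<alpha> z \<gamma>) \<in> L" if "finite S" "\<And>\<alpha>. \<alpha> \<in> S \<Longrightarrow> X \<alpha> \<in> L"
    for S :: "nat list set" and X
    using that by (induction S) (auto simp: L0 intro: Ladd)
  define c where "c = (\<lambda>\<alpha> z. f z \<alpha>)"
  have hol: "c \<alpha> holomorphic_on (- {0})" for \<alpha> unfolding c_def by (rule coeff_holomorphic[OF f])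
  define H where "H = (\<lambda>\<beta> z. \<Sum>\<alpha>\<in>{\<alpha> \<in> W. sort \<alpha> = \<beta>}. c \<alpha> z / z ^ invs \<alpha>)"
  have Hhol: "H \<beta> holomorphic_on (- {0})" for \<beta>
    unfolding H_def by (intro holomorphic_intros hol) auto
  have Hq: "H \<beta> q = 0" if "\<beta> \<in> sort ` W" for \<beta>
  proof -
    have b: "sorted \<beta>" "\<beta> \<in> words n" "length \<beta> \<le> M" using that by (auto simp: W_def)
    \<comment> \<open>Rearrangement preserves length, so a truncation contains either all words of a
      content or none, and \<open>H \<beta> q\<close> is a complete coefficient of
      \<open>\<pi> f\<close>.\<close>
    have "{\<alpha> \<in> W. sort \<alpha> = \<beta>} = wcls n (count_list \<beta>)"
    proof (intro set_eqI iffI)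
      fix \<alpha> assume "\<alpha> \<in> wcls n (count_list \<beta>)"
      then have a: "\<alpha> \<in> words n" "count_list \<alpha> = count_list \<beta>" by (auto simp: wcls_def)
      then have "sort \<alpha> = \<beta>" using sort_eq_iff_count_list[OF b(1)] by blast
      moreover from this have "length \<alpha> = length \<beta>" by (metis length_sort)
      ultimately show "\<alpha> \<in> {\<alpha> \<in> W. sort \<alpha> = \<beta>}" using a b by (simp add: W_def)
    next
      fix \<alpha> assume "\<alpha> \<in> {\<alpha> \<in> W. sort \<alpha> = \<beta>}"
      then show "\<alpha> \<in> wcls n (count_list \<beta>)"
        using sort_eq_iff_count_list[OF b(1), of \<alpha>] by (simp add: W_def wcls_def)
    qed
    then have "H \<beta> q = \<pi> f (count_list \<beta>)" unfolding H_def \<pi>_def phi_def c_def by simp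
    then show ?thesis using f0 by simp
  qed
  let ?D = "\<lambda>\<alpha> z \<gamma>. mon (c \<alpha>) \<alpha> z \<gamma> + mon (\<lambda>z. - (c \<alpha> z / z ^ invs \<alpha>)) (sort \<alpha>) z \<gamma>"
  have 1: "(\<lambda>z \<gamma>. \<Sum>\<alpha>\<in>W. ?D \<alpha> z \<gamma>) \<in> L"
    using LJ mon_sort_J[OF hol] by (intro sumL finW) (auto simp: W_def)
  have "mon (H \<beta>) \<beta> \<in> L" if "\<beta> \<in> sort ` W" for \<beta>
  proof -
    have "mon (\<lambda>_. 1) \<beta> \<in> Ocar n P" using that by (intro Ocar_mon) (auto simp: W_def)
    moreover have "ta_act A (H \<beta>) (mon (\<lambda>_. 1) \<beta>) = mon (H \<beta>) \<beta>"
      by (auto simp: Oalg_simps mon_def fun_eq_iff)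
    ultimately show ?thesis using Lact[OF Hhol Hq[OF that]] by metis
  qed
  then have 2: "(\<lambda>z \<gamma>. \<Sum>\<beta>\<in>sort ` W. mon (H \<beta>) \<beta> z \<gamma>) \<in> L"
    by (intro sumL) (auto simp: finW)
  \<comment> \<open>The sorted terms subtracted in \<open>?D\<close> are those collected in
    \<open>H\<close>; they cancel, and the truncated series remains.\<close>
  have "trunc M f z \<gamma> = (\<Sum>\<alpha>\<in>W. ?D \<alpha> z \<gamma>) + (\<Sum>\<beta>\<in>sort ` W. mon (H \<beta>) \<beta> z \<gamma>)" for z \<gamma>
  proof (cases "z = 0")
    case True
    then show ?thesis using Ocar_0[OF f] by (simp add: trunc_def mon_def)
  next
    case z: False
    have "(\<Sum>\<beta>\<in>sort ` W. mon (H \<beta>) \<beta> z \<gamma>)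
        = (\<Sum>\<beta>\<in>sort ` W. \<Sum>\<alpha>\<in>{\<alpha> \<in> W. sort \<alpha> = \<beta>}. mon (\<lambda>z. c \<alpha> z / z ^ invs \<alpha>) (sort \<alpha>) z \<gamma>)"
      by (intro sum.cong refl) (auto simp: mon_def H_def intro!: sum.neutral)
    also have "\<dots> = (\<Sum>\<alpha>\<in>W. mon (\<lambda>z. c \<alpha> z / z ^ invs \<alpha>) (sort \<alpha>) z \<gamma>)"
      by (rule sum.group) (auto simp: finW)
    finally have "(\<Sum>\<alpha>\<in>W. ?D \<alpha> z \<gamma>) + (\<Sum>\<beta>\<in>sort ` W. mon (H \<beta>) \<beta> z \<gamma>)
        = (\<Sum>\<alpha>\<in>W. ?D \<alpha> z \<gamma> + mon (\<lambda>z. c \<alpha> z / z ^ invs \<alpha>) (sort \<alpha>) z \<gamma>)"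
      by (simp only: sum.distrib)
    also have "\<dots> = (\<Sum>\<alpha>\<in>W. if \<gamma> = \<alpha> then c \<alpha> z else 0)"
      using z by (intro sum.cong refl) (auto simp: mon_def)
    also have "\<dots> = (if \<gamma> \<in> W then f z \<gamma> else 0)" using finW by (simp add: c_def)
    also have "\<dots> = trunc M f z \<gamma>"
      using Fcar_off[OF Ocar_Fcar'[OF f]] by (auto simp: W_def trunc_def)
    finally show ?thesis by simp
  qed
  then have "trunc M f = (\<lambda>z \<gamma>. (\<Sum>\<alpha>\<in>W. ?D \<alpha> z \<gamma>) + (\<Sum>\<beta>\<in>sort ` W. mon (H \<beta>) \<beta> z \<gamma>))"
    by (simp add: fun_eq_iff)
  then show ?thesis using Ladd[OF 1 2] by simp
qed

text \<open>A neighbourhood imposes finitely many conditions, each satisfied by all sufficiently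
  long truncations; the sum of the thresholds serves them all.\<close>

lemma trunc_dense:
  assumes f: "f \<in> Ocar n P" and U: "openin (ta_top A) U" and fU: "f \<in> U"
    and tr: "\<And>M. trunc M f \<in> Ocar n P"
  obtains M where "trunc M f \<in> U"
proof -
  from bspec[OF conjunct2[OF U[unfolded Oalg_simps openin_semi_top]] fU]
  obtain D0 and \<epsilon> :: real where D0: "finite D0" "D0 \<subseteq> Odist P" "\<epsilon> > 0"
    "{y \<in> Ocar n P. \<forall>d\<in>D0. d y f < ennreal \<epsilon>} \<subseteq> U"
    by (elim exE conjE) (rule that)
  have "\<exists>M. \<forall>M'\<ge>M. d (trunc M' f) f < ennreal \<epsilon>" if d: "d \<in> D0" for d
  proof -
    obtain K p where K: "d = (\<lambda>f g. SUP z\<in>K. p (\<lambda>\<alpha>. f z \<alpha> - g z \<alpha>))" "compact K" "K \<subseteq> - {0}" "p \<in> P"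
      using subsetD[OF D0(2) d] unfolding Odist_def by (elim CollectE exE conjE) (rule that)
    obtain M where M: "\<And>M'. M' \<ge> M \<Longrightarrow> (SUP z\<in>K. p (tail M' (f z))) < ennreal \<epsilon>"
      using tail_uniformly_small[OF f K(4,2,3) D0(3)] by blast
    have "p (\<lambda>\<alpha>. trunc M' f z \<alpha> - f z \<alpha>) = p (tail M' (f z))" for M' z
    proof -
      have "(\<lambda>\<alpha>. trunc M' f z \<alpha> - f z \<alpha>) = (\<lambda>\<alpha>. (-1) * tail M' (f z) \<alpha>)"
        by (auto simp: trunc_def tail_def fun_eq_iff)
      then show ?thesis using p_scale[OF K(4), of "-1" "tail M' (f z)"] by simp
    qed
    then show ?thesis unfolding K(1) using M by auto
  qed
  then obtain M where M: "\<And>d M'. d \<in> D0 \<Longrightarrow> M' \<ge> M d \<Longrightarrow> d (trunc M' f) f < ennreal \<epsilon>" by metis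
  have "d (trunc (\<Sum>d\<in>D0. M d) f) f < ennreal \<epsilon>" if "d \<in> D0" for d
    using M[OF that member_le_sum[OF that, of M]] D0(1) by simp
  then have "trunc (\<Sum>d\<in>D0. M d) f \<in> U" using D0(4) tr by blast
  then show thesis by (rule that)
qed

text \<open>An open set of the quotient around the class of \<open>f\<close> has an open union
  containing \<open>f\<close>, hence containing a truncation of \<open>f\<close>. The class of a
  truncation lies in every set of the family that defines the fiber ideal, so the class of
  \<open>f\<close> lies in the closure.\<close>

lemma ker_subset_fiber_ideal: "hom_ker Q B \<psi> \<subseteq> fiber_ideal Q q"
proof
  fix X assume X: "X \<in> hom_ker Q B \<psi>"
  then obtain f where f: "f \<in> Ocar n P" "X = coset A J f"
    unfolding hom_ker_def Odef_eq I.quot_carrier Oalg_simps by blast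
  have f0: "\<pi> f = (\<lambda>k. 0)" using X \<psi>_coset[OF f(1)] f(2) unfolding hom_ker_def B_simps by simp
  have tr: "trunc M f \<in> Ocar n P" for M
  \<comment> \<open>Taken with \<open>Ocar\<close> for \<open>L\<close>, the decomposition into
    sorted words shows that truncations belong to the algebra in the first place.\<close>
  proof (rule trunc_in_fiber_ideal[OF f(1) f0 Ocar_zero Ocar_add])
    show "J \<subseteq> Ocar n P" using I.J_carrier unfolding Oalg_simps(1) by blast
    show "ta_act A h a \<in> Ocar n P" if "h holomorphic_on (- {0})" "a \<in> Ocar n P" for h a
      using Ocar_act[OF that] by (simp add: Oalg_simps)
  qed
  let ?Fam = "{S. S \<subseteq> ta_carrier Q \<and> ta_zero Q \<in> S \<and> (\<forall>x\<in>S. \<forall>y\<in>S. ta_add Q x y \<in> S)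
        \<and> (\<forall>h a. h holomorphic_on (- {0}) \<and> h q = 0 \<and> a \<in> ta_carrier Q \<longrightarrow> ta_act Q h a \<in> S)}"
  have trS: "coset A J (trunc M f) \<in> S" if S: "S \<in> ?Fam" for M S
  proof -
    let ?L = "{x \<in> Ocar n P. coset A J x \<in> S}"
    have "trunc M f \<in> ?L"
    proof (rule trunc_in_fiber_ideal[OF f(1) f0])
      have z: "coset A J (ta_zero A) \<in> S" using S unfolding Odef_eq I.quot_zero by blast
      then show "(\<lambda>z \<alpha>. 0) \<in> ?L" using Ocar_zero by (simp add: Oalg_simps)
      show "J \<subseteq> ?L" using I.coset_J z I.J_carrier by (auto simp: Oalg_simps(1))
      show "(\<lambda>z \<alpha>. x z \<alpha> + y z \<alpha>) \<in> ?L" if "x \<in> ?L" "y \<in> ?L" for x y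
      proof -
        have "ta_add Q (coset A J x) (coset A J y) = coset A J (ta_add A x y)"
          unfolding Odef_eq using that by (intro I.quot_add) (auto simp: Oalg_simps)
        moreover have "ta_add Q (coset A J x) (coset A J y) \<in> S" using S that by blast
        ultimately show ?thesis using that Ocar_add by (auto simp: Oalg_simps)
      qed
      show "ta_act A h a \<in> ?L" if "h holomorphic_on (- {0})" "h q = 0" "a \<in> Ocar n P" for h a
      proof -
        have "coset A J a \<in> ta_carrier Q" using that unfolding Odef_eq I.quot_carrier by (simp add: Oalg_simps)
        then have "ta_act Q h (coset A J a) \<in> S" using S that by blast
        then show ?thesis using act_coset[OF that(1,3)] Ocar_act[OF that(1,3)] by (simp add: Oalg_simps)
      qed
    qed
    then show ?thesis by blast
  qed
  show "X \<in> fiber_ideal Q q"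
    unfolding fiber_ideal_def in_closure_of
  proof (intro conjI allI impI)
    show "X \<in> topspace (ta_top Q)" using X unfolding Q.topspace_eq hom_ker_def by blast
    fix T assume T: "X \<in> T \<and> openin (ta_top Q) T"
    have UT: "openin (ta_top A) (\<Union>T)" "T \<subseteq> coset A J ` ta_carrier A"
      using T unfolding Odef_eq I.openin_quot by blast+
    have "f \<in> \<Union>T" using T f(2) I.coset_self[of f] f(1) by (auto simp: Oalg_simps)
    then obtain M where "trunc M f \<in> \<Union>T" using trunc_dense[OF f(1) UT(1) _ tr] by blast
    then obtain Y where Y: "Y \<in> T" "trunc M f \<in> Y" by blast
    then obtain g where g: "g \<in> ta_carrier A" "Y = coset A J g" using UT by blast
    have "coset A J (trunc M f) = Y" using I.coset_absorb[OF g(1)] Y(2) g(2) by simp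
    then show "\<exists>y. y \<in> \<Inter>?Fam \<and> y \<in> T" using trS[of _ M] Y(1) by auto
  qed
qed

text \<open>\<open>\<pi>\<close> is factored twice, through \<open>J\<close> and then through the
  fiber ideal, so the isomorphism is \<open>induced (induced \<pi>)\<close>.\<close>

lemma fiber_iso:
  "\<exists>\<Phi>. talg_iso (fiber Q q) B \<Phi> \<and> (\<forall>i<n. \<Phi> (zeta_cls n P q i) = xq i)"
proof (intro exI conjI allI impI)
  have eq: "fiber_ideal Q q = hom_ker Q B \<psi>"
    using fiber_ideal_subset ker_subset_fiber_ideal by blast
  show "talg_iso (fiber Q q) B (induced \<psi>)"
    unfolding fiber_def eq by (rule Q.quot_hom_ker_iso[OF open_hom_\<psi> zero_laws_B topspace_B])
  fix i assume i: "i < n"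
  interpret K: talg_ideal Q "hom_ker Q B \<psi>"
    by unfold_locales (rule Q.is_ideal_hom_ker[OF open_hom_\<psi> zero_laws_B])
  have z: "zeta i = mon (\<lambda>_. 1) [i]" by (simp add: zeta_def mon_def)
  have zO: "zeta i \<in> Ocar n P" unfolding z using i by (intro Ocar_mon) auto
  have "induced \<psi> (zeta_cls n P q i) = \<psi> (coset A J (zeta i))"
    unfolding zeta_cls_def eq
    using zO by (intro K.induced_coset Q.hom_add_ker[OF open_hom_\<psi> zero_laws_B])
      (auto simp: Odef_eq I.quot_carrier Oalg_simps(1))
  also have "\<dots> = \<pi> (zeta i)" by (rule \<psi>_coset[OF zO])
  also have "\<dots> = xq i"
    unfolding z \<pi>_def mon_def using q_nz i phi_single[of "[i]" n q 1]
    by (simp add: fun_eq_iff[of "phi n q _"] count_list_singleton xq_def munit_def del: count_list.simps)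
  finally show "induced \<psi> (zeta_cls n P q i) = xq i" .
qed

end

section \<open>Polydisc and ball\<close>

lemma sum_wdeg_split:
  assumes "i \<le> m"
  shows "(\<Sum>\<gamma>\<in>wdeg n m. F (take i \<gamma>) (drop i \<gamma>)) = (\<Sum>\<alpha>\<in>wdeg n i. \<Sum>\<beta>\<in>wdeg n (m - i). F \<alpha> \<beta>)"
proof -
  have "(\<Sum>\<gamma>\<in>wdeg n m. F (take i \<gamma>) (drop i \<gamma>)) = (\<Sum>(\<alpha>, \<beta>)\<in>wdeg n i \<times> wdeg n (m - i). F \<alpha> \<beta>)"
    by (rule sum.reindex_bij_witness[where i = "\<lambda>(\<alpha>, \<beta>). \<alpha> @ \<beta>" and j = "\<lambda>\<gamma>. (take i \<gamma>, drop i \<gamma>)"])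
      (use assms in \<open>auto simp: wdeg_def take_drop_in_words[symmetric] intro: take_drop_in_words[THEN iffD1, THEN conjunct1]
        take_drop_in_words[THEN iffD1, THEN conjunct2]\<close>)
  then show ?thesis by (simp add: sum.cartesian_product)
qed

section \<open>The polydisc: weighted l1 norms\<close>

definition nl1 :: "nat \<Rightarrow> real \<Rightarrow> real \<Rightarrow> nat \<Rightarrow> (nat list \<Rightarrow> complex) \<Rightarrow> real" where
  "nl1 n \<rho> \<tau> d c = (\<Sum>\<alpha>\<in>wdeg n d. norm (c \<alpha>) * \<rho> ^ length \<alpha> * \<tau> ^ sp1 \<alpha>)"

text \<open>The weight of a word is submultiplicative under concatenation by
  \<open>sp1_append\<close>; after exchanging the sums over words and cuts, each cut position gives
  a product of two norms.\<close>

lemma nl1_cmul: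
  assumes "\<rho> > 0" "\<tau> \<ge> 1"
  shows "nl1 n \<rho> \<tau> m (cmul c c') \<le> (\<Sum>i\<le>m. nl1 n \<rho> \<tau> i c * nl1 n \<rho> \<tau> (m - i) c')"
proof -
  let ?W = "\<lambda>\<alpha>. \<rho> ^ length \<alpha> * \<tau> ^ sp1 \<alpha>"
  let ?F = "\<lambda>\<alpha> \<beta>. (norm (c \<alpha>) * ?W \<alpha>) * (norm (c' \<beta>) * ?W \<beta>)"
  have W: "?W (\<alpha> @ \<beta>) \<le> ?W \<alpha> * ?W \<beta>" for \<alpha> \<beta>
  proof -
    have "\<tau> ^ sp1 (\<alpha> @ \<beta>) \<le> \<tau> ^ (sp1 \<alpha> + sp1 \<beta>)"
      using assms by (intro power_increasing sp1_append)
    then have "\<rho> ^ (length \<alpha> + length \<beta>) * \<tau> ^ sp1 (\<alpha> @ \<beta>) \<le> \<rho> ^ (length \<alpha> + length \<beta>) * \<tau> ^ (sp1 \<alpha> + sp1 \<beta>)"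
      using assms by (intro mult_left_mono) auto
    then show ?thesis by (simp add: power_add algebra_simps)
  qed
  have "norm (cmul c c' \<gamma>) * ?W \<gamma> \<le> (\<Sum>i\<le>m. ?F (take i \<gamma>) (drop i \<gamma>))" if \<gamma>: "\<gamma> \<in> wdeg n m" for \<gamma>
  proof -
    have W0: "?W \<gamma> \<ge> 0" using assms by simp
    have "norm (cmul c c' \<gamma>) \<le> (\<Sum>i\<le>m. norm (c (take i \<gamma>)) * norm (c' (drop i \<gamma>)))"
      unfolding cmul_def using \<gamma> norm_sum[of "\<lambda>i. c (take i \<gamma>) * c' (drop i \<gamma>)" "{..length \<gamma>}"]
      by (simp add: wdeg_def norm_mult)
    then have "norm (cmul c c' \<gamma>) * ?W \<gamma> \<le> (\<Sum>i\<le>m. norm (c (take i \<gamma>)) * norm (c' (drop i \<gamma>))) * ?W \<gamma>"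
      using W0 by (rule mult_right_mono)
    also have "\<dots> = (\<Sum>i\<le>m. norm (c (take i \<gamma>)) * norm (c' (drop i \<gamma>)) * ?W (take i \<gamma> @ drop i \<gamma>))"
      by (simp only: sum_distrib_right append_take_drop_id)
    also have "\<dots> \<le> (\<Sum>i\<le>m. norm (c (take i \<gamma>)) * norm (c' (drop i \<gamma>)) * (?W (take i \<gamma>) * ?W (drop i \<gamma>)))"
      by (intro sum_mono mult_left_mono W) auto
    also have "\<dots> = (\<Sum>i\<le>m. ?F (take i \<gamma>) (drop i \<gamma>))" by (simp only: mult_ac)
    finally show ?thesis .
  qed
  then have "nl1 n \<rho> \<tau> m (cmul c c') \<le> (\<Sum>\<gamma>\<in>wdeg n m. \<Sum>i\<le>m. ?F (take i \<gamma>) (drop i \<gamma>))"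
    unfolding nl1_def mult.assoc[of "norm _"] by (rule sum_mono)
  also have "\<dots> = (\<Sum>i\<le>m. \<Sum>\<gamma>\<in>wdeg n m. ?F (take i \<gamma>) (drop i \<gamma>))" by (rule sum.swap)
  also have "\<dots> = (\<Sum>i\<le>m. \<Sum>\<alpha>\<in>wdeg n i. \<Sum>\<beta>\<in>wdeg n (m - i). ?F \<alpha> \<beta>)"
    by (intro sum.cong refl sum_wdeg_split) simp
  also have "\<dots> = (\<Sum>i\<le>m. nl1 n \<rho> \<tau> i c * nl1 n \<rho> \<tau> (m - i) c')"
    unfolding nl1_def sum_product mult.assoc[of "norm _"] ..
  finally show ?thesis .
qed

lemma graded_norms_nl1:
  assumes T: "\<And>\<rho> \<tau>. (\<rho>, \<tau>) \<in> T \<Longrightarrow> \<rho> > 0 \<and> \<tau> \<ge> 1" "T \<noteq> {}"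
  shows "graded_norms n ((\<lambda>(\<rho>, \<tau>). nl1 n \<rho> \<tau>) ` T)"
proof
  fix N assume "N \<in> (\<lambda>(\<rho>, \<tau>). nl1 n \<rho> \<tau>) ` T"
  then obtain \<rho> \<tau> where N: "N = nl1 n \<rho> \<tau>" and \<rho>: "\<rho> > 0" "\<tau> \<ge> 1" using T(1) by auto
  show "N d c \<le> N d c'" if "\<And>\<alpha>. \<alpha> \<in> wdeg n d \<Longrightarrow> norm (c \<alpha>) \<le> norm (c' \<alpha>)" for d c c'
    unfolding N nl1_def using \<rho> that by (intro sum_mono mult_right_mono) auto
  show "N d (\<lambda>\<alpha>. c \<alpha> + c' \<alpha>) \<le> N d c + N d c'" for d c c'
    unfolding N nl1_def sum.distrib[symmetric] distrib_right[symmetric] using \<rho>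
    by (intro sum_mono mult_right_mono norm_triangle_ineq) auto
  show "N d (\<lambda>\<alpha>. a * c \<alpha>) = norm a * N d c" for d a c
    unfolding N nl1_def by (simp add: norm_mult sum_distrib_left mult.assoc)
  show "N m (cmul c c') \<le> (\<Sum>i\<le>m. N i c * N (m - i) c')" for m c c'
    unfolding N by (rule nl1_cmul[OF \<rho>])
  fix \<alpha> assume \<alpha>: "\<alpha> \<in> words n"
  have W: "\<rho> ^ length \<alpha> * \<tau> ^ sp1 \<alpha> > 0" using \<rho> by simp
  have "norm (c \<alpha>) * \<rho> ^ length \<alpha> * \<tau> ^ sp1 \<alpha> \<le> N (length \<alpha>) c" for c
    unfolding N nl1_def using \<alpha> \<rho> by (intro member_le_sum finite_wdeg) (auto simp: wdeg_def)
  then have "norm (c \<alpha>) \<le> 1 / (\<rho> ^ length \<alpha> * \<tau> ^ sp1 \<alpha>) * N (length \<alpha>) c" for c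
    using W by (simp add: field_simps)
  then show "\<exists>C>0. \<forall>c. norm (c \<alpha>) \<le> C * N (length \<alpha>) c"
    using W by (intro exI[of _ "1 / (\<rho> ^ length \<alpha> * \<tau> ^ sp1 \<alpha>)"]) auto
qed (use T(2) in auto)

text \<open>Among the words of one content this one minimises |q|^inv, with minimum
  \<open>wq\<close>: inversions range from 0 (increasing) to \<open>cross\<close> (decreasing), and
  the size of |q| decides which end is cheaper.\<close>

definition extremal :: "complex \<Rightarrow> nat list \<Rightarrow> bool" where
  "extremal q \<alpha> \<longleftrightarrow> (if norm q \<ge> 1 then sorted \<alpha> else sorted (rev \<alpha>))"

text \<open>The factor \<open>q ^ invs \<alpha>\<close> undoes the division in \<open>phi\<close>,
  and its modulus is the weight \<open>wq\<close>.\<close>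

definition sect1 :: "nat \<Rightarrow> complex \<Rightarrow> ((nat \<Rightarrow> nat) \<Rightarrow> complex) \<Rightarrow> nat list \<Rightarrow> complex" where
  "sect1 n q b \<alpha> = (if \<alpha> \<in> words n \<and> extremal q \<alpha> then b (count_list \<alpha>) * q ^ invs \<alpha> else 0)"

lemma wq_extremal:
  assumes "\<alpha> \<in> wcls n k" "extremal q \<alpha>"
  shows "norm q ^ invs \<alpha> = wq q n k"
  using assms invs_rev[of \<alpha> n] invs_sorted[of \<alpha>] invs_sorted[of "rev \<alpha>"]
  unfolding extremal_def wq_def wcls_def by (auto split: if_splits)

lemma wq_le:
  assumes "\<alpha> \<in> wcls n k"
  shows "wq q n k \<le> norm q ^ invs \<alpha>"
proof (cases "norm q \<ge> 1")
  case True
  then show ?thesis by (simp add: wq_def)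
next
  case False
  have "invs \<alpha> \<le> cross n k" using assms invs_rev[of \<alpha> n] by (auto simp: wcls_def)
  then show ?thesis using False by (simp add: wq_def power_decreasing)
qed

lemma wq_pos: "q \<noteq> 0 \<Longrightarrow> wq q n k > 0"
  by (simp add: wq_def)

lemma extremal_unique:
  assumes "k \<in> midx n"
  obtains \<alpha> where "{\<alpha> \<in> wcls n k. extremal q \<alpha>} = {\<alpha>}"
proof -
  obtain \<beta> where \<beta>: "\<beta> \<in> words n" "sorted \<beta>" "count_list \<beta> = k" using midx_count_list[OF assms] .
  have r: "count_list (rev \<alpha>) = count_list \<alpha>" for \<alpha> :: "nat list" by (simp add: fun_eq_iff)
  have u: "\<alpha> = \<beta>" if "sorted \<alpha>" "count_list \<alpha> = k" for \<alpha>
    using sort_eq_iff_count_list[OF \<beta>(2), of \<alpha>] that \<beta>(3) by (simp add: sorted_sort_id)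
  show thesis
  proof (cases "norm q \<ge> 1")
    case True
    have "{\<alpha> \<in> wcls n k. extremal q \<alpha>} = {\<beta>}"
    proof (intro set_eqI iffI)
      fix \<alpha> assume "\<alpha> \<in> {\<alpha> \<in> wcls n k. extremal q \<alpha>}"
      then have "sorted \<alpha>" "count_list \<alpha> = k" using True by (auto simp: extremal_def wcls_def)
      then show "\<alpha> \<in> {\<beta>}" using u by simp
    qed (use True \<beta> in \<open>auto simp: extremal_def wcls_def\<close>)
    then show thesis by (rule that)
  next
    case False
    have "{\<alpha> \<in> wcls n k. extremal q \<alpha>} = {rev \<beta>}"
    proof (intro set_eqI iffI)
      fix \<alpha> assume "\<alpha> \<in> {\<alpha> \<in> wcls n k. extremal q \<alpha>}"
      then have "sorted (rev \<alpha>)" "count_list (rev \<alpha>) = k"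
        using False r[of \<alpha>] by (auto simp: extremal_def wcls_def)
      then have "rev \<alpha> = \<beta>" by (rule u)
      then show "\<alpha> \<in> {rev \<beta>}" by auto
    qed (use False \<beta> r in \<open>auto simp: extremal_def wcls_def\<close>)
    then show thesis by (rule that)
  qed
qed

lemma sum_extremal:
  assumes "k \<in> midx n" "\<And>\<alpha>. \<alpha> \<in> wcls n k \<Longrightarrow> extremal q \<alpha> \<Longrightarrow> F \<alpha> = a"
  shows "(\<Sum>\<alpha>\<in>wcls n k. if extremal q \<alpha> then F \<alpha> else 0) = a"
proof -
  obtain \<alpha> where \<alpha>: "{\<alpha> \<in> wcls n k. extremal q \<alpha>} = {\<alpha>}" using extremal_unique[OF assms(1)] .
  have "(\<Sum>\<alpha>\<in>wcls n k. if extremal q \<alpha> then F \<alpha> else 0) = sum F {\<alpha> \<in> wcls n k. extremal q \<alpha>}"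
    by (simp add: sum.inter_filter)
  also have "\<dots> = a" using assms(2) \<alpha> by auto
  finally show ?thesis .
qed

lemma extremal_sp1: "\<alpha> \<in> words n \<Longrightarrow> extremal q \<alpha> \<Longrightarrow> sp1 \<alpha> \<le> n"
  using sp1_sorted_le[of \<alpha> n] sp1_sorted_le[of "rev \<alpha>" n] sp1_rev[of \<alpha>]
  by (auto simp: extremal_def split: if_splits)

text \<open>Both polydisc algebras are instances: \<open>T\<close> may contain every
  \<open>\<tau> \<ge> 1\<close> or just \<open>\<tau> = 1\<close>. The norm with
  \<open>\<tau> = 1\<close> already bounds \<open>phi\<close> with constant 1, because
  \<open>wq\<close> is at most |q|^inv.\<close>

lemma fiber_setup_nl1:
  assumes r: "0 < r" and q: "q \<noteq> 0"
    and T: "\<And>\<rho> \<tau>. (\<rho>, \<tau>) \<in> T \<Longrightarrow> 0 < \<rho> \<and> ereal \<rho> < r \<and> \<tau> \<ge> 1"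
    and T': "\<And>\<rho>. 0 < \<rho> \<Longrightarrow> ereal \<rho> < r \<Longrightarrow> (\<rho>, 1) \<in> T"
  shows "fiber_setup n ((\<lambda>(\<rho>, \<tau>). nl1 n \<rho> \<tau>) ` T) r q (wq q n) (sect1 n q)"
proof -
  obtain \<rho>0 :: real where "0 < \<rho>0" "ereal \<rho>0 < r" using ereal_dense2[OF r] by (metis ereal_less(2))
  then have "T \<noteq> {}" using T' by blast
  then interpret graded_norms n "(\<lambda>(\<rho>, \<tau>). nl1 n \<rho> \<tau>) ` T"
    using T by (intro graded_norms_nl1) blast+
  show ?thesis
  proof
    show "wq q n k > 0" for k using wq_pos[OF q] .
    fix \<rho> :: real assume \<rho>: "0 < \<rho>" "ereal \<rho> < r"
    have "(\<Sum>k\<in>kdeg n d. norm (phi n q c k) * wq q n k * \<rho> ^ d) \<le> 1 * nl1 n \<rho> 1 d c" for c d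
    proof -
      have "norm (phi n q c k) * wq q n k \<le> (\<Sum>\<alpha>\<in>wcls n k. norm (c \<alpha>))" for k
      proof -
        have "norm (phi n q c k) * wq q n k \<le> (\<Sum>\<alpha>\<in>wcls n k. norm (c \<alpha> / q ^ invs \<alpha>)) * wq q n k"
          unfolding phi_def using wq_pos[OF q, of n k] by (intro mult_right_mono norm_sum) auto
        also have "\<dots> = (\<Sum>\<alpha>\<in>wcls n k. norm (c \<alpha>) * (wq q n k / norm q ^ invs \<alpha>))"
          by (simp add: sum_distrib_right norm_divide norm_power)
        also have "\<dots> \<le> (\<Sum>\<alpha>\<in>wcls n k. norm (c \<alpha>) * 1)"
          using q wq_le[of _ n k q] by (intro sum_mono mult_left_mono) auto
        finally show ?thesis by simp
      qed
      then have "(\<Sum>k\<in>kdeg n d. norm (phi n q c k) * wq q n k * \<rho> ^ d) \<le> (\<Sum>k\<in>kdeg n d. (\<Sum>\<alpha>\<in>wcls n k. norm (c \<alpha>)) * \<rho> ^ d)"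
        using \<rho> by (intro sum_mono mult_right_mono) auto
      also have "\<dots> = (\<Sum>\<alpha>\<in>wdeg n d. norm (c \<alpha>)) * \<rho> ^ d"
        by (simp add: sum_wdeg_group sum_distrib_right)
      also have "\<dots> = nl1 n \<rho> 1 d c"
        unfolding nl1_def sum_distrib_right by (intro sum.cong) (auto simp: wdeg_def)
      finally show ?thesis by simp
    qed
    moreover have "nl1 n \<rho> 1 \<in> (\<lambda>(\<rho>, \<tau>). nl1 n \<rho> \<tau>) ` T" using T'[OF \<rho>] by force
    ultimately show "\<exists>N\<in>(\<lambda>(\<rho>, \<tau>). nl1 n \<rho> \<tau>) ` T. \<exists>C>0. \<forall>c d.
        (\<Sum>k\<in>kdeg n d. norm (phi n q c k) * wq q n k * \<rho> ^ d) \<le> C * N d c"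
      by (intro bexI[of _ "nl1 n \<rho> 1"] exI[of _ 1] conjI allI) auto
  next
    fix b k assume k: "k \<in> midx n"
    have "phi n q (sect1 n q b) k = (\<Sum>\<alpha>\<in>wcls n k. if extremal q \<alpha> then b k else 0)"
      unfolding phi_def sect1_def using q by (intro sum.cong) (auto simp: wcls_def)
    then show "phi n q (sect1 n q b) k = b k" using sum_extremal[OF k, of q "\<lambda>_. b k" "b k"] by simp
  next
    fix N assume "N \<in> (\<lambda>(\<rho>, \<tau>). nl1 n \<rho> \<tau>) ` T"
    then obtain \<rho> \<tau> where N: "N = nl1 n \<rho> \<tau>" and \<rho>: "0 < \<rho>" "ereal \<rho> < r" "\<tau> \<ge> 1" using T by auto
    \<comment> \<open>An extremal word has at most \<open>n\<close> blocks, which bounds its factor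
      \<open>\<tau> ^ sp1 \<alpha>\<close> by \<open>\<tau> ^ n\<close> uniformly in the
      degree.\<close>
    have "N d (sect1 n q b) \<le> \<tau> ^ n * (\<Sum>k\<in>kdeg n d. norm (b k) * wq q n k * \<rho> ^ d)" for b d
    proof -
      have "N d (sect1 n q b) = (\<Sum>k\<in>kdeg n d. \<Sum>\<alpha>\<in>wcls n k. norm (sect1 n q b \<alpha>) * \<rho> ^ length \<alpha> * \<tau> ^ sp1 \<alpha>)"
        unfolding N nl1_def by (rule sum_wdeg_group)
      also have "\<dots> \<le> (\<Sum>k\<in>kdeg n d. \<Sum>\<alpha>\<in>wcls n k. if extremal q \<alpha> then norm (b k) * wq q n k * \<rho> ^ d * \<tau> ^ n else 0)"
      proof (intro sum_mono)
        fix k \<alpha> assume k: "k \<in> kdeg n d" and \<alpha>: "\<alpha> \<in> wcls n k"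
        then have l: "length \<alpha> = d" using mdeg_count_list[of \<alpha> n] by (auto simp: wcls_def kdeg_def)
        show "norm (sect1 n q b \<alpha>) * \<rho> ^ length \<alpha> * \<tau> ^ sp1 \<alpha>
            \<le> (if extremal q \<alpha> then norm (b k) * wq q n k * \<rho> ^ d * \<tau> ^ n else 0)"
        proof (cases "extremal q \<alpha>")
          case True
          then have "norm (sect1 n q b \<alpha>) = norm (b k) * wq q n k"
            using \<alpha> wq_extremal[OF \<alpha> True] by (simp add: sect1_def wcls_def norm_mult norm_power)
          moreover have "\<tau> ^ sp1 \<alpha> \<le> \<tau> ^ n"
            using \<rho> extremal_sp1[of \<alpha> n q] True \<alpha> by (intro power_increasing) (auto simp: wcls_def)
          ultimately show ?thesis using True l \<rho> wq_pos[OF q, of n k] by (auto intro!: mult_left_mono)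
        qed (simp add: sect1_def)
      qed
      also have "\<dots> = (\<Sum>k\<in>kdeg n d. norm (b k) * wq q n k * \<rho> ^ d * \<tau> ^ n)"
        by (intro sum.cong refl sum_extremal) (auto simp: kdeg_def)
      also have "\<dots> = \<tau> ^ n * (\<Sum>k\<in>kdeg n d. norm (b k) * wq q n k * \<rho> ^ d)"
        by (simp add: sum_distrib_left mult.commute)
      finally show ?thesis .
    qed
    then show "\<exists>\<rho> C. 0 < \<rho> \<and> ereal \<rho> < r \<and> 0 < C \<and>
        (\<forall>b d. N d (sect1 n q b) \<le> C * (\<Sum>k\<in>kdeg n d. norm (b k) * wq q n k * \<rho> ^ d))"
      using \<rho> by (intro exI[of _ \<rho>] exI[of _ "\<tau> ^ n"] conjI allI) auto
  qed (use r q in \<open>auto simp: sect1_def\<close>)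
qed

lemma infsum_words_graded:
  fixes f :: "nat list \<Rightarrow> real"
  assumes "\<And>\<alpha>. f \<alpha> \<ge> 0"
  shows "(\<Sum>\<^sub>\<infinity>\<alpha>\<in>words n. ennreal (f \<alpha>)) = (\<Sum>d. ennreal (\<Sum>\<alpha>\<in>wdeg n d. f \<alpha>))"
proof -
  have "(\<Sum>\<^sub>\<infinity>\<alpha>\<in>words n. ennreal (f \<alpha>)) = (\<Sum>d. \<Sum>\<alpha>\<in>wdeg n d. ennreal (f \<alpha>))"
    unfolding wdeg_def by (rule infsum_ennreal_graded) (use finite_wdeg in \<open>simp add: wdeg_def\<close>)
  then show ?thesis using assms by simp
qed

lemma gsum_nl1:
  assumes "\<rho> > 0" "\<tau> \<ge> 1"
  shows "(\<lambda>c. \<Sum>\<^sub>\<infinity>\<alpha>\<in>words n. ennreal (norm (c \<alpha>) * \<rho> ^ length \<alpha> * \<tau> ^ sp1 \<alpha>)) = gsum (nl1 n \<rho> \<tau>)"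
  unfolding gsum_def[abs_def] nl1_def using assms by (intro ext infsum_words_graded) auto

lemma FD_norms_eq:
  "FD_norms n r = gsum ` (\<lambda>(\<rho>, \<tau>). nl1 n \<rho> \<tau>) ` {(\<rho>, \<tau>). 0 < \<rho> \<and> ereal \<rho> < r \<and> 1 \<le> \<tau>}"
proof -
  let ?S = "{(\<rho>, \<tau>). 0 < \<rho> \<and> ereal \<rho> < r \<and> 1 \<le> \<tau>}"
  have "FD_norms n r = (\<lambda>(\<rho>, \<tau>) c. \<Sum>\<^sub>\<infinity>\<alpha>\<in>words n. ennreal (norm (c \<alpha>) * \<rho> ^ length \<alpha> * \<tau> ^ sp1 \<alpha>)) ` ?S"
    unfolding FD_norms_def by auto
  also have "\<dots> = (\<lambda>x. gsum ((\<lambda>(\<rho>, \<tau>). nl1 n \<rho> \<tau>) x)) ` ?S"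
    by (intro image_cong refl) (auto simp: gsum_nl1)
  finally show ?thesis by (simp add: image_image)
qed

lemma FT_norms_eq:
  "FT_norms n r = gsum ` (\<lambda>(\<rho>, \<tau>). nl1 n \<rho> \<tau>) ` {(\<rho>, \<tau>). 0 < \<rho> \<and> ereal \<rho> < r \<and> \<tau> = 1}"
proof -
  let ?S = "{\<rho>. 0 < \<rho> \<and> ereal \<rho> < r}"
  have "FT_norms n r = (\<lambda>\<rho> c. \<Sum>\<^sub>\<infinity>\<alpha>\<in>words n. ennreal (norm (c \<alpha>) * \<rho> ^ length \<alpha>)) ` ?S"
    unfolding FT_norms_def by auto
  also have "\<dots> = (\<lambda>\<rho>. gsum (nl1 n \<rho> 1)) ` ?S"
    by (intro image_cong refl) (use gsum_nl1[where \<tau> = 1] in auto)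
  also have "\<dots> = gsum ` (\<lambda>(\<rho>, \<tau>). nl1 n \<rho> \<tau>) ` (\<lambda>\<rho>. (\<rho>, 1)) ` ?S"
    by (simp add: image_image)
  also have "(\<lambda>\<rho>. (\<rho>, 1)) ` ?S = {(\<rho>, \<tau>). 0 < \<rho> \<and> ereal \<rho> < r \<and> \<tau> = 1}" by auto
  finally show ?thesis .
qed

section \<open>The ball: l2 norms in each degree\<close>

definition nl2 :: "nat \<Rightarrow> real \<Rightarrow> nat \<Rightarrow> (nat list \<Rightarrow> complex) \<Rightarrow> real" where
  "nl2 n \<rho> d c = L2_set (\<lambda>\<alpha>. norm (c \<alpha>)) (wdeg n d) * \<rho> ^ d"

lemma L2_set_sum_le:
  "finite I \<Longrightarrow> L2_set (\<lambda>x. \<Sum>i\<in>I. f i x) S \<le> (\<Sum>i\<in>I. L2_set (f i) S)"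
proof (induction I rule: finite_induct)
  case (insert i I)
  have "L2_set (\<lambda>x. \<Sum>i\<in>insert i I. f i x) S = L2_set (\<lambda>x. f i x + (\<Sum>i\<in>I. f i x)) S"
    using insert by simp
  also have "\<dots> \<le> L2_set (f i) S + L2_set (\<lambda>x. \<Sum>i\<in>I. f i x) S" by (rule L2_set_triangle_ineq)
  finally show ?case using insert by simp
qed (simp add: L2_set_0')

text \<open>For a fixed cut the product is a tensor product, on which the l2 norm is multiplicative;
  Minkowski's inequality sums over the cuts.\<close>

lemma nl2_cmul:
  assumes "\<rho> > 0"
  shows "nl2 n \<rho> m (cmul c c') \<le> (\<Sum>i\<le>m. nl2 n \<rho> i c * nl2 n \<rho> (m - i) c')"
proof -
  let ?L = "\<lambda>c d. L2_set (\<lambda>\<alpha>. norm (c \<alpha> :: complex)) (wdeg n d)"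
  have "?L (cmul c c') m \<le> L2_set (\<lambda>\<gamma>. \<Sum>i\<le>m. norm (c (take i \<gamma>)) * norm (c' (drop i \<gamma>))) (wdeg n m)"
  proof (rule L2_set_mono)
    fix \<gamma> assume "\<gamma> \<in> wdeg n m"
    then show "norm (cmul c c' \<gamma>) \<le> (\<Sum>i\<le>m. norm (c (take i \<gamma>)) * norm (c' (drop i \<gamma>)))"
      unfolding cmul_def using norm_sum[of "\<lambda>i. c (take i \<gamma>) * c' (drop i \<gamma>)" "{..length \<gamma>}"]
      by (simp add: wdeg_def norm_mult)
  qed simp
  also have "\<dots> \<le> (\<Sum>i\<le>m. L2_set (\<lambda>\<gamma>. norm (c (take i \<gamma>)) * norm (c' (drop i \<gamma>))) (wdeg n m))"
    by (rule L2_set_sum_le) simp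
  also have "\<dots> = (\<Sum>i\<le>m. ?L c i * ?L c' (m - i))"
  proof (intro sum.cong refl)
    fix i assume "i \<in> {..m}"
    then have "(\<Sum>\<gamma>\<in>wdeg n m. (norm (c (take i \<gamma>)) * norm (c' (drop i \<gamma>)))\<^sup>2)
        = (\<Sum>\<alpha>\<in>wdeg n i. \<Sum>\<beta>\<in>wdeg n (m - i). (norm (c \<alpha>) * norm (c' \<beta>))\<^sup>2)"
      by (intro sum_wdeg_split) simp
    also have "\<dots> = (\<Sum>\<alpha>\<in>wdeg n i. (norm (c \<alpha>))\<^sup>2) * (\<Sum>\<beta>\<in>wdeg n (m - i). (norm (c' \<beta>))\<^sup>2)"
      by (simp add: sum_product power_mult_distrib)
    finally show "L2_set (\<lambda>\<gamma>. norm (c (take i \<gamma>)) * norm (c' (drop i \<gamma>))) (wdeg n m) = ?L c i * ?L c' (m - i)"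
      by (simp add: L2_set_def real_sqrt_mult)
  qed
  finally have "?L (cmul c c') m * \<rho> ^ m \<le> (\<Sum>i\<le>m. ?L c i * ?L c' (m - i)) * \<rho> ^ m"
    using assms by (intro mult_right_mono) auto
  also have "\<dots> = (\<Sum>i\<le>m. nl2 n \<rho> i c * nl2 n \<rho> (m - i) c')"
    unfolding nl2_def sum_distrib_right
  proof (intro sum.cong refl)
    fix i assume "i \<in> {..m}"
    then have "\<rho> ^ m = \<rho> ^ i * \<rho> ^ (m - i)" by (simp flip: power_add)
    then show "?L c i * ?L c' (m - i) * \<rho> ^ m = ?L c i * \<rho> ^ i * (?L c' (m - i) * \<rho> ^ (m - i))" by simp
  qed
  finally show ?thesis unfolding nl2_def .
qed

lemma graded_norms_nl2:
  assumes T: "\<And>\<rho>. \<rho> \<in> T \<Longrightarrow> \<rho> > 0" "T \<noteq> {}"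
  shows "graded_norms n (nl2 n ` T)"
proof
  fix N assume "N \<in> nl2 n ` T"
  then obtain \<rho> where N: "N = nl2 n \<rho>" and \<rho>: "\<rho> > 0" using T(1) by auto
  show "N d c \<le> N d c'" if "\<And>\<alpha>. \<alpha> \<in> wdeg n d \<Longrightarrow> norm (c \<alpha>) \<le> norm (c' \<alpha>)" for d c c'
    unfolding N nl2_def using \<rho> that by (intro mult_right_mono L2_set_mono) auto
  show "N d (\<lambda>\<alpha>. c \<alpha> + c' \<alpha>) \<le> N d c + N d c'" for d c c'
  proof -
    have "L2_set (\<lambda>\<alpha>. norm (c \<alpha> + c' \<alpha>)) (wdeg n d) \<le> L2_set (\<lambda>\<alpha>. norm (c \<alpha>) + norm (c' \<alpha>)) (wdeg n d)"
      by (intro L2_set_mono norm_triangle_ineq) auto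
    also have "\<dots> \<le> L2_set (\<lambda>\<alpha>. norm (c \<alpha>)) (wdeg n d) + L2_set (\<lambda>\<alpha>. norm (c' \<alpha>)) (wdeg n d)"
      by (rule L2_set_triangle_ineq)
    finally show ?thesis unfolding N nl2_def distrib_right[symmetric] using \<rho> by (intro mult_right_mono) auto
  qed
  show "N d (\<lambda>\<alpha>. a * c \<alpha>) = norm a * N d c" for d a c
    unfolding N nl2_def by (simp add: norm_mult L2_set_right_distrib mult.assoc[symmetric])
  show "N m (cmul c c') \<le> (\<Sum>i\<le>m. N i c * N (m - i) c')" for m c c'
    unfolding N by (rule nl2_cmul[OF \<rho>])
  fix \<alpha> assume \<alpha>: "\<alpha> \<in> words n"
  have "norm (c \<alpha>) \<le> L2_set (\<lambda>\<alpha>. norm (c \<alpha>)) (wdeg n (length \<alpha>))" for c :: "nat list \<Rightarrow> complex"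
    using \<alpha> by (intro member_le_L2_set finite_wdeg) (auto simp: wdeg_def)
  then have "norm (c \<alpha>) \<le> 1 / \<rho> ^ length \<alpha> * N (length \<alpha>) c" for c
    unfolding N nl2_def using \<rho> by (simp add: field_simps)
  then show "\<exists>C>0. \<forall>c. norm (c \<alpha>) \<le> C * N (length \<alpha>) c"
    using \<rho> by (intro exI[of _ "1 / \<rho> ^ length \<alpha>"]) auto
qed (use T(2) in auto)

text \<open>The squared l2 norm of the functional \<open>c \<mapsto> phi n q c k\<close> on the
  words of content \<open>k\<close>.\<close>

definition invmass :: "nat \<Rightarrow> complex \<Rightarrow> (nat \<Rightarrow> nat) \<Rightarrow> real" where
  "invmass n q k = (\<Sum>\<alpha>\<in>wcls n k. (norm (1 / q ^ invs \<alpha>))\<^sup>2)"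

lemma qfact_pos: "t > 0 \<Longrightarrow> qfact t m > 0"
  unfolding qfact_def by (intro prod_pos ballI sum_pos) (auto simp: Suc_le_eq)

lemma qmfact_pos: "t > 0 \<Longrightarrow> qmfact t n k > 0"
  unfolding qmfact_def by (intro prod_pos) (simp add: qfact_pos)

lemma ball_w_pos: "q \<noteq> 0 \<Longrightarrow> ball_w q n k > 0"
  unfolding ball_w_def by (simp add: qfact_pos qmfact_pos)

text \<open>By \<open>invs_rev\<close>, multiplying |q|^(-2 inv) of a word by |q|^(2 cross) gives
  |q|^(2 inv) of its reversal. Reversal permutes the words of a content, so the q-multinomial
  theorem at t = |q|^2 evaluates the sum.\<close>

lemma ball_w_invmass:
  assumes q: "q \<noteq> 0" and k: "k \<in> midx n"
  shows "(ball_w q n k)\<^sup>2 * invmass n q k = 1"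
proof -
  let ?t = "(norm q)\<^sup>2"
  have t: "?t > 0" using q by simp
  have "(norm (1 / q ^ invs \<alpha>))\<^sup>2 * ?t ^ cross n k = ?t ^ invs (rev \<alpha>)" if "\<alpha> \<in> wcls n k" for \<alpha>
  proof -
    have "cross n k = invs \<alpha> + invs (rev \<alpha>)" using that invs_rev[of \<alpha> n] by (auto simp: wcls_def)
    then show ?thesis using q by (simp add: power_add norm_divide norm_power power_divide power_mult[symmetric] mult.commute)
  qed
  then have "invmass n q k * ?t ^ cross n k = (\<Sum>\<alpha>\<in>wcls n k. ?t ^ invs (rev \<alpha>))"
    unfolding invmass_def sum_distrib_right by (intro sum.cong) auto
  also have "\<dots> = (\<Sum>\<alpha>\<in>wcls n k. ?t ^ invs \<alpha>)"
    by (rule sum.reindex_bij_witness[where i = rev and j = rev]) (auto simp: wcls_def fun_eq_iff)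
  finally have "invmass n q k * ?t ^ cross n k * qmfact ?t n k = qfact ?t (mdeg n k)"
    using sum_invs_qmultinomial[OF k, of ?t] by simp
  moreover have "(ball_w q n k)\<^sup>2 = qmfact ?t n k / qfact ?t (mdeg n k) * ?t ^ cross n k"
    using qfact_pos[OF t, of "mdeg n k"] qmfact_pos[OF t, of n k]
    unfolding ball_w_def by (simp add: power_mult_distrib power_mult[symmetric] mult.commute)
  ultimately have "((ball_w q n k)\<^sup>2 * invmass n q k) * qfact ?t (mdeg n k) = 1 * qfact ?t (mdeg n k)"
    using qfact_pos[OF t, of "mdeg n k"] by (simp add: mult_ac)
  then show ?thesis using qfact_pos[OF t, of "mdeg n k"] by simp
qed

text \<open>The n-th root y of x reduces the claim to (d + 1) y^d, which is at most 1 + y + ... +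
  y^d and hence at most 1 / (1 - y).\<close>

lemma polynomial_times_geometric_bounded:
  fixes x :: real
  assumes "0 < x" "x < 1"
  obtains C where "C > 0" "\<And>d :: nat. real ((d + 1) ^ n) * x ^ d \<le> C"
proof (cases "n = 0")
  case True
  then show thesis using assms that[of 1] by (simp add: power_le_one)
next
  case False
  define y where "y = root n x"
  have y: "0 < y" "y < 1" "y ^ n = x" using False assms by (auto simp: y_def)
  have b: "real (d + 1) * y ^ d \<le> 1 / (1 - y)" for d
  proof -
    have "real (d + 1) * y ^ d = (\<Sum>i\<le>d. y ^ d)" by simp
    also have "\<dots> \<le> (\<Sum>i\<le>d. y ^ i)" using y by (intro sum_mono power_decreasing) auto
    also have "\<dots> = (1 - y ^ Suc d) / (1 - y)" using y by (simp add: sum_gp0)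
    also have "\<dots> \<le> 1 / (1 - y)" using y by (intro divide_right_mono) auto
    finally show ?thesis .
  qed
  have "real ((d + 1) ^ n) * x ^ d \<le> (1 / (1 - y)) ^ n" for d
  proof -
    have "real ((d + 1) ^ n) * x ^ d = (real (d + 1) * y ^ d) ^ n"
      by (simp add: y(3)[symmetric] power_mult_distrib power_mult[symmetric] mult.commute)
    also have "\<dots> \<le> (1 / (1 - y)) ^ n" using y b[of d] by (intro power_mono) auto
    finally show ?thesis .
  qed
  then show thesis using y that[of "(1 / (1 - y)) ^ n"] by simp
qed

text \<open>The preimage of least l2 norm: on each content class it is a multiple of the vector
  representing the functional \<open>phi\<close>, whence the conjugate and the division by the
  squared norm of that functional.\<close>

definition sect2 :: "nat \<Rightarrow> complex \<Rightarrow> ((nat \<Rightarrow> nat) \<Rightarrow> complex) \<Rightarrow> nat list \<Rightarrow> complex" where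
  "sect2 n q b \<alpha> = (if \<alpha> \<in> words n
     then b (count_list \<alpha>) * cnj (1 / q ^ invs \<alpha>) / of_real (invmass n q (count_list \<alpha>)) else 0)"

text \<open>Cauchy-Schwarz on a content class bounds one coefficient of \<open>phi\<close> with
  constant 1, as \<open>ball_w\<close> is the reciprocal of the norm of the functional. Radius is
  lost only when the bounds for all contents of a degree are added up.\<close>

lemma fiber_setup_nl2:
  assumes r: "0 < r" and q: "q \<noteq> 0"
  shows "fiber_setup n (nl2 n ` {\<rho>. 0 < \<rho> \<and> ereal \<rho> < r}) r q (ball_w q n) (sect2 n q)"
proof -
  let ?T = "{\<rho>. 0 < \<rho> \<and> ereal \<rho> < r}"
  let ?L = "\<lambda>c. L2_set (\<lambda>\<alpha>. norm (c \<alpha> :: complex))"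
  obtain \<rho>0 :: real where "0 < \<rho>0" "ereal \<rho>0 < r" using ereal_dense2[OF r] by (metis ereal_less(2))
  then interpret graded_norms n "nl2 n ` ?T"
    by (intro graded_norms_nl2) auto
  have mass: "(ball_w q n k)\<^sup>2 * invmass n q k = 1" "ball_w q n k > 0" "invmass n q k > 0"
    "ball_w q n k * sqrt (invmass n q k) = 1" if "k \<in> midx n" for k
  proof -
    show 1: "(ball_w q n k)\<^sup>2 * invmass n q k = 1" using ball_w_invmass[OF q that] .
    show 2: "ball_w q n k > 0" using ball_w_pos[OF q] .
    show "invmass n q k > 0" using 1 2 by (metis zero_less_mult_pos zero_less_one zero_less_power)
    have "sqrt ((ball_w q n k)\<^sup>2 * invmass n q k) = ball_w q n k * sqrt (invmass n q k)"
      using 2 by (simp add: real_sqrt_mult)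
    then show "ball_w q n k * sqrt (invmass n q k) = 1" using 1 by simp
  qed
  show ?thesis
  proof
    show "ball_w q n k > 0" for k using ball_w_pos[OF q] .
    fix \<rho> :: real assume \<rho>: "0 < \<rho>" "ereal \<rho> < r"
    \<comment> \<open>A radius strictly between \<open>\<rho>\<close> and \<open>r\<close>: the
      factor \<open>(\<rho> / \<rho>') ^ d\<close> compensates for the at most (d + 1)^n contents of
      degree d.\<close>
    obtain \<rho>' :: real where \<rho>': "\<rho> < \<rho>'" "ereal \<rho>' < r"
      using ereal_dense2[OF \<rho>(2)] by (metis ereal_less_eq(3) less_ereal.simps(1))
    have x: "0 < \<rho> / \<rho>'" "\<rho> / \<rho>' < 1" using \<rho> \<rho>' by auto
    obtain C where C: "C > 0" "\<And>d :: nat. real ((d + 1) ^ n) * (\<rho> / \<rho>') ^ d \<le> C"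
      using polynomial_times_geometric_bounded[OF x] by blast
    have "(\<Sum>k\<in>kdeg n d. norm (phi n q c k) * ball_w q n k * \<rho> ^ d) \<le> C * nl2 n \<rho>' d c" for c d
    proof -
      have "norm (phi n q c k) * ball_w q n k \<le> ?L c (wdeg n d)" if k: "k \<in> kdeg n d" for k
      proof -
        have km: "k \<in> midx n" "mdeg n k = d" using k by (auto simp: kdeg_def)
        have "norm (phi n q c k) \<le> (\<Sum>\<alpha>\<in>wcls n k. \<bar>norm (c \<alpha>)\<bar> * \<bar>norm (1 / q ^ invs \<alpha>)\<bar>)"
          unfolding phi_def by (rule order_trans[OF norm_sum]) (simp add: norm_divide)
        also have "\<dots> \<le> ?L c (wcls n k) * L2_set (\<lambda>\<alpha>. norm (1 / q ^ invs \<alpha>)) (wcls n k)"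
          by (rule L2_set_mult_ineq)
        also have "L2_set (\<lambda>\<alpha>. norm (1 / q ^ invs \<alpha>)) (wcls n k) = sqrt (invmass n q k)"
          by (simp add: L2_set_def invmass_def)
        finally have "norm (phi n q c k) * ball_w q n k \<le> ?L c (wcls n k) * sqrt (invmass n q k) * ball_w q n k"
          using mass(2)[OF km(1)] by (intro mult_right_mono) auto
        also have "\<dots> = ?L c (wcls n k)" using mass(4)[OF km(1)] by (simp add: mult.assoc mult.commute)
        also have "\<dots> \<le> ?L c (wdeg n d)"
          unfolding L2_set_def using wcls_subset[of n k] km(2) by (intro real_sqrt_le_mono sum_mono2) auto
        finally show ?thesis .
      qed
      then have "(\<Sum>k\<in>kdeg n d. norm (phi n q c k) * ball_w q n k * \<rho> ^ d) \<le> (\<Sum>k\<in>kdeg n d. ?L c (wdeg n d) * \<rho> ^ d)"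
        using \<rho> by (intro sum_mono mult_right_mono) auto
      also have "\<dots> = real (card (kdeg n d)) * (\<rho> / \<rho>') ^ d * (?L c (wdeg n d) * \<rho>' ^ d)"
        using \<rho> \<rho>' by (simp add: power_divide)
      also have "\<dots> \<le> C * (?L c (wdeg n d) * \<rho>' ^ d)"
      proof (rule mult_right_mono)
        have "real (card (kdeg n d)) * (\<rho> / \<rho>') ^ d \<le> real ((d + 1) ^ n) * (\<rho> / \<rho>') ^ d"
          using card_kdeg[of n d] x by (intro mult_right_mono) (simp_all only: of_nat_le_iff zero_le_power less_imp_le)
        also have "\<dots> \<le> C" by (rule C(2))
        finally show "real (card (kdeg n d)) * (\<rho> / \<rho>') ^ d \<le> C" .
        show "?L c (wdeg n d) * \<rho>' ^ d \<ge> 0" using \<rho> \<rho>' by simp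
      qed
      finally show ?thesis unfolding nl2_def .
    qed
    moreover have "nl2 n \<rho>' \<in> nl2 n ` ?T" using \<rho> \<rho>' by auto
    ultimately show "\<exists>N\<in>nl2 n ` ?T. \<exists>C>0. \<forall>c d.
        (\<Sum>k\<in>kdeg n d. norm (phi n q c k) * ball_w q n k * \<rho> ^ d) \<le> C * N d c"
      using C(1) by (intro bexI[of _ "nl2 n \<rho>'"] exI[of _ C] conjI allI) auto
  next
    fix b k assume k: "k \<in> midx n"
    have "phi n q (sect2 n q b) k = (\<Sum>\<alpha>\<in>wcls n k. b k / of_real (invmass n q k) * of_real ((norm (1 / q ^ invs \<alpha>))\<^sup>2))"
      unfolding phi_def
    proof (intro sum.cong refl)
      fix \<alpha> assume "\<alpha> \<in> wcls n k"
      then have "sect2 n q b \<alpha> / q ^ invs \<alpha> = b k / of_real (invmass n q k) * ((1 / q ^ invs \<alpha>) * cnj (1 / q ^ invs \<alpha>))"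
        by (simp add: sect2_def wcls_def)
      then show "sect2 n q b \<alpha> / q ^ invs \<alpha> = b k / of_real (invmass n q k) * of_real ((norm (1 / q ^ invs \<alpha>))\<^sup>2)"
        by (simp only: complex_norm_square)
    qed
    also have "\<dots> = b k / of_real (invmass n q k) * of_real (invmass n q k)"
      unfolding invmass_def by (simp add: sum_distrib_left)
    also have "\<dots> = b k" using mass(3)[OF k] by simp
    finally show "phi n q (sect2 n q b) k = b k" .
  next
    fix N assume "N \<in> nl2 n ` ?T"
    then obtain \<rho> where N: "N = nl2 n \<rho>" and \<rho>: "0 < \<rho>" "ereal \<rho> < r" by auto
    have "N d (sect2 n q b) \<le> 1 * (\<Sum>k\<in>kdeg n d. norm (b k) * ball_w q n k * \<rho> ^ d)" for b d
    proof -
      have "(\<Sum>\<alpha>\<in>wdeg n d. (norm (sect2 n q b \<alpha>))\<^sup>2) = (\<Sum>k\<in>kdeg n d. \<Sum>\<alpha>\<in>wcls n k. (norm (sect2 n q b \<alpha>))\<^sup>2)"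
        by (rule sum_wdeg_group)
      also have "\<dots> = (\<Sum>k\<in>kdeg n d. (norm (b k) * ball_w q n k)\<^sup>2)"
      proof (intro sum.cong refl)
        fix k assume "k \<in> kdeg n d"
        then have k: "k \<in> midx n" by (simp add: kdeg_def)
        have "(\<Sum>\<alpha>\<in>wcls n k. (norm (sect2 n q b \<alpha>))\<^sup>2)
            = (\<Sum>\<alpha>\<in>wcls n k. (norm (b k))\<^sup>2 / (invmass n q k)\<^sup>2 * (norm (1 / q ^ invs \<alpha>))\<^sup>2)"
          by (intro sum.cong refl)
            (auto simp: sect2_def wcls_def norm_mult norm_divide norm_power power_mult_distrib power_divide)
        also have "\<dots> = (norm (b k))\<^sup>2 / (invmass n q k)\<^sup>2 * invmass n q k"
          unfolding invmass_def by (simp add: sum_distrib_left)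
        also have "\<dots> = (norm (b k))\<^sup>2 * (1 / invmass n q k)"
          using mass(3)[OF k] by (simp add: power2_eq_square)
        also have "1 / invmass n q k = (ball_w q n k)\<^sup>2"
          using mass(1,3)[OF k] by (simp add: field_simps)
        finally show "(\<Sum>\<alpha>\<in>wcls n k. (norm (sect2 n q b \<alpha>))\<^sup>2) = (norm (b k) * ball_w q n k)\<^sup>2"
          by (simp add: power_mult_distrib)
      qed
      finally have "?L (sect2 n q b) (wdeg n d) = L2_set (\<lambda>k. norm (b k) * ball_w q n k) (kdeg n d)"
        by (simp add: L2_set_def)
      \<comment> \<open>In this direction the radius stays the same, as an l2 norm is at most the l1
        norm.\<close>
      also have "\<dots> \<le> (\<Sum>k\<in>kdeg n d. norm (b k) * ball_w q n k)"
        by (rule L2_set_le_sum) (auto simp: kdeg_def less_imp_le mass)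
      finally have "?L (sect2 n q b) (wdeg n d) * \<rho> ^ d \<le> (\<Sum>k\<in>kdeg n d. norm (b k) * ball_w q n k) * \<rho> ^ d"
        using \<rho> by (intro mult_right_mono) auto
      then show ?thesis unfolding N nl2_def by (simp add: sum_distrib_right)
    qed
    then show "\<exists>\<rho> C. 0 < \<rho> \<and> ereal \<rho> < r \<and> 0 < C \<and>
        (\<forall>b d. N d (sect2 n q b) \<le> C * (\<Sum>k\<in>kdeg n d. norm (b k) * ball_w q n k * \<rho> ^ d))"
      using \<rho> by (intro exI[of _ \<rho>] exI[of _ 1] conjI allI) auto
  qed (use r q in \<open>auto simp: sect2_def\<close>)
qed

lemma FB_norms_eq: "FB_norms n r = gsum ` nl2 n ` {\<rho>. 0 < \<rho> \<and> ereal \<rho> < r}"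
proof -
  have "(\<Sum>\<^sub>\<infinity>d\<in>(UNIV::nat set). f d) = (\<Sum>d. f d)" for f :: "nat \<Rightarrow> ennreal"
    using infsum_ennreal_graded[of UNIV "\<lambda>d. d" f] by simp
  then have "FB_norms n r = {gsum (nl2 n \<rho>) | \<rho>. 0 < \<rho> \<and> ereal \<rho> < r}"
    unfolding FB_norms_def gsum_def[abs_def] nl2_def L2_set_def wdeg_def by simp
  then show ?thesis by auto
qed

theorem theorem8p3:
  fixes n :: nat and r :: ereal and q :: complex
  assumes "0 < r" and "q \<noteq> 0"
  shows "(\<exists>\<Phi>. talg_iso (fiber (Odef n (FD_norms n r)) q) (Oq_D n r q) \<Phi>
              \<and> (\<forall>i<n. \<Phi> (zeta_cls n (FD_norms n r) q i) = xq i))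
       \<and> (\<exists>\<Phi>. talg_iso (fiber (Odef n (FT_norms n r)) q) (Oq_D n r q) \<Phi>
              \<and> (\<forall>i<n. \<Phi> (zeta_cls n (FT_norms n r) q i) = xq i))
       \<and> (\<exists>\<Phi>. talg_iso (fiber (Odef n (FB_norms n r)) q) (Oq_B n r q) \<Phi>
              \<and> (\<forall>i<n. \<Phi> (zeta_cls n (FB_norms n r) q i) = xq i))"
  unfolding FD_norms_eq FT_norms_eq FB_norms_eq Oq_D_def Oq_B_def
  by (intro conjI fiber_setup.fiber_iso[OF fiber_setup_nl1[OF assms]]
      fiber_setup.fiber_iso[OF fiber_setup_nl2[OF assms]]) auto

end
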